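(* Let $\eta:[0,\infty)\to[0,\infty)$ be a continuous non-decreasing function with $\eta(x)>0$ for all $x>0$ and $\lim_{x\to\infty}\eta(x)=+\infty$, and let $(X,A,H,M)$ satisfy condition $\mathcal{A}_{\sup}$ with this $\eta$. Fix $c>0$ and let $G(x)=\int_c^x\frac{\mathrm{d}u}{\eta(u)}$. Then the following assertions hold. **a)** For all stopping times $\tau$ and all deterministic times $T\ge0$, $$\mathbb{E}[G(X_{\tau\wedge T})]\le\mathbb{E}[A_{\tau\wedge T}]+G(\mathbb{E}[H_{\tau\wedge T}]),$$ where the terms take values in $[-\infty,+\infty]$. **b)** Let $T\ge 0$. If $\int_0^\varepsilon\frac{\mathrm{d}u}{\eta(u)}=+\infty$ for all $\varepsilon>0$ and $H_T=0$, then $X^*_T=0$ $\mathbb{P}$-almost surely. **c)** Let $T\ge 0$, and let $(X^{(n)},A,H^{(n)},M^{(n)})$ satisfy condition $\mathcal{A}_{\sup}$ for each $n\in\mathbb{N}$ with $\eta$ (and $A$) not depending on $n$. If $\int_0^\varepsilon\frac{\mathrm{d}u}{\eta(u)}=+\infty$ for all $\varepsilon>0$ and $\lim_{n\to\infty}\mathbb{E}[H^{(n)}_T]=0$, then $$\lim_{n\to\infty}\mathbb{P}\Big[\sup_{t\in[0,T]}X^{(n)}_t>\delta\Big]=0\qquad\text{for each }\delta>0.$$ **d)** If $X_t\ge c$ for all $t\in[0,T]$ for some $T>0$ (where $c$ is the constant in the definition of $G$), then for any $p\in(0,1)$ $$\|G(X^*_T)\|_p\le\alpha_1\alpha_2\,\|A_T+G(\mathbb{E}[H_T])\|_p,$$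 where $\alpha_1=(1-p)^{-1/p}$ and $\alpha_2=p^{-1}$. If in addition $\int_1^\infty\frac{\mathrm{d}u}{\eta(u)}=+\infty$, $\mathbb{E}[A_T^p]<\infty$ and $\mathbb{E}[H_T]<\infty$, this guarantees that $X^*_T$ is almost surely finite.
   Context: All processes are defined on a filtered probability space $(\Omega,\mathcal{F},\mathbb{P},(\mathcal{F}_t)_{t\ge0})$ satisfying the usual conditions. Condition $\mathcal{A}_{\sup}$ for $(X,A,H,M)$ with $\eta$: $(X_t)_{t\ge0}$ is an adapted non-negative right-continuous process, $(A_t)_{t\ge0}$ is a predictable non-decreasing càdlàg process with $A_0=0$, $(H_t)_{t\ge0}$ is an adapted non-negative non-decreasing càdlàg process, $(M_t)_{t\ge0}$ is a càdlàg local martingale with $M_0=0$, $\eta:[0,\infty)\to[0,\infty)$ is continuous and non-decreasing with $\eta(x)>0$ for all $x>0$, and for all $t\ge0$ $$X_t\le\int_{(0,t]}\eta(X^*_{s^-})\,\mathrm{d}A_s+M_t+H_t\qquad\mathbb{P}\text{-a.s.}$$ Running supremum: $X^*_t=\sup_{0\le s\le t}X_s$, $X^*_{t^-}=\lim_{s\nearrow t}X^*_s=\sup_{s<t}X_s$ for $t>0$, $X^*_{0^-}=X_0$ (values in $[0,+\infty]$). $G$ is defined on $[0,\infty)$ with $G(0)\in[-\infty,0)$, and $G(+\infty)=\lim_{x\to\infty}G(x)$. $\|Y\|_p=\mathbb{E}[|Y|^p]^{1/p}$ for random variables $Y$. In a), the inequality is regarded as trivially true if the right-hand side is $+\infty$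 or of the form $\infty-\infty$. *)

theory Defs
  imports "HOL-Probability.Probability"
begin

section \<open>Filtered probability spaces\<close>

text \<open>Time is the half-line \<^term>\<open>{0..} :: real set\<close>: the values of filtrations and processes
  at negative times are irrelevant, and every condition below is guarded accordingly.\<close>

locale usual_filtered_prob_space = prob_space P for P :: "'a measure" +
  fixes F :: "real \<Rightarrow> 'a measure"
  assumes subalgebra_F: "0 \<le> t \<Longrightarrow> subalgebra P (F t)"
    and sets_F_mono: "0 \<le> s \<Longrightarrow> s \<le> t \<Longrightarrow> sets (F s) \<subseteq> sets (F t)"
    and complete_P: "complete_measure P"
    and null_sets_F0: "null_sets P \<subseteq> sets (F 0)"
    and right_continuous_F: "0 \<le> t \<Longrightarrow> (\<Inter>s\<in>{t<..}. sets (F s)) = sets (F t)"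

text \<open>Stopping times take values in \<open>[0,\<infinity>]\<close>. The library notion identifies the index set of the
  filtration with the set of values; at \<^term>\<open>\<top> :: ennreal\<close> its requirement is void (the event is the
  whole space), so the \<sigma>-algebra used there does not matter.\<close>

definition is_stopping_time :: "(real \<Rightarrow> 'a measure) \<Rightarrow> ('a \<Rightarrow> ennreal) \<Rightarrow> bool" where
  "is_stopping_time F \<tau> \<longleftrightarrow> stopping_time (\<lambda>t. F (enn2real t)) \<tau>"

lemma is_stopping_time_iff:
  assumes "\<And>t. 0 \<le> t \<Longrightarrow> space (F t) = \<Omega>"
  shows "is_stopping_time F \<tau> \<longleftrightarrow> (\<forall>t\<ge>0. {\<omega>\<in>\<Omega>. \<tau> \<omega> \<le> ennreal t} \<in> sets (F t))"
proof
  assume *: "is_stopping_time F \<tau>"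
  show "\<forall>t\<ge>0. {\<omega>\<in>\<Omega>. \<tau> \<omega> \<le> ennreal t} \<in> sets (F t)"
  proof (intro allI impI)
    fix t :: real assume t: "0 \<le> t"
    have "Measurable.pred (F (enn2real (ennreal t))) (\<lambda>\<omega>. \<tau> \<omega> \<le> ennreal t)"
      using * unfolding is_stopping_time_def stopping_time_def by blast
    then show "{\<omega>\<in>\<Omega>. \<tau> \<omega> \<le> ennreal t} \<in> sets (F t)"
      using t assms[OF t] by (simp add: pred_def)
  qed
next
  assume *: "\<forall>t\<ge>0. {\<omega>\<in>\<Omega>. \<tau> \<omega> \<le> ennreal t} \<in> sets (F t)"
  show "is_stopping_time F \<tau>"
    unfolding is_stopping_time_def stopping_time_def
  proof
    fix t :: ennreal
    show "Measurable.pred (F (enn2real t)) (\<lambda>\<omega>. \<tau> \<omega> \<le> t)"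
      using * assms by (cases t) (auto simp: pred_def)
  qed
qed

definition stopped_time :: "('a \<Rightarrow> ennreal) \<Rightarrow> real \<Rightarrow> 'a \<Rightarrow> real" where
  "stopped_time \<tau> t \<omega> = enn2real (min (\<tau> \<omega>) (ennreal t))"

section \<open>Processes\<close>

definition adapted :: "(real \<Rightarrow> 'a measure) \<Rightarrow> (real \<Rightarrow> 'a \<Rightarrow> real) \<Rightarrow> bool" where
  "adapted F Y \<longleftrightarrow> (\<forall>t\<ge>0. Y t \<in> borel_measurable (F t))"

definition right_continuous :: "(real \<Rightarrow> real) \<Rightarrow> bool" where
  "right_continuous f \<longleftrightarrow> (\<forall>t\<ge>0. continuous (at_right t) f)"

definition cadlag :: "(real \<Rightarrow> real) \<Rightarrow> bool" where
  "cadlag f \<longleftrightarrow> right_continuous f \<and> (\<forall>t>0. \<exists>l. (f \<longlongrightarrow> l) (at_left t))"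

definition predictable_sigma :: "'a measure \<Rightarrow> (real \<Rightarrow> 'a measure) \<Rightarrow> (real \<times> 'a) measure" where
  "predictable_sigma P F = sigma ({0..} \<times> space P)
     ({{0} \<times> B | B. B \<in> sets (F 0)} \<union>
      {{s<..t} \<times> B | s t B. 0 \<le> s \<and> s \<le> t \<and> B \<in> sets (F s)})"

definition predictable ::
    "'a measure \<Rightarrow> (real \<Rightarrow> 'a measure) \<Rightarrow> (real \<Rightarrow> 'a \<Rightarrow> real) \<Rightarrow> bool" where
  "predictable P F Y \<longleftrightarrow> (\<lambda>(t, \<omega>). Y t \<omega>) \<in> borel_measurable (predictable_sigma P F)"

definition martingale ::
    "'a measure \<Rightarrow> (real \<Rightarrow> 'a measure) \<Rightarrow> (real \<Rightarrow> 'a \<Rightarrow> real) \<Rightarrow> bool" where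
  "martingale P F N \<longleftrightarrow> adapted F N \<and> (\<forall>t\<ge>0. integrable P (N t)) \<and>
     (\<forall>s t. 0 \<le> s \<and> s \<le> t \<longrightarrow> (AE \<omega> in P. real_cond_exp P (F s) (N t) \<omega> = N s \<omega>))"

definition cadlag_local_martingale ::
    "'a measure \<Rightarrow> (real \<Rightarrow> 'a measure) \<Rightarrow> (real \<Rightarrow> 'a \<Rightarrow> real) \<Rightarrow> bool" where
  "cadlag_local_martingale P F N \<longleftrightarrow>
     adapted F N \<and> (\<forall>\<omega>\<in>space P. cadlag (\<lambda>t. N t \<omega>)) \<and>
     (\<exists>\<tau> :: nat \<Rightarrow> 'a \<Rightarrow> ennreal.
        (\<forall>n. is_stopping_time F (\<tau> n)) \<and>
        (AE \<omega> in P. incseq (\<lambda>n. \<tau> n \<omega>) \<and> (\<lambda>n. \<tau> n \<omega>) \<longlonglongrightarrow> \<top>) \<and>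
        (\<forall>n. martingale P F (\<lambda>t \<omega>. N (stopped_time (\<tau> n) t \<omega>) \<omega> - N 0 \<omega>)))"

definition running_sup :: "(real \<Rightarrow> 'a \<Rightarrow> real) \<Rightarrow> real \<Rightarrow> 'a \<Rightarrow> ennreal" where
  "running_sup X t \<omega> = (SUP s\<in>{0..t}. ennreal (X s \<omega>))"

definition running_sup_left :: "(real \<Rightarrow> 'a \<Rightarrow> real) \<Rightarrow> real \<Rightarrow> 'a \<Rightarrow> ennreal" where
  "running_sup_left X t \<omega> =
     (if t \<le> 0 then ennreal (X 0 \<omega>) else (SUP s\<in>{0..<t}. ennreal (X s \<omega>)))"

section \<open>Condition A_sup\<close>

text \<open>The paths of \<open>X\<close> need not have left limits, so the left limit of the running supremum can be
  infinite; \<open>\<eta>\<close> is extended to \<open>\<infinity>\<close> by its limit.\<close>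

definition eta_ext :: "(real \<Rightarrow> real) \<Rightarrow> ennreal \<Rightarrow> ennreal" where
  "eta_ext \<eta> x = (if x = \<top> then Lim at_top (\<lambda>r. ennreal (\<eta> r)) else ennreal (\<eta> (enn2real x)))"

text \<open>Lebesgue-Stieltjes integral over \<open>(0,t]\<close>. The integrator is continued constantly to the negative
  half-line since \<^const>\<open>interval_measure\<close> expects a function on all of \<open>\<real>\<close>.\<close>

definition stieltjes_integral :: "(real \<Rightarrow> ennreal) \<Rightarrow> (real \<Rightarrow> real) \<Rightarrow> real \<Rightarrow> ennreal" where
  "stieltjes_integral f a t = (\<integral>\<^sup>+s\<in>{0<..t}. f s \<partial>interval_measure (\<lambda>s. a (max 0 s)))"

definition condition_A_sup ::
    "'a measure \<Rightarrow> (real \<Rightarrow> 'a measure) \<Rightarrow> (real \<Rightarrow> real) \<Rightarrow> (real \<Rightarrow> 'a \<Rightarrow> real) \<Rightarrow>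
     (real \<Rightarrow> 'a \<Rightarrow> real) \<Rightarrow> (real \<Rightarrow> 'a \<Rightarrow> real) \<Rightarrow> (real \<Rightarrow> 'a \<Rightarrow> real) \<Rightarrow> bool" where
  "condition_A_sup P F \<eta> X A H M \<longleftrightarrow>
     adapted F X \<and>
     (\<forall>\<omega>\<in>space P. (\<forall>t\<ge>0. 0 \<le> X t \<omega>) \<and> right_continuous (\<lambda>t. X t \<omega>)) \<and>
     predictable P F A \<and>
     (\<forall>\<omega>\<in>space P. A 0 \<omega> = 0 \<and> mono_on {0..} (\<lambda>t. A t \<omega>) \<and> cadlag (\<lambda>t. A t \<omega>)) \<and>
     adapted F H \<and>
     (\<forall>\<omega>\<in>space P. (\<forall>t\<ge>0. 0 \<le> H t \<omega>) \<and> mono_on {0..} (\<lambda>t. H t \<omega>) \<and> cadlag (\<lambda>t. H t \<omega>)) \<and>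
     cadlag_local_martingale P F M \<and> (\<forall>\<omega>\<in>space P. M 0 \<omega> = 0) \<and>
     continuous_on {0..} \<eta> \<and> mono_on {0..} \<eta> \<and> (\<forall>x\<ge>0. 0 \<le> \<eta> x) \<and> (\<forall>x>0. 0 < \<eta> x) \<and>
     (\<forall>t\<ge>0. AE \<omega> in P.
        ereal (X t \<omega>)
          \<le> enn2ereal (stieltjes_integral (\<lambda>s. eta_ext \<eta> (running_sup_left X s \<omega>)) (\<lambda>s. A s \<omega>) t)
             + ereal (M t \<omega>) + ereal (H t \<omega>))"

section \<open>The function G, expectations and norms\<close>

text \<open>The oriented integral of \<open>1 / \<eta>\<close> from \<open>c\<close> to \<open>x\<close>. It is a difference of non-negative integrals, not
  a Bochner interval integral, because the latter would be \<open>0\<close> instead of \<open>-\<infinity>\<close> at \<open>x = 0\<close> when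
  \<open>1 / \<eta>\<close> is not integrable at the origin.\<close>

definition G :: "(real \<Rightarrow> real) \<Rightarrow> real \<Rightarrow> real \<Rightarrow> ereal" where
  "G \<eta> c x = (if c \<le> x then enn2ereal (\<integral>\<^sup>+u\<in>{c<..<x}. ennreal (1 / \<eta> u) \<partial>lborel)
              else - enn2ereal (\<integral>\<^sup>+u\<in>{x<..<c}. ennreal (1 / \<eta> u) \<partial>lborel))"

definition G_ext :: "(real \<Rightarrow> real) \<Rightarrow> real \<Rightarrow> ennreal \<Rightarrow> ereal" where
  "G_ext \<eta> c x = (if x = \<top> then Lim at_top (G \<eta> c) else G \<eta> c (enn2real x))"

text \<open>Since \<open>\<infinity> - \<infinity> = \<infinity>\<close> in \<^typ>\<open>ereal\<close>, an upper bound other than \<open>\<infinity>\<close> on this expectation includes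
  the claim that the positive part has finite expectation, i.e. that the expectation is well defined. Likewise \<open>\<infinity> + (-\<infinity>) = \<infinity>\<close> in \<^typ>\<open>ereal\<close>: an inequality
  whose right-hand side is \<open>\<infinity>\<close> or of the form \<open>\<infinity> - \<infinity>\<close> is trivially true.\<close>

definition ereal_expectation :: "'a measure \<Rightarrow> ('a \<Rightarrow> ereal) \<Rightarrow> ereal" where
  "ereal_expectation P Y =
     enn2ereal (\<integral>\<^sup>+\<omega>. e2ennreal (Y \<omega>) \<partial>P) - enn2ereal (\<integral>\<^sup>+\<omega>. e2ennreal (- Y \<omega>) \<partial>P)"

definition ennreal_powr :: "ennreal \<Rightarrow> real \<Rightarrow> ennreal" where
  "ennreal_powr x p = (if x = \<top> then \<top> else ennreal (enn2real x powr p))"  \<comment> \<open>for \<open>p > 0\<close>\<close>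

definition Lp_norm :: "'a measure \<Rightarrow> real \<Rightarrow> ('a \<Rightarrow> ereal) \<Rightarrow> ennreal" where
  "Lp_norm P p Y = ennreal_powr (\<integral>\<^sup>+\<omega>. ennreal_powr (e2ennreal \<bar>Y \<omega>\<bar>) p \<partial>P) (1 / p)"

definition osgood_at_0 :: "(real \<Rightarrow> real) \<Rightarrow> bool" where
  "osgood_at_0 \<eta> \<longleftrightarrow> (\<forall>\<epsilon>>0. (\<integral>\<^sup>+u\<in>{0<..<\<epsilon>}. ennreal (1 / \<eta> u) \<partial>lborel) = \<top>)"

end

theory Submission
  imports Defs
begin

text \<open>For a level \<open>u\<close>, stop at the first passage of \<open>X\<close> above \<open>u\<close>. Up to that time
  \<open>X\<^sup>*\<^sub>s\<^sub>- \<le> u\<close>, and optional stopping removes the local martingale, so that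
  \<open>E[X\<^sub>\<tau> \<and> u] \<le> h \<and> u + E[\<integral>\<^bsub>(0,\<tau>]\<^esub> 1{X\<^sup>*\<^sub>s\<^sub>- \<le> u} \<eta>(X\<^sup>*\<^sub>s\<^sub>-) dA\<^sub>s]\<close> with \<open>h = E[H\<^sub>\<tau>]\<close>.
  Since \<open>1/\<eta>\<close> decreases to \<open>0\<close>, it is the tail of the measure \<open>\<nu> = -d(1/\<eta>)\<close>, and integrating over \<open>u\<close>
  against \<open>\<nu>\<close> turns \<open>x \<and> u\<close> into \<open>\<integral>\<^sub>0\<^sup>x dv/\<eta>(v)\<close> and \<open>1{y \<le> u} \<eta>(y)\<close> into \<open>1\<close>. This gives
  \<open>E[\<Gamma>(X\<^sub>\<tau>)] \<le> E[A\<^sub>\<tau>] + \<Gamma>(E[H\<^sub>\<tau>])\<close> for \<open>\<Gamma>(x) = \<integral>\<^sub>0\<^sup>x dv/\<eta>(v)\<close>, without Ito's formula; if \<open>1/\<eta>\<close> is not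
  integrable at \<open>0\<close>, replace \<open>\<eta>\<close> by \<open>max \<eta> (\<eta> e)\<close> and let \<open>e\<close> tend to \<open>0\<close>, which is a). For b), c) and d)
  the process is in addition stopped strictly before the predictable process \<open>A\<close> reaches a level \<open>k\<close>, which
  yields Lenglart's inequality with truncation \<open>A\<^sub>T \<and> k\<close>; in d) it is integrated over the levels.\<close>

section \<open>Stopping times and right-continuous paths\<close>

text \<open>The level \<open>u\<close> replaces a change of variables: only the bounded quantity
  \<open>min X u\<close> is compared in expectation, so \<open>X\<close> needs no left limits and
  need not be a semimartingale. The obstacle is that the hypothesis holds almost surely for each
  fixed time, while random times are needed; right-continuity transfers it only while
  \<open>X\<close> is bounded, and the passage times provide just that. For a), the primitives from
  \<open>0\<close> and from \<open>c\<close> differ, where \<open>\<eta>\<close> is not raised, by a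
  constant that is finite and cancels. For the tail bounds, stopping when \<open>A\<close> first
  reaches \<open>k\<close> would let a jump of \<open>A\<close> overshoot \<open>k\<close>; stopping
  earlier requires times that announce this passage. They come from an inner regularity argument in
  which the compact sets are replaced by sets whose arrival is known a little in advance. Truncating
  at \<open>p x\<close> in d) yields the constant \<open>p powr (-p) / (1 - p)\<close>, whose power
  \<open>1 / p\<close> is \<open>\<alpha>\<^sub>1 \<alpha>\<^sub>2\<close>.\<close>

context usual_filtered_prob_space
begin

lemma space_F: "0 \<le> t \<Longrightarrow> space (F t) = space P"
  using subalgebra_F[of t] by (simp add: subalgebra_def)

lemma in_sets_F_imp: "0 \<le> t \<Longrightarrow> B \<in> sets (F t) \<Longrightarrow> B \<in> sets P"
  using subalgebra_F[of t] by (auto simp: subalgebra_def)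

lemma measurable_F_imp: "0 \<le> t \<Longrightarrow> f \<in> borel_measurable (F t) \<Longrightarrow> f \<in> borel_measurable P"
  using measurable_from_subalg[OF subalgebra_F[of t]] by blast

lemma measurable_F_mono:
  assumes "0 \<le> s" "s \<le> t" "f \<in> borel_measurable (F s)"
  shows "f \<in> borel_measurable (F t)"
proof -
  have "subalgebra (F t) (F s)"
    using assms sets_F_mono[of s t] by (simp add: subalgebra_def space_F)
  then show ?thesis using assms(3) measurable_from_subalg by blast
qed

lemma stop_iff:
  "is_stopping_time F \<theta> \<longleftrightarrow> (\<forall>t\<ge>0. {\<omega>\<in>space P. \<theta> \<omega> \<le> ennreal t} \<in> sets (F t))"
  by (rule is_stopping_time_iff) (rule space_F)

lemma stopD: "is_stopping_time F \<theta> \<Longrightarrow> 0 \<le> t \<Longrightarrow> {\<omega>\<in>space P. \<theta> \<omega> \<le> ennreal t} \<in> sets (F t)"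
  by (simp add: stop_iff)

lemma stop_measurable: "is_stopping_time F \<theta> \<Longrightarrow> \<theta> \<in> borel_measurable P"
proof (rule borel_measurableI_le)
  fix t :: ennreal assume \<theta>: "is_stopping_time F \<theta>"
  show "{\<omega>\<in>space P. \<theta> \<omega> \<le> t} \<in> sets P"
  proof (cases t)
    case (real r)
    then show ?thesis using stopD[OF \<theta>] in_sets_F_imp by blast
  qed simp
qed

lemma stopD_less:
  assumes "is_stopping_time F \<theta>" "0 \<le> t"
  shows "{\<omega>\<in>space P. \<theta> \<omega> < ennreal t} \<in> sets (F t)"
proof -
  have *: "\<theta> \<omega> < ennreal t \<longleftrightarrow> (\<exists>q\<in>\<rat> \<inter> {0..<t}. \<theta> \<omega> \<le> ennreal q)" for \<omega>
  proof
    assume *: "\<theta> \<omega> < ennreal t"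
    then obtain r where r: "\<theta> \<omega> = ennreal r" "0 \<le> r" by (cases "\<theta> \<omega>") auto
    with * have "r < t" by (simp add: ennreal_less_iff)
    then obtain q where "q \<in> \<rat>" "r < q" "q < t" using Rats_dense_in_real by blast
    with r show "\<exists>q\<in>\<rat> \<inter> {0..<t}. \<theta> \<omega> \<le> ennreal q" by (intro bexI[of _ q]) (auto intro: ennreal_leI)
  qed (auto simp: ennreal_less_iff intro: le_less_trans)
  have "{\<omega>\<in>space P. \<theta> \<omega> < ennreal t} = (\<Union>q\<in>\<rat> \<inter> {0..<t}. {\<omega>\<in>space P. \<theta> \<omega> \<le> ennreal q})"
    using * by auto
  also have "\<dots> \<in> sets (F t)"
  proof (intro sets.countable_UN' image_subsetI)
    fix q assume "q \<in> \<rat> \<inter> {0..<t}"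
    then show "{\<omega>\<in>space P. \<theta> \<omega> \<le> ennreal q} \<in> sets (F t)"
      using stopD[OF assms(1), of q] sets_F_mono[of q t] by auto
  qed (auto intro!: countable_subset[OF _ countable_rat])
  finally show ?thesis .
qed

text \<open>By right-continuity of the filtration, optional times are stopping times.\<close>

lemma stopI_less:
  assumes "\<And>t. 0 < t \<Longrightarrow> {\<omega>\<in>space P. \<theta> \<omega> < ennreal t} \<in> sets (F t)"
  shows "is_stopping_time F \<theta>"
  unfolding stop_iff
proof (intro allI impI)
  fix t :: real assume t: "0 \<le> t"
  have "{\<omega>\<in>space P. \<theta> \<omega> \<le> ennreal t} \<in> sets (F s)" if s: "t < s" for s
  proof -
    \<comment> \<open>These times decrease to \<open>t\<close> inside \<open>(t, s]\<close>, so the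
      strict events at \<open>r n\<close> all lie in \<open>F s\<close>; letting \<open>s\<close>
      fall to \<open>t\<close> is then right-continuity of the filtration.\<close>
    define r where "r n = t + (s - t) / Suc n" for n
    have r: "t < r n" "r n \<le> s" for n
    proof -
      show "t < r n" using s by (simp add: r_def)
      have "(s - t) / Suc n \<le> (s - t) / 1" using s by (intro divide_left_mono) auto
      then show "r n \<le> s" by (simp add: r_def)
    qed
    have lim: "r \<longlonglongrightarrow> t"
    proof -
      have "(\<lambda>n. t + (s - t) * inverse (real (Suc n))) \<longlonglongrightarrow> t + (s - t) * 0"
        by (intro tendsto_intros LIMSEQ_inverse_real_of_nat)
      then show ?thesis by (simp add: r_def[abs_def] divide_inverse del: of_nat_Suc)
    qed
    have "\<theta> \<omega> \<le> ennreal t \<longleftrightarrow> (\<forall>n. \<theta> \<omega> < ennreal (r n))" for \<omega>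
    proof
      assume "\<theta> \<omega> \<le> ennreal t" then show "\<forall>n. \<theta> \<omega> < ennreal (r n)"
        using r t by (auto intro!: le_less_trans[of "\<theta> \<omega>" "ennreal t"] simp: ennreal_less_iff)
    next
      assume "\<forall>n. \<theta> \<omega> < ennreal (r n)"
      then show "\<theta> \<omega> \<le> ennreal t"
        by (intro LIMSEQ_le_const[OF tendsto_ennrealI[OF lim]]) (auto intro: less_imp_le)
    qed
    then have "{\<omega>\<in>space P. \<theta> \<omega> \<le> ennreal t} = (\<Inter>n. {\<omega>\<in>space P. \<theta> \<omega> < ennreal (r n)})"
      by auto
    also have "\<dots> \<in> sets (F s)"
    proof (intro sets.countable_INT'[of UNIV] image_subsetI)
      fix n
      have "0 < r n" using r(1)[of n] t by linarith
      with assms[OF this] sets_F_mono[OF _ r(2)[of n]]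
      show "{\<omega>\<in>space P. \<theta> \<omega> < ennreal (r n)} \<in> sets (F s)"
        by (meson less_imp_le subsetD)
    qed auto
    finally show ?thesis .
  qed
  then show "{\<omega>\<in>space P. \<theta> \<omega> \<le> ennreal t} \<in> sets (F t)"
    using right_continuous_F[OF t] by auto
qed

lemma stop_min:
  assumes "is_stopping_time F \<theta>" "is_stopping_time F \<theta>'"
  shows "is_stopping_time F (\<lambda>\<omega>. min (\<theta> \<omega>) (\<theta>' \<omega>))"
proof -
  have "{\<omega>\<in>space P. min (\<theta> \<omega>) (\<theta>' \<omega>) \<le> ennreal t}
    = {\<omega>\<in>space P. \<theta> \<omega> \<le> ennreal t} \<union> {\<omega>\<in>space P. \<theta>' \<omega> \<le> ennreal t}" for t
    by (auto simp: min_le_iff_disj)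
  with assms show ?thesis by (auto simp: stop_iff)
qed

lemma stop_const: "is_stopping_time F (\<lambda>\<omega>. c)"
  by (simp add: is_stopping_time_def stopping_time_const)

lemma stop_INF:
  assumes "\<And>j::nat. is_stopping_time F (\<theta> j)"
  shows "is_stopping_time F (\<lambda>\<omega>. INF j. \<theta> j \<omega>)"
proof (rule stopI_less)
  fix t :: real assume t: "0 < t"
  have "{\<omega>\<in>space P. (INF j. \<theta> j \<omega>) < ennreal t} = (\<Union>j. {\<omega>\<in>space P. \<theta> j \<omega> < ennreal t})"
    by (auto simp: INF_less_iff)
  then show "{\<omega>\<in>space P. (INF j. \<theta> j \<omega>) < ennreal t} \<in> sets (F t)"
    using stopD_less[OF assms] t by auto
qed

lemma stopped_time_nonneg [simp]: "0 \<le> stopped_time \<theta> t \<omega>"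
  by (simp add: stopped_time_def)

lemma ennreal_stopped_time: "0 \<le> t \<Longrightarrow> ennreal (stopped_time \<theta> t \<omega>) = min (\<theta> \<omega>) (ennreal t)"
  unfolding stopped_time_def
  by (subst ennreal_enn2real) (auto simp: min_less_iff_disj)

lemma stopped_time_le: "0 \<le> t \<Longrightarrow> stopped_time \<theta> t \<omega> \<le> t"
  using ennreal_stopped_time[of t \<theta> \<omega>] by (metis ennreal_le_iff min.cobounded2)

lemma stopped_time_measurable: "is_stopping_time F \<theta> \<Longrightarrow> stopped_time \<theta> t \<in> borel_measurable P"
  using stop_measurable[of \<theta>] unfolding stopped_time_def by measurable

lemma stopped_time_eq: "0 \<le> t \<Longrightarrow> ennreal t \<le> \<theta> \<omega> \<Longrightarrow> stopped_time \<theta> t \<omega> = t"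
  by (simp add: stopped_time_def min_def)

end

section \<open>Approximating times from the right by lattice points\<close>

text \<open>The next lattice point strictly after \<open>t\<close>. Rounding strictly up serves
  twice: limits are taken from the right, where the paths are continuous, and the event that a
  stopping time is rounded to a given point is known at that point.\<close>

definition grid :: "nat \<Rightarrow> real \<Rightarrow> real" where
  "grid n t = (of_int \<lfloor>t * real (Suc n)\<rfloor> + 1) / real (Suc n)"

lemma grid_gt: "t < grid n t"
  unfolding grid_def by (simp add: pos_less_divide_eq del: of_nat_Suc)

lemma grid_le: "grid n t \<le> t + 1 / Suc n"
proof -
  have "of_int \<lfloor>t * real (Suc n)\<rfloor> + 1 \<le> t * real (Suc n) + 1" by simp
  then have "grid n t \<le> (t * real (Suc n) + 1) / real (Suc n)"
    unfolding grid_def by (intro divide_right_mono) auto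
  also have "\<dots> = t + 1 / Suc n" by (simp add: add_divide_distrib del: of_nat_Suc)
  finally show ?thesis .
qed

lemma grid_le': "grid n t \<le> t + 1"
proof -
  have "1 / Suc n \<le> (1::real)" by simp
  then show ?thesis using grid_le[of n t] by linarith
qed

lemma grid_lim: "(\<lambda>n. grid n t) \<longlonglongrightarrow> t"
proof (rule tendsto_sandwich[of "\<lambda>_. t" _ _ "\<lambda>n. t + 1 / Suc n"])
  show "(\<lambda>n. t + 1 / real (Suc n)) \<longlonglongrightarrow> t"
    using LIMSEQ_inverse_real_of_nat_add[of t] by (simp add: divide_inverse del: of_nat_Suc)
  show "\<forall>\<^sub>F n in sequentially. t \<le> grid n t"
    by (intro always_eventually allI less_imp_le grid_gt)
  show "\<forall>\<^sub>F n in sequentially. grid n t \<le> t + 1 / real (Suc n)"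
    by (intro always_eventually allI grid_le)
qed simp

lemma right_continuous_seq:
  assumes "right_continuous f" "0 \<le> t" "s \<longlonglongrightarrow> t" "\<And>n. t < s n"
  shows "(\<lambda>n. f (s n)) \<longlonglongrightarrow> f t"
proof -
  have "(f \<longlongrightarrow> f t) (at_right t)"
    using assms(1,2) by (simp add: right_continuous_def continuous_within)
  moreover have "filterlim s (at_right t) sequentially"
    using assms(3,4) by (auto simp: filterlim_at less_imp_neq[THEN not_sym] intro!: always_eventually)
  ultimately show ?thesis by (rule filterlim_compose)
qed

lemma right_continuous_grid:
  "right_continuous f \<Longrightarrow> 0 \<le> t \<Longrightarrow> (\<lambda>n. f (grid n t)) \<longlonglongrightarrow> f t"
  using right_continuous_seq grid_lim grid_gt by blast

lemma grid_nonneg: "0 \<le> t \<Longrightarrow> 0 \<le> grid n t"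
  using grid_gt[of t n] by linarith

text \<open>For a fixed mesh the rounded time takes countably many values, so the composition is
  glued from countably many fixed-time variables; right-continuity lets the mesh shrink.\<close>

lemma measurable_right_continuous_at:
  fixes Y :: "real \<Rightarrow> 'a \<Rightarrow> real"
  assumes Y: "\<And>t. 0 \<le> t \<Longrightarrow> Y t \<in> borel_measurable P"
    and rc: "\<And>\<omega>. \<omega> \<in> space P \<Longrightarrow> right_continuous (\<lambda>t. Y t \<omega>)"
    and \<theta>: "\<theta> \<in> borel_measurable P" and nn: "\<And>\<omega>. \<omega> \<in> space P \<Longrightarrow> 0 \<le> \<theta> \<omega>"
  shows "(\<lambda>\<omega>. Y (\<theta> \<omega>) \<omega>) \<in> borel_measurable P"
proof (rule borel_measurable_LIMSEQ_real)
  fix n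
  note \<theta>[measurable]
  \<comment> \<open>\<open>max 0\<close> protects the gluing: it runs over all integers, and nothing
    is known about \<open>Y\<close> at negative times.\<close>
  have "(\<lambda>\<omega>. Y (max 0 ((of_int \<lfloor>\<theta> \<omega> * real (Suc n)\<rfloor> + 1) / real (Suc n))) \<omega>) \<in> borel_measurable P"
  proof (rule measurable_compose_countable[where f = "\<lambda>k \<omega>. Y (max 0 ((of_int k + 1) / real (Suc n))) \<omega>"])
    show "Y (max 0 ((of_int i + 1) / real (Suc n))) \<in> borel_measurable P" for i by (rule Y) auto
    show "(\<lambda>\<omega>. \<lfloor>\<theta> \<omega> * real (Suc n)\<rfloor>) \<in> P \<rightarrow>\<^sub>M count_space UNIV"
      by measurable
  qed
  then show "(\<lambda>\<omega>. Y (max 0 (grid n (\<theta> \<omega>))) \<omega>) \<in> borel_measurable P" by (simp add: grid_def)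
next
  fix \<omega> assume \<omega>: "\<omega> \<in> space P"
  show "(\<lambda>n. Y (max 0 (grid n (\<theta> \<omega>))) \<omega>) \<longlonglongrightarrow> Y (\<theta> \<omega>) \<omega>"
    using right_continuous_grid[OF rc[OF \<omega>] nn[OF \<omega>]] grid_nonneg[OF nn[OF \<omega>]] by (simp add: max_def)
qed

section \<open>Optional stopping\<close>

text \<open>Two regimes: once \<open>\<tau>\<close> has passed, the stopped path is constant to the
  right; before that, it coincides with the original path on some \<open>[t, b]\<close>.\<close>

lemma right_continuous_stopped:
  assumes "right_continuous f"
  shows "right_continuous (\<lambda>t. f (stopped_time \<tau> t \<omega>))"
  unfolding right_continuous_def
proof (intro allI impI)
  fix t :: real assume t: "0 \<le> t"
  show "continuous (at_right t) (\<lambda>t. f (stopped_time \<tau> t \<omega>))"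
  proof (cases "\<tau> \<omega> \<le> ennreal t")
    case True
    have "stopped_time \<tau> s \<omega> = enn2real (\<tau> \<omega>)" if "t \<le> s" for s
    proof -
      have "ennreal t \<le> ennreal s" using that by (rule ennreal_leI)
      with True have "\<tau> \<omega> \<le> ennreal s" by (rule order_trans)
      then show ?thesis by (simp add: stopped_time_def min_absorb1)
    qed
    then have "\<forall>\<^sub>F s in at_right t. f (stopped_time \<tau> s \<omega>) = f (stopped_time \<tau> t \<omega>)"
      by (auto intro!: eventually_at_rightI[of t "t + 1"])
    then show ?thesis
      by (simp add: continuous_within) (rule tendsto_eventually)
  next
    case False
    then obtain b where b: "t < b" "ennreal b \<le> \<tau> \<omega>"
    proof (cases "\<tau> \<omega>")
      case (real r)
      with False t that[of r] show ?thesis by (auto simp: ennreal_le_iff)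
    next
      case top
      then show ?thesis using that[of "t + 1"] by simp
    qed
    have eq: "stopped_time \<tau> s \<omega> = s" if "t \<le> s" "s \<le> b" for s
    proof -
      have "ennreal s \<le> \<tau> \<omega>" using order_trans[OF ennreal_leI[OF that(2)] b(2)] .
      then show ?thesis using that t by (simp add: stopped_time_def min_absorb2)
    qed
    have "\<forall>\<^sub>F s in at_right t. f s = f (stopped_time \<tau> s \<omega>)"
      using b by (auto intro!: eventually_at_rightI[of t b] simp: eq)
    moreover have "(f \<longlongrightarrow> f t) (at_right t)"
      using assms t by (simp add: right_continuous_def continuous_within)
    ultimately show ?thesis
      using b eq[of t] by (auto simp: continuous_within intro: Lim_transform_eventually)
  qed
qed

context usual_filtered_prob_space
begin

lemma martingale_set_integral:
  assumes N: "martingale P F N" and st: "0 \<le> s" "s \<le> t" and B: "B \<in> sets (F s)"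
  shows "(\<integral>\<omega>\<in>B. N s \<omega> \<partial>P) = (\<integral>\<omega>\<in>B. N t \<omega> \<partial>P)"
proof -
  interpret S: sigma_finite_subalgebra P "F s"
    using finite_measure_subalgebra_is_sigma_finite[OF finite_measure_subalgebra.intro[OF finite_measure_axioms]]
      subalgebra_F[OF st(1)] by (simp add: finite_measure_subalgebra_axioms_def)
  have BP: "B \<in> sets P" using in_sets_F_imp[OF st(1) B] .
  have int: "integrable P (N s)" "integrable P (N t)" using N st by (auto simp: martingale_def)
  have "(\<integral>\<omega>\<in>B. N t \<omega> \<partial>P) = (\<integral>\<omega>\<in>B. real_cond_exp P (F s) (N t) \<omega> \<partial>P)"
    by (rule S.real_cond_exp_intA[OF int(2) B])
  also have "\<dots> = (\<integral>\<omega>\<in>B. N s \<omega> \<partial>P)"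
  proof (rule set_lebesgue_integral_cong_AE[OF BP])
    have "AE \<omega> in P. real_cond_exp P (F s) (N t) \<omega> = N s \<omega>" using N st by (auto simp: martingale_def)
    then show "AE \<omega>\<in>B in P. real_cond_exp P (F s) (N t) \<omega> = N s \<omega>" by eventually_elim simp
  qed (use int in auto)
  finally show ?thesis by simp
qed

text \<open>The submartingale property of \<open>(- N - K)\<^sup>+\<close> without conditional
  Jensen: on \<open>{N s < - K}\<close>, an event of \<open>F s\<close>, the positive part is affine
  in \<open>N s\<close>, so its integral is carried to time \<open>t\<close> unchanged, where the
  positive part dominates it.\<close>

lemma martingale_neg_part:
  assumes N: "martingale P F N" and st: "0 \<le> s" "s \<le> t" and B: "B \<in> sets (F s)"
  shows "(\<integral>\<omega>\<in>B. max 0 (- N s \<omega> - K) \<partial>P) \<le> (\<integral>\<omega>\<in>B. max 0 (- N t \<omega> - K) \<partial>P)"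
proof -
  have Ns: "N s \<in> borel_measurable (F s)" using N st by (auto simp: martingale_def adapted_def)
  have int[simp]: "integrable P (N s)" "integrable P (N t)" using N st by (auto simp: martingale_def)
  define B' where "B' = B \<inter> {\<omega>\<in>space P. N s \<omega> < - K}"
  have "{\<omega>\<in>space (F s). N s \<omega> < - K} \<in> sets (F s)" using Ns by measurable
  then have B': "B' \<in> sets (F s)" using B st by (simp add: B'_def space_F)
  have [simp]: "B \<in> sets P" "B' \<in> sets P" using B B' in_sets_F_imp[OF st(1)] by auto
  have si: "set_integrable P S (\<lambda>\<omega>. - N r \<omega> - K)" "set_integrable P S (\<lambda>\<omega>. max 0 (- N r \<omega> - K))"
    if "S \<in> sets P" "integrable P (N r)" for S r
    unfolding set_integrable_def using that by (intro integrable_mult_indicator; simp)+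
  have "(\<integral>\<omega>\<in>B. max 0 (- N s \<omega> - K) \<partial>P) = (\<integral>\<omega>\<in>B'. - N s \<omega> - K \<partial>P)"
    unfolding set_lebesgue_integral_def
    by (intro Bochner_Integration.integral_cong) (auto simp: B'_def indicator_def max_def)
  also have "\<dots> = - (\<integral>\<omega>\<in>B'. N s \<omega> \<partial>P) - (\<integral>\<omega>\<in>B'. K \<partial>P)"
    using integrable_mult_indicator[of B' P "N s"] integrable_mult_indicator[of B' P "\<lambda>_. K"]
    by (simp add: set_lebesgue_integral_def algebra_simps Bochner_Integration.integral_diff)
  also have "\<dots> = - (\<integral>\<omega>\<in>B'. N t \<omega> \<partial>P) - (\<integral>\<omega>\<in>B'. K \<partial>P)"
    using martingale_set_integral[OF N st B'] by simp
  also have "\<dots> = (\<integral>\<omega>\<in>B'. - N t \<omega> - K \<partial>P)"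
    using integrable_mult_indicator[of B' P "N t"] integrable_mult_indicator[of B' P "\<lambda>_. K"]
    by (simp add: set_lebesgue_integral_def algebra_simps Bochner_Integration.integral_diff)
  also have "\<dots> \<le> (\<integral>\<omega>\<in>B. max 0 (- N t \<omega> - K) \<partial>P)"
    unfolding set_lebesgue_integral_def
  proof (rule integral_mono)
    show "integrable P (\<lambda>\<omega>. indicat_real B' \<omega> *\<^sub>R (- N t \<omega> - K))"
      "integrable P (\<lambda>\<omega>. indicat_real B \<omega> *\<^sub>R max 0 (- N t \<omega> - K))"
      using si(1)[of B' t] si(2)[of B t] by (simp_all add: set_integrable_def)
  qed (auto simp: B'_def indicator_def)
  finally show ?thesis .
qed

text \<open>In terms of the bounded time this is \<open>a \<le> min \<theta> T < b\<close>, a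
  difference of two strict events, both known at \<open>b\<close>.\<close>

lemma grid_level_set:
  assumes \<theta>: "is_stopping_time F \<theta>" and T: "0 \<le> T" and i: "0 \<le> i" "(of_int i + 1) / real (Suc n) \<le> T + 1"
  shows "{\<omega>\<in>space P. \<lfloor>stopped_time \<theta> T \<omega> * real (Suc n)\<rfloor> = i} \<in> sets (F ((of_int i + 1) / real (Suc n)))"
proof -
  define a where "a = of_int i / real (Suc n)"
  define b where "b = (of_int i + 1) / real (Suc n)"
  have ab: "0 \<le> a" "a < b" using i by (auto simp: a_def b_def divide_strict_right_mono)
  let ?\<theta> = "\<lambda>\<omega>. min (\<theta> \<omega>) (ennreal T)"
  have st: "is_stopping_time F ?\<theta>" by (intro stop_min \<theta> stop_const)
  have 1: "\<lfloor>stopped_time \<theta> T \<omega> * real (Suc n)\<rfloor> = i \<longleftrightarrow> a \<le> stopped_time \<theta> T \<omega> \<and> stopped_time \<theta> T \<omega> < b" for \<omega>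
    unfolding floor_eq_iff a_def b_def by (simp add: pos_divide_le_eq pos_less_divide_eq del: of_nat_Suc)
  have 2: "a \<le> stopped_time \<theta> T \<omega> \<and> stopped_time \<theta> T \<omega> < b \<longleftrightarrow> ennreal a \<le> ?\<theta> \<omega> \<and> ?\<theta> \<omega> < ennreal b" for \<omega>
    using ab T ennreal_less_iff[of "stopped_time \<theta> T \<omega>" b] ennreal_le_iff[of "stopped_time \<theta> T \<omega>" a]
    unfolding ennreal_stopped_time[OF T, symmetric] by simp
  have "{\<omega>\<in>space P. \<lfloor>stopped_time \<theta> T \<omega> * real (Suc n)\<rfloor> = i}
     = {\<omega>\<in>space P. ?\<theta> \<omega> < ennreal b} - {\<omega>\<in>space P. ?\<theta> \<omega> < ennreal a}"
    unfolding trans[OF 1 2] by (auto simp only: not_le mem_Collect_eq Diff_iff)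
  also have "\<dots> \<in> sets (F b)"
    using stopD_less[OF st, of b] stopD_less[OF st, of a] sets_F_mono[of a b] ab by (intro sets.Diff) auto
  finally show ?thesis by (simp add: b_def)
qed

text \<open>Since the rounded time is at most \<open>T + 1\<close>, it has finitely many values and
  optional stopping becomes a finite sum over the cells \<open>B i\<close>. The third claim cuts any
  integral along the same cells, so that two integrals can be compared cell by cell.\<close>

lemma stopped_grid:
  fixes N :: "real \<Rightarrow> 'a \<Rightarrow> real" and n :: nat and f :: "'a \<Rightarrow> real"
  assumes \<theta>: "is_stopping_time F \<theta>" and T: "0 \<le> T"
    and int: "\<forall>t\<ge>0. integrable P (N t)"
  defines "I \<equiv> {i::int. 0 \<le> i \<and> (of_int i + 1) / real (Suc n) \<le> T + 1}"
  defines "B \<equiv> \<lambda>i. {\<omega>\<in>space P. \<lfloor>stopped_time \<theta> T \<omega> * real (Suc n)\<rfloor> = i}"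
  shows "integrable P (\<lambda>\<omega>. N (grid n (stopped_time \<theta> T \<omega>)) \<omega>)"
    and "(\<integral>\<omega>. N (grid n (stopped_time \<theta> T \<omega>)) \<omega> \<partial>P)
          = (\<Sum>i\<in>I. \<integral>\<omega>\<in>B i. N ((of_int i + 1) / real (Suc n)) \<omega> \<partial>P)"
    and "integrable P f \<Longrightarrow> (\<integral>\<omega>. f \<omega> \<partial>P) = (\<Sum>i\<in>I. \<integral>\<omega>\<in>B i. f \<omega> \<partial>P)"
proof -
  have "I \<subseteq> {0..\<lceil>(T + 1) * real (Suc n)\<rceil>}"
  proof
    fix i assume "i \<in> I"
    then have "0 \<le> i" "of_int i + 1 \<le> (T + 1) * real (Suc n)"
      by (auto simp: I_def pos_divide_le_eq simp del: of_nat_Suc)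
    then have "0 \<le> i" "of_int i \<le> (of_int \<lceil>(T + 1) * real (Suc n)\<rceil> :: real)" by linarith+
    then show "i \<in> {0..\<lceil>(T + 1) * real (Suc n)\<rceil>}" by simp
  qed
  then have fin: "finite I" by (rule finite_subset) simp
  have mem: "\<lfloor>stopped_time \<theta> T \<omega> * real (Suc n)\<rfloor> \<in> I" for \<omega>
    using grid_le'[of n "stopped_time \<theta> T \<omega>"] stopped_time_le[OF T, of \<theta> \<omega>]
    by (auto simp: I_def grid_def simp del: of_nat_Suc)
  have B: "B i \<in> sets P" if "i \<in> I" for i
  proof -
    have i: "0 \<le> i" "(of_int i + 1) / real (Suc n) \<le> T + 1" using that by (simp_all add: I_def)
    have "0 \<le> (of_int i + 1) / real (Suc n)" using i(1) by simp
    from in_sets_F_imp[OF this grid_level_set[OF \<theta> T i]] show ?thesis by (simp only: B_def)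
  qed
  have decomp: "g (\<lfloor>stopped_time \<theta> T \<omega> * real (Suc n)\<rfloor>) = (\<Sum>i\<in>I. indicator (B i) \<omega> *\<^sub>R g i)"
    if "\<omega> \<in> space P" for \<omega> and g :: "int \<Rightarrow> real"
  proof -
    have "(\<Sum>i\<in>I. indicator (B i) \<omega> *\<^sub>R g i)
       = (\<Sum>i\<in>I. if i = \<lfloor>stopped_time \<theta> T \<omega> * real (Suc n)\<rfloor> then g i else 0)"
      using that by (intro sum.cong) (auto simp: B_def)
    then show ?thesis using fin mem by simp
  qed
  have I0: "0 \<le> (of_int i + 1) / real (Suc n)" if "i \<in> I" for i using that by (simp add: I_def)
  have intB: "integrable P (\<lambda>\<omega>. indicator (B i) \<omega> *\<^sub>R N ((of_int i + 1) / real (Suc n)) \<omega>)" if "i \<in> I" for i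
    using that B int I0 by (intro integrable_mult_indicator) auto
  have eq: "N (grid n (stopped_time \<theta> T \<omega>)) \<omega>
    = (\<Sum>i\<in>I. indicator (B i) \<omega> *\<^sub>R N ((of_int i + 1) / real (Suc n)) \<omega>)" if "\<omega> \<in> space P" for \<omega>
    using decomp[OF that, of "\<lambda>i. N ((of_int i + 1) / real (Suc n)) \<omega>"] by (simp add: grid_def)
  show "integrable P (\<lambda>\<omega>. N (grid n (stopped_time \<theta> T \<omega>)) \<omega>)"
    using Bochner_Integration.integrable_cong[THEN iffD2, OF refl eq
        Bochner_Integration.integrable_sum[OF intB]] by blast
  have "(\<integral>\<omega>. N (grid n (stopped_time \<theta> T \<omega>)) \<omega> \<partial>P)
    = (\<integral>\<omega>. (\<Sum>i\<in>I. indicator (B i) \<omega> *\<^sub>R N ((of_int i + 1) / real (Suc n)) \<omega>) \<partial>P)"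
    by (intro Bochner_Integration.integral_cong refl eq)
  also have "\<dots> = (\<Sum>i\<in>I. \<integral>\<omega>\<in>B i. N ((of_int i + 1) / real (Suc n)) \<omega> \<partial>P)"
    unfolding set_lebesgue_integral_def by (intro Bochner_Integration.integral_sum intB)
  finally show "(\<integral>\<omega>. N (grid n (stopped_time \<theta> T \<omega>)) \<omega> \<partial>P)
          = (\<Sum>i\<in>I. \<integral>\<omega>\<in>B i. N ((of_int i + 1) / real (Suc n)) \<omega> \<partial>P)" .
  assume f: "integrable P f"
  have "(\<integral>\<omega>. f \<omega> \<partial>P) = (\<integral>\<omega>. (\<Sum>i\<in>I. indicator (B i) \<omega> *\<^sub>R f \<omega>) \<partial>P)"
  proof (intro Bochner_Integration.integral_cong refl)
    fix \<omega> assume "\<omega> \<in> space P"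
    then show "f \<omega> = (\<Sum>i\<in>I. indicator (B i) \<omega> *\<^sub>R f \<omega>)" by (rule decomp[of \<omega> "\<lambda>_. f \<omega>"])
  qed
  also have "\<dots> = (\<Sum>i\<in>I. \<integral>\<omega>\<in>B i. f \<omega> \<partial>P)"
    unfolding set_lebesgue_integral_def
    using f B by (intro Bochner_Integration.integral_sum integrable_mult_indicator) auto
  finally show "(\<integral>\<omega>. f \<omega> \<partial>P) = (\<Sum>i\<in>I. \<integral>\<omega>\<in>B i. f \<omega> \<partial>P)" .
qed

text \<open>On each cell the martingale at the lattice point is compared with its value at the
  horizon. The horizon is \<open>T + 1\<close> because rounding up may leave
  \<open>[0, T]\<close>.\<close>

lemma martingale_grid:
  assumes N: "martingale P F N" and \<theta>: "is_stopping_time F \<theta>" and T: "0 \<le> T"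
  shows "integrable P (\<lambda>\<omega>. N (grid n (stopped_time \<theta> T \<omega>)) \<omega>)"
    and "(\<integral>\<omega>. N (grid n (stopped_time \<theta> T \<omega>)) \<omega> \<partial>P) = (\<integral>\<omega>. N (T + 1) \<omega> \<partial>P)"
    and "(\<integral>\<omega>. max 0 (- N (grid n (stopped_time \<theta> T \<omega>)) \<omega> - K) \<partial>P) \<le> (\<integral>\<omega>. max 0 (- N (T + 1) \<omega> - K) \<partial>P)"
proof -
  have int: "\<forall>t\<ge>0. integrable P (N t)" using N by (auto simp: martingale_def)
  then have int': "\<forall>t\<ge>0. integrable P (\<lambda>\<omega>. max 0 (- N t \<omega> - K))" by auto
  note g = stopped_grid[OF \<theta> T, of N, OF int] 
  note g' = stopped_grid[OF \<theta> T, of "\<lambda>t \<omega>. max 0 (- N t \<omega> - K)", OF int']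
  show "integrable P (\<lambda>\<omega>. N (grid n (stopped_time \<theta> T \<omega>)) \<omega>)" by (rule g(1))
  have T1: "0 \<le> T + 1" using T by simp
  show "(\<integral>\<omega>. N (grid n (stopped_time \<theta> T \<omega>)) \<omega> \<partial>P) = (\<integral>\<omega>. N (T + 1) \<omega> \<partial>P)"
    unfolding g(2) g(3)[OF int[rule_format, OF T1], of n]
    by (intro sum.cong refl martingale_set_integral[OF N] grid_level_set \<theta> T) (auto simp del: of_nat_Suc)
  show "(\<integral>\<omega>. max 0 (- N (grid n (stopped_time \<theta> T \<omega>)) \<omega> - K) \<partial>P) \<le> (\<integral>\<omega>. max 0 (- N (T + 1) \<omega> - K) \<partial>P)"
    unfolding g'(2) g'(3)[OF int'[rule_format, OF T1], of n]
    by (intro sum_mono martingale_neg_part[OF N] grid_level_set \<theta> T) (auto simp del: of_nat_Suc)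
qed

lemma martingale_uminus:
  assumes "martingale P F N" shows "martingale P F (\<lambda>t \<omega>. - N t \<omega>)"
  unfolding martingale_def adapted_def
proof (intro conjI allI impI)
  fix s t :: real assume st: "0 \<le> s \<and> s \<le> t"
  interpret S: sigma_finite_subalgebra P "F s"
    using finite_measure_subalgebra_is_sigma_finite[OF finite_measure_subalgebra.intro[OF finite_measure_axioms]]
      subalgebra_F[of s] st by (simp add: finite_measure_subalgebra_axioms_def)
  have int: "integrable P (N t)" and
    ae: "AE \<omega> in P. real_cond_exp P (F s) (N t) \<omega> = N s \<omega>" using assms st by (auto simp: martingale_def)
  have "AE \<omega> in P. real_cond_exp P (F s) (\<lambda>\<omega>. -1 * N t \<omega>) \<omega> = -1 * real_cond_exp P (F s) (N t) \<omega>"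
    by (rule S.real_cond_exp_cmult[OF int])
  with ae show "AE \<omega> in P. real_cond_exp P (F s) (\<lambda>\<omega>. - N t \<omega>) \<omega> = - N s \<omega>"
    by eventually_elim simp
qed (use assms in \<open>auto simp: martingale_def adapted_def\<close>)

text \<open>Fatou needs a lower bound that is uniform along the discretisation: \<open>- K\<close> up to an error
  \<open>E (- N - K)\<^sup>+\<close>, which the submartingale property controls by its value at the deterministic horizon.\<close>

lemma optional_stopping_aux:
  assumes N: "martingale P F N" and \<theta>: "is_stopping_time F \<theta>" and T: "0 \<le> T"
    and rc: "\<And>\<omega>. \<omega> \<in> space P \<Longrightarrow> right_continuous (\<lambda>t. N t \<omega>)"
  shows "integrable P (\<lambda>\<omega>. max 0 (N (stopped_time \<theta> T \<omega>) \<omega> + K))"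
    and "(\<integral>\<omega>. max 0 (N (stopped_time \<theta> T \<omega>) \<omega> + K) \<partial>P)
      \<le> (\<integral>\<omega>. N (T + 1) \<omega> \<partial>P) + K + (\<integral>\<omega>. max 0 (- N (T + 1) \<omega> - K) \<partial>P)"
proof -
  let ?b = "(\<integral>\<omega>. N (T + 1) \<omega> \<partial>P) + K + (\<integral>\<omega>. max 0 (- N (T + 1) \<omega> - K) \<partial>P)"
  let ?g = "\<lambda>n \<omega>. N (grid n (stopped_time \<theta> T \<omega>)) \<omega>"
  note g = martingale_grid[OF N \<theta> T]
  have meas: "(\<lambda>\<omega>. N (stopped_time \<theta> T \<omega>) \<omega>) \<in> borel_measurable P"
  proof (rule measurable_right_continuous_at[OF _ rc stopped_time_measurable[OF \<theta>]])
    show "N t \<in> borel_measurable P" if "0 \<le> t" for t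
      using N that measurable_F_imp by (auto simp: martingale_def adapted_def)
  qed auto
  have E: "(\<integral>\<omega>. max 0 (?g n \<omega> + K) \<partial>P) \<le> ?b" for n
  proof -
    \<comment> \<open>The identity \<open>(y + K)\<^sup>+ = y + K + (- y - K)\<^sup>+\<close>: the
      martingale term has the same expectation for every \<open>n\<close>, and the last one is the
      controlled error.\<close>
    have "(\<integral>\<omega>. max 0 (?g n \<omega> + K) \<partial>P) = (\<integral>\<omega>. ?g n \<omega> + K + max 0 (- ?g n \<omega> - K) \<partial>P)"
      by (intro Bochner_Integration.integral_cong) auto
    also have "\<dots> = (\<integral>\<omega>. ?g n \<omega> \<partial>P) + K + (\<integral>\<omega>. max 0 (- ?g n \<omega> - K) \<partial>P)"
      using g(1)[of n] by (simp add: prob_space)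
    also have "\<dots> \<le> ?b" using g(2)[of n] g(3)[of n K] by simp
    finally show ?thesis .
  qed
  have "(\<integral>\<^sup>+\<omega>. ennreal (max 0 (N (stopped_time \<theta> T \<omega>) \<omega> + K)) \<partial>P)
      = (\<integral>\<^sup>+\<omega>. liminf (\<lambda>n. ennreal (max 0 (?g n \<omega> + K))) \<partial>P)"
  proof (intro nn_integral_cong)
    fix \<omega> assume "\<omega> \<in> space P"
    then have "(\<lambda>n. ?g n \<omega>) \<longlonglongrightarrow> N (stopped_time \<theta> T \<omega>) \<omega>"
      using right_continuous_grid[OF rc] by simp
    then have "(\<lambda>n. ennreal (max 0 (?g n \<omega> + K))) \<longlonglongrightarrow> ennreal (max 0 (N (stopped_time \<theta> T \<omega>) \<omega> + K))"
      by (intro tendsto_intros)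
    then show "ennreal (max 0 (N (stopped_time \<theta> T \<omega>) \<omega> + K)) = liminf (\<lambda>n. ennreal (max 0 (?g n \<omega> + K)))"
      by (simp add: lim_imp_Liminf)
  qed
  also have "\<dots> \<le> liminf (\<lambda>n. \<integral>\<^sup>+\<omega>. ennreal (max 0 (?g n \<omega> + K)) \<partial>P)"
  proof (rule nn_integral_liminf)
    fix n
    have [measurable]: "?g n \<in> borel_measurable P" by (rule borel_measurable_integrable[OF g(1)])
    show "(\<lambda>\<omega>. ennreal (max 0 (?g n \<omega> + K))) \<in> borel_measurable P" by measurable
  qed
  also have "\<dots> \<le> liminf (\<lambda>n. ennreal ?b)"
  proof (intro Liminf_mono always_eventually allI)
    fix n
    have "(\<integral>\<^sup>+\<omega>. ennreal (max 0 (?g n \<omega> + K)) \<partial>P) = ennreal (\<integral>\<omega>. max 0 (?g n \<omega> + K) \<partial>P)"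
      using g(1)[of n] by (intro nn_integral_eq_integral) auto
    then show "(\<integral>\<^sup>+\<omega>. ennreal (max 0 (?g n \<omega> + K)) \<partial>P) \<le> ennreal ?b"
      using E[of n] by (simp add: ennreal_leI)
  qed
  finally have le: "(\<integral>\<^sup>+\<omega>. ennreal (max 0 (N (stopped_time \<theta> T \<omega>) \<omega> + K)) \<partial>P) \<le> ennreal ?b"
    by (simp add: Liminf_const)
  then show int: "integrable P (\<lambda>\<omega>. max 0 (N (stopped_time \<theta> T \<omega>) \<omega> + K))"
    using meas by (intro integrableI_bounded) (auto simp: le_less_trans)
  \<comment> \<open>Non-negativity of the bound is needed because \<open>ennreal\<close> would send
    a negative bound to \<open>0\<close>.\<close>
  have "0 \<le> (\<integral>\<omega>. max 0 (?g 0 \<omega> + K) \<partial>P)" by simp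
  then have "0 \<le> ?b" using E[of 0] by linarith
  then show "(\<integral>\<omega>. max 0 (N (stopped_time \<theta> T \<omega>) \<omega> + K) \<partial>P) \<le> ?b"
    using le nn_integral_eq_integral[OF int] by simp
qed

text \<open>As \<open>K\<close> grows, the error \<open>E (- N - K)\<^sup>+\<close> at the horizon
  vanishes, which leaves the inequality \<open>\<le>\<close> for \<open>N\<close>. Applied to
  \<open>- N\<close> as well it becomes an equality; the same symmetry makes both parts of
  \<open>N\<close> integrable.\<close>

lemma optional_stopping:
  assumes N: "martingale P F N" and \<theta>: "is_stopping_time F \<theta>" and T: "0 \<le> T"
    and rc: "\<And>\<omega>. \<omega> \<in> space P \<Longrightarrow> right_continuous (\<lambda>t. N t \<omega>)"
  shows "integrable P (\<lambda>\<omega>. N (stopped_time \<theta> T \<omega>) \<omega>)"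
    and "(\<integral>\<omega>. N (stopped_time \<theta> T \<omega>) \<omega> \<partial>P) = (\<integral>\<omega>. N 0 \<omega> \<partial>P)"
proof -
  have rc': "\<And>\<omega>. \<omega> \<in> space P \<Longrightarrow> right_continuous (\<lambda>t. - N t \<omega>)"
    using rc unfolding right_continuous_def by (auto intro: continuous_intros)
  have int: "integrable P (\<lambda>\<omega>. N (stopped_time \<theta> T \<omega>) \<omega>)"
    if N: "martingale P F N" and rc: "\<And>\<omega>. \<omega> \<in> space P \<Longrightarrow> right_continuous (\<lambda>t. N t \<omega>)" for N
  proof -
    have rc': "\<And>\<omega>. \<omega> \<in> space P \<Longrightarrow> right_continuous (\<lambda>t. - N t \<omega>)"
      using rc unfolding right_continuous_def by (auto intro: continuous_intros)
    have "integrable P (\<lambda>\<omega>. max 0 (N (stopped_time \<theta> T \<omega>) \<omega> + 0) - max 0 (- N (stopped_time \<theta> T \<omega>) \<omega> + 0))"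
      by (intro Bochner_Integration.integrable_diff
          optional_stopping_aux(1)[OF N \<theta> T rc] optional_stopping_aux(1)[OF martingale_uminus[OF N] \<theta> T rc'])
    then show ?thesis
      by (rule Bochner_Integration.integrable_cong[THEN iffD1, rotated 2]) auto
  qed
  then show intN: "integrable P (\<lambda>\<omega>. N (stopped_time \<theta> T \<omega>) \<omega>)" using N rc by blast
  have le: "(\<integral>\<omega>. N (stopped_time \<theta> T \<omega>) \<omega> \<partial>P) \<le> (\<integral>\<omega>. N 0 \<omega> \<partial>P)"
    if N: "martingale P F N" and rc: "\<And>\<omega>. \<omega> \<in> space P \<Longrightarrow> right_continuous (\<lambda>t. N t \<omega>)" for N
  proof -
    have iT: "integrable P (N (T + 1))" using N T by (auto simp: martingale_def)
    have "(\<lambda>K::nat. \<integral>\<omega>. max 0 (- N (T + 1) \<omega> - real K) \<partial>P) \<longlonglongrightarrow> (\<integral>\<omega>. 0 \<partial>P)"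
    proof (rule integral_dominated_convergence[where w = "\<lambda>\<omega>. \<bar>N (T + 1) \<omega>\<bar>"])
      show "AE \<omega> in P. (\<lambda>K::nat. max 0 (- N (T + 1) \<omega> - real K)) \<longlonglongrightarrow> 0"
      proof (intro AE_I2 tendsto_eventually)
        fix \<omega>
        obtain K0 :: nat where "- N (T + 1) \<omega> \<le> real K0" using real_arch_simple by blast
        then show "\<forall>\<^sub>F K::nat in sequentially. max 0 (- N (T + 1) \<omega> - real K) = 0"
          by (intro eventually_sequentiallyI[of K0]) auto
      qed
    qed (use iT in auto)
    then have lim: "(\<lambda>K::nat. (\<integral>\<omega>. N (T + 1) \<omega> \<partial>P) + (\<integral>\<omega>. max 0 (- N (T + 1) \<omega> - real K) \<partial>P))
        \<longlonglongrightarrow> (\<integral>\<omega>. N (T + 1) \<omega> \<partial>P) + 0"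
      by (intro tendsto_intros) simp
    have "(\<integral>\<omega>. N (stopped_time \<theta> T \<omega>) \<omega> \<partial>P)
        \<le> (\<integral>\<omega>. N (T + 1) \<omega> \<partial>P) + (\<integral>\<omega>. max 0 (- N (T + 1) \<omega> - real K) \<partial>P)" for K :: nat
    proof -
      note a = optional_stopping_aux[OF N \<theta> T rc, of K]
      have "(\<integral>\<omega>. N (stopped_time \<theta> T \<omega>) \<omega> \<partial>P) \<le> (\<integral>\<omega>. max 0 (N (stopped_time \<theta> T \<omega>) \<omega> + K) - K \<partial>P)"
        using a(1) int[OF N rc] by (intro integral_mono) auto
      also have "\<dots> = (\<integral>\<omega>. max 0 (N (stopped_time \<theta> T \<omega>) \<omega> + K) \<partial>P) - K"
        using a(1) by (simp add: prob_space)
      finally show ?thesis using a(2) by simp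
    qed
    then have "(\<integral>\<omega>. N (stopped_time \<theta> T \<omega>) \<omega> \<partial>P) \<le> (\<integral>\<omega>. N (T + 1) \<omega> \<partial>P)"
      using LIMSEQ_le_const[OF lim] by simp
    also have "\<dots> = (\<integral>\<omega>. N 0 \<omega> \<partial>P)"
    proof -
      have "space P \<in> sets (F 0)" using space_F[of 0] by (metis order_refl sets.top)
      from martingale_set_integral[OF N order_refl _ this, of "T + 1"] T
      show ?thesis using N by (simp add: set_integral_space martingale_def)
    qed
    finally show ?thesis .
  qed
  show "(\<integral>\<omega>. N (stopped_time \<theta> T \<omega>) \<omega> \<partial>P) = (\<integral>\<omega>. N 0 \<omega> \<partial>P)"
    using le[OF N rc] le[OF martingale_uminus[OF N] rc'] by simp
qed

end

section \<open>Foretelling the passage of a predictable increasing process\<close>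

context usual_filtered_prob_space
begin

lemma predictable_rectangles_subset:
  "{{0} \<times> B | B. B \<in> sets (F 0)} \<union>
      {{s<..t} \<times> B | s t B. 0 \<le> s \<and> s \<le> t \<and> B \<in> sets (F s)} \<subseteq> Pow ({0..} \<times> space P)"
proof -
  have "B \<subseteq> space P" if "B \<in> sets (F s)" "0 \<le> s" for B s
    using sets.sets_into_space[OF that(1)] space_F[OF that(2)] by simp
  then show ?thesis by fastforce
qed

lemma space_predictable_sigma [simp]: "space (predictable_sigma P F) = {0..} \<times> space P"
  and sets_predictable_sigma: "sets (predictable_sigma P F) = sigma_sets ({0..} \<times> space P)
     ({{0} \<times> B | B. B \<in> sets (F 0)} \<union>
      {{s<..t} \<times> B | s t B. 0 \<le> s \<and> s \<le> t \<and> B \<in> sets (F s)})"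
  unfolding predictable_sigma_def using predictable_rectangles_subset
  by (simp_all add: space_measure_of sets_measure_of)

lemma Ioc_predictable:
  assumes "0 \<le> s" "B \<in> sets (F s)" shows "{s<..t} \<times> B \<in> sets (predictable_sigma P F)"
proof (cases "s \<le> t")
  case True
  then show ?thesis using assms unfolding sets_predictable_sigma
    by (intro sigma_sets.Basic) blast
qed simp

lemma zero_predictable: "B \<in> sets (F 0) \<Longrightarrow> {0} \<times> B \<in> sets (predictable_sigma P F)"
  unfolding sets_predictable_sigma by (intro sigma_sets.Basic) blast

text \<open>Strict inequality \<open>r < s\<close> makes the debut of such a set foretellable.\<close>

inductive_set lagged_sets :: "(real \<times> 'a) set set" where
  empty: "{} \<in> lagged_sets"
| rect: "0 \<le> r \<Longrightarrow> r < s \<Longrightarrow> B \<in> sets (F r) \<Longrightarrow> {s..t} \<times> B \<in> lagged_sets"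
| un: "K \<in> lagged_sets \<Longrightarrow> K' \<in> lagged_sets \<Longrightarrow> K \<union> K' \<in> lagged_sets"

text \<open>The intersection of two rectangles is a rectangle whose base is known at
  \<open>max r r'\<close>, strictly before its left end \<open>max s s'\<close>.\<close>

lemma lagged_Int_rect:
  assumes "K \<in> lagged_sets" "0 \<le> r" "r < s" "B \<in> sets (F r)"
  shows "K \<inter> ({s..t} \<times> B) \<in> lagged_sets"
  using assms(1)
proof induction
  case (rect r' s' B' t')
  have eq: "{s'..t'} \<times> B' \<inter> {s..t} \<times> B = {max s s'..min t t'} \<times> (B \<inter> B')" by auto
  have "B \<inter> B' \<in> sets (F (max r r'))"
    using rect assms sets_F_mono[of r "max r r'"] sets_F_mono[of r' "max r r'"] by (intro sets.Int) auto
  then show ?case unfolding eq using rect assms by (intro lagged_sets.rect[of "max r r'"]) auto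
qed (auto simp: Int_Un_distrib2 intro: lagged_sets.intros)

lemma lagged_Int: "K' \<in> lagged_sets \<Longrightarrow> K \<in> lagged_sets \<Longrightarrow> K \<inter> K' \<in> lagged_sets"
  by (induction rule: lagged_sets.induct)
    (auto simp: Int_Un_distrib intro: lagged_sets.intros lagged_Int_rect)

lemma lagged_INT: "(\<And>i. K i \<in> lagged_sets) \<Longrightarrow> (\<Inter>i\<le>n::nat. K i) \<in> lagged_sets"
  by (induction n) (auto simp: atMost_Suc intro: lagged_Int)

text \<open>Closed time sections are what the compactness argument in
  \<open>lagged_delta_foretell\<close> needs; the intervals in \<open>rect\<close> are closed for
  this reason.\<close>

lemma lagged_closed: "K \<in> lagged_sets \<Longrightarrow> closed {t. (t, \<omega>) \<in> K}"
proof (induction rule: lagged_sets.induct)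
  case (rect r s B t)
  have "{u. (u, \<omega>) \<in> {s..t} \<times> B} = (if \<omega> \<in> B then {s..t} else {})" by auto
  then show ?case by simp
next
  case (un K K')
  have "{t. (t, \<omega>) \<in> K \<union> K'} = {t. (t, \<omega>) \<in> K} \<union> {t. (t, \<omega>) \<in> K'}" by auto
  then show ?case using un by auto
qed simp

text \<open>\<open>[s, t]\<close> is the intersection of half-open \<open>(q n, t]\<close> with
  \<open>r \<le> q n < s\<close>; the lag is what keeps \<open>B\<close> in
  \<open>F (q n)\<close>.\<close>

lemma lagged_predictable: "K \<in> lagged_sets \<Longrightarrow> K \<in> sets (predictable_sigma P F)"
proof (induction rule: lagged_sets.induct)
  case (rect r s B t)
  define q where "q n = s - (s - r) * inverse (real (Suc n))" for n
  have q: "r \<le> q n" "q n < s" for n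
  proof -
    have "inverse (real (Suc n)) \<le> 1" by (simp add: inverse_le_1_iff del: of_nat_Suc)
    then have "(s - r) * inverse (real (Suc n)) \<le> (s - r) * 1" using rect by (intro mult_left_mono) auto
    then show "r \<le> q n" by (simp add: q_def)
    show "q n < s" using rect by (simp add: q_def)
  qed
  have lim: "q \<longlonglongrightarrow> s - (s - r) * 0"
    unfolding q_def by (intro tendsto_intros LIMSEQ_inverse_real_of_nat)
  have "{s..t} = (\<Inter>n. {q n<..t})"
  proof (intro equalityI subsetI)
    fix u assume "u \<in> (\<Inter>n. {q n<..t})"
    then have u: "\<And>n. q n \<le> u" "u \<le> t" by (auto intro: less_imp_le)
    have "s \<le> u" using LIMSEQ_le_const2[OF lim, of u] u by simp
    with u show "u \<in> {s..t}" by simp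
  qed (use q(2) in \<open>auto intro: less_le_trans\<close>)
  then have "{s..t} \<times> B = (\<Inter>n. {q n<..t} \<times> B)" by auto
  also have "\<dots> \<in> sets (predictable_sigma P F)"
  proof (intro sets.countable_INT image_subsetI)
    fix n
    show "{q n<..t} \<times> B \<in> sets (predictable_sigma P F)"
      using q[of n] rect sets_F_mono[of r "q n"] by (intro Ioc_predictable) auto
  qed auto
  finally show ?case .
qed auto

text \<open>The debut is announced strictly in advance, but by at most \<open>d\<close>. For one
  rectangle the announcement is a constant time on the base and infinite elsewhere; for a union the
  minimum works.\<close>

lemma lagged_foretell:
  assumes "K \<in> lagged_sets" "0 < d"
  shows "\<exists>\<theta>. is_stopping_time F \<theta> \<and> (\<forall>t \<omega>. (t, \<omega>) \<in> K \<longrightarrow> \<theta> \<omega> < ennreal t) \<and>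
     (\<forall>\<omega>. \<theta> \<omega> < \<top> \<longrightarrow> (\<exists>t. (t, \<omega>) \<in> K \<and> ennreal t \<le> \<theta> \<omega> + ennreal d))"
  using assms(1)
proof induction
  case empty
  show ?case by (intro exI[of _ "\<lambda>_. \<top>"]) (auto simp: stop_const)
next
  case (rect r s B t)
  \<comment> \<open>Not before \<open>r\<close>, so that \<open>B\<close> is known; not more than
    \<open>d\<close> before \<open>s\<close>; and strictly before \<open>s\<close>, as both
    candidates are.\<close>
  define q where "q = max r (s - d)"
  define \<theta> where "\<theta> \<omega> = (if \<omega> \<in> B \<and> s \<le> t then ennreal q else \<top>)" for \<omega>
  have q: "0 \<le> q" "q < s" "s \<le> q + d" "r \<le> q" using rect assms by (auto simp: q_def)
  have BP: "B \<subseteq> space P" using sets.sets_into_space[OF rect(3)] space_F[OF rect(1)] by simp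
  have "is_stopping_time F \<theta>"
    unfolding stop_iff
  proof (intro allI impI)
    fix x :: real assume x: "0 \<le> x"
    have "{\<omega>\<in>space P. \<theta> \<omega> \<le> ennreal x} = (if s \<le> t \<and> q \<le> x then B else {})"
      using BP q x by (auto simp: \<theta>_def ennreal_le_iff top_unique)
    then show "{\<omega>\<in>space P. \<theta> \<omega> \<le> ennreal x} \<in> sets (F x)"
      using rect q sets_F_mono[of r x] by auto
  qed
  moreover have "\<theta> \<omega> < ennreal u" if "(u, \<omega>) \<in> {s..t} \<times> B" for u \<omega>
    using that q by (auto simp: \<theta>_def ennreal_less_iff)
  moreover have "\<exists>u. (u, \<omega>) \<in> {s..t} \<times> B \<and> ennreal u \<le> \<theta> \<omega> + ennreal d" if "\<theta> \<omega> < \<top>" for \<omega>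
  proof -
    have "\<omega> \<in> B" "s \<le> t" using that by (auto simp: \<theta>_def split: if_splits)
    then show ?thesis using q assms(2)
      by (intro exI[of _ s]) (auto simp: \<theta>_def simp flip: ennreal_plus intro: ennreal_leI)
  qed
  ultimately show ?case by blast
next
  case (un K K')
  then obtain \<theta> \<theta>' where \<theta>: "is_stopping_time F \<theta>" "\<forall>t \<omega>. (t, \<omega>) \<in> K \<longrightarrow> \<theta> \<omega> < ennreal t"
     "\<forall>\<omega>. \<theta> \<omega> < \<top> \<longrightarrow> (\<exists>t. (t, \<omega>) \<in> K \<and> ennreal t \<le> \<theta> \<omega> + ennreal d)"
    and \<theta>': "is_stopping_time F \<theta>'" "\<forall>t \<omega>. (t, \<omega>) \<in> K' \<longrightarrow> \<theta>' \<omega> < ennreal t"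
     "\<forall>\<omega>. \<theta>' \<omega> < \<top> \<longrightarrow> (\<exists>t. (t, \<omega>) \<in> K' \<and> ennreal t \<le> \<theta>' \<omega> + ennreal d)"
    by blast
  have "min (\<theta> \<omega>) (\<theta>' \<omega>) < ennreal t" if "(t, \<omega>) \<in> K \<union> K'" for t \<omega>
    using that \<theta>(2) \<theta>'(2) by (auto simp: min_less_iff_disj)
  moreover have "\<exists>t. (t, \<omega>) \<in> K \<union> K' \<and> ennreal t \<le> min (\<theta> \<omega>) (\<theta>' \<omega>) + ennreal d"
    if "min (\<theta> \<omega>) (\<theta>' \<omega>) < \<top>" for \<omega>
  proof (cases "\<theta> \<omega> \<le> \<theta>' \<omega>")
    case True
    then have m: "min (\<theta> \<omega>) (\<theta>' \<omega>) = \<theta> \<omega>" by (simp add: min_absorb1)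
    with that \<theta>(3) obtain t where "(t, \<omega>) \<in> K" "ennreal t \<le> \<theta> \<omega> + ennreal d" by auto
    with m show ?thesis by auto
  next
    case False
    then have m: "min (\<theta> \<omega>) (\<theta>' \<omega>) = \<theta>' \<omega>" by (simp add: min_absorb2)
    with that \<theta>'(3) obtain t where "(t, \<omega>) \<in> K'" "ennreal t \<le> \<theta>' \<omega> + ennreal d" by auto
    with m show ?thesis by auto
  qed
  ultimately show ?case using stop_min[OF \<theta>(1) \<theta>'(1)] by blast
qed

section \<open>Countable intersections of lagged sets\<close>

text \<open>These play the role of compact sets in a regularity argument: they are stable under
  finite unions and countable intersections and have closed time sections.\<close>

definition lagged_delta :: "(real \<times> 'a) set \<Rightarrow> bool" where
  "lagged_delta L \<longleftrightarrow> (\<exists>K::nat \<Rightarrow> _. (\<forall>n. K n \<in> lagged_sets) \<and> L = (\<Inter>n. K n))"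

lemma lagged_deltaI: "K \<in> lagged_sets \<Longrightarrow> lagged_delta K"
  unfolding lagged_delta_def by (intro exI[of _ "\<lambda>_. K"]) auto

lemma lagged_delta_predictable: "lagged_delta L \<Longrightarrow> L \<in> sets (predictable_sigma P F)"
  unfolding lagged_delta_def using lagged_predictable by auto

text \<open>By distributivity the union is the intersection of \<open>K m \<union> K' n\<close> over
  all pairs, which \<open>prod_decode\<close> enumerates.\<close>

lemma lagged_delta_Un:
  assumes "lagged_delta L" "lagged_delta L'" shows "lagged_delta (L \<union> L')"
proof -
  obtain K K' :: "nat \<Rightarrow> _" where K: "\<And>n. K n \<in> lagged_sets" "L = (\<Inter>n. K n)"
    and K': "\<And>n. K' n \<in> lagged_sets" "L' = (\<Inter>n. K' n)" using assms unfolding lagged_delta_def by blast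
  let ?K = "\<lambda>n. K (fst (prod_decode n)) \<union> K' (snd (prod_decode n))"
  have "L \<union> L' = (\<Inter>n. ?K n)"
  proof (intro equalityI subsetI)
    fix x assume x: "x \<in> (\<Inter>n. ?K n)"
    show "x \<in> L \<union> L'"
    proof (rule ccontr)
      assume "x \<notin> L \<union> L'"
      then obtain m n where "x \<notin> K m" "x \<notin> K' n" by (auto simp: K K')
      moreover have "x \<in> ?K (prod_encode (m, n))" using x by blast
      ultimately show False by simp
    qed
  qed (auto simp: K K')
  then show ?thesis unfolding lagged_delta_def using K K' by (intro exI[of _ ?K]) (auto intro: lagged_sets.un)
qed

lemma lagged_delta_UN:
  "(\<And>i. lagged_delta (L i)) \<Longrightarrow> lagged_delta (\<Union>i\<le>n::nat. L i)"
  by (induction n) (auto simp: atMost_Suc intro: lagged_delta_Un)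

lemma lagged_delta_INT:
  assumes "\<And>i::nat. lagged_delta (L i)" shows "lagged_delta (\<Inter>i. L i)"
proof -
  obtain K where K: "\<And>i n. K i n \<in> lagged_sets" "\<And>i. L i = (\<Inter>n::nat. K i n)"
    using assms unfolding lagged_delta_def by metis
  let ?K = "\<lambda>n. K (fst (prod_decode n)) (snd (prod_decode n))"
  have "(\<Inter>i. L i) = (\<Inter>n. ?K n)"
  proof (intro equalityI subsetI)
    fix x assume x: "x \<in> (\<Inter>n. ?K n)"
    have "x \<in> K i n" for i n
    proof -
      have "x \<in> ?K (prod_encode (i, n))" using x by blast
      then show ?thesis by simp
    qed
    then show "x \<in> (\<Inter>i. L i)" by (simp add: K)
  qed (auto simp: K)
  then show ?thesis unfolding lagged_delta_def using K by (intro exI[of _ ?K]) auto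
qed

text \<open>On \<open>E\<close> an announcement before \<open>T\<close> is a false alarm. If on a
  path of \<open>E\<close> the times announcing \<open>K n\<close> were below \<open>T\<close> for
  infinitely many \<open>n\<close>, the sections of \<open>K n\<close> would meet
  \<open>[0, T + 1 / (n + 1)]\<close> for every \<open>n\<close>, and compactness would give a point
  of \<open>L\<close> in \<open>[0, T]\<close>. So the probability of a false alarm tends to
  \<open>0\<close>, and one far index suffices.\<close>

lemma lagged_delta_foretell:
  assumes L: "lagged_delta L" and T: "0 \<le> T" and E: "E \<in> sets P"
    and disj: "\<And>t \<omega>. \<omega> \<in> E \<Longrightarrow> 0 \<le> t \<Longrightarrow> t \<le> T \<Longrightarrow> (t, \<omega>) \<notin> L" and e: "0 < e"
  shows "\<exists>\<theta>. is_stopping_time F \<theta> \<and> (\<forall>t \<omega>. (t, \<omega>) \<in> L \<longrightarrow> \<theta> \<omega> < ennreal t) \<and>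
    measure P {\<omega>\<in>E. \<theta> \<omega> < ennreal T} < e"
proof -
  obtain K0 :: "nat \<Rightarrow> _" where K0: "\<And>n. K0 n \<in> lagged_sets" "L = (\<Inter>n. K0 n)"
    using L unfolding lagged_delta_def by blast
  define K where "K n = (\<Inter>i\<le>n. K0 i)" for n
  have K: "K n \<in> lagged_sets" for n unfolding K_def by (intro lagged_INT K0)
  have LK: "L \<subseteq> K n" "K n \<subseteq> K0 n" for n by (auto simp: K_def K0)
  have dec: "K n \<subseteq> K m" if "m \<le> n" for m n using that by (auto simp: K_def)
  have "\<exists>\<theta>. is_stopping_time F \<theta> \<and> (\<forall>t \<omega>. (t, \<omega>) \<in> K n \<longrightarrow> \<theta> \<omega> < ennreal t) \<and>
     (\<forall>\<omega>. \<theta> \<omega> < \<top> \<longrightarrow> (\<exists>t. (t, \<omega>) \<in> K n \<and> ennreal t \<le> \<theta> \<omega> + ennreal (inverse (real (Suc n)))))" for n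
    by (intro lagged_foretell K) simp
  then obtain \<theta> where \<theta>: "\<And>n. is_stopping_time F (\<theta> n)" "\<And>n t \<omega>. (t, \<omega>) \<in> K n \<Longrightarrow> \<theta> n \<omega> < ennreal t"
     "\<And>n \<omega>. \<theta> n \<omega> < \<top> \<Longrightarrow> (\<exists>t. (t, \<omega>) \<in> K n \<and> ennreal t \<le> \<theta> n \<omega> + ennreal (inverse (real (Suc n))))"
    by metis
  have ev: "\<forall>\<^sub>F n in sequentially. ennreal T \<le> \<theta> n \<omega>" if \<omega>: "\<omega> \<in> E" for \<omega>
  proof (rule ccontr)
    assume neg: "\<not> (\<forall>\<^sub>F n in sequentially. ennreal T \<le> \<theta> n \<omega>)"
    \<comment> \<open>The announced point may lie past \<open>T\<close>, by at most the announcement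
      error; hence the slightly longer interval, which shrinks to \<open>[0, T]\<close>.\<close>
    define V where "V n = {0..T + inverse (real (Suc n))} \<inter> {t. (t, \<omega>) \<in> K n}" for n
    have mono: "V n \<subseteq> V m" if "m \<le> n" for m n
    proof -
      have "inverse (real (Suc n)) \<le> inverse (real (Suc m))" using that by simp
      then have "{0..T + inverse (real (Suc n))} \<subseteq> {0..T + inverse (real (Suc m))}"
        unfolding atLeastatMost_subset_iff by linarith
      then show ?thesis using dec[OF that] unfolding V_def by blast
    qed
    have ne: "V n \<noteq> {}" for n
    proof -
      obtain m where m: "n \<le> m" "\<theta> m \<omega> < ennreal T"
        using neg by (auto simp: eventually_sequentially not_le)
      then have "\<theta> m \<omega> < \<top>" by (meson ennreal_less_top less_trans)
      then obtain t where t: "(t, \<omega>) \<in> K m" "ennreal t \<le> \<theta> m \<omega> + ennreal (inverse (real (Suc m)))"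
        using \<theta>(3) by blast
      have "0 < ennreal t" using \<theta>(2)[OF t(1)] by (rule le_less_trans[OF zero_le])
      then have "0 < t" by simp
      have "ennreal t \<le> ennreal T + ennreal (inverse (real (Suc m)))"
        using t(2) m(2) by (meson add_right_mono less_imp_le order_trans)
      also have "\<dots> = ennreal (T + inverse (real (Suc m)))" using T by (intro ennreal_plus[symmetric]) auto
      finally have "t \<le> T + inverse (real (Suc m))" using T by (subst (asm) ennreal_le_iff) auto
      with t \<open>0 < t\<close> have "t \<in> V m" by (simp add: V_def)
      with mono[OF m(1)] show ?thesis by auto
    qed
    have "(\<Inter>n. V n) \<noteq> {}"
      using ne mono lagged_closed[OF K] by (intro compact_nest) (auto simp: V_def intro!: compact_Int_closed)
    then obtain t where t: "\<And>n. t \<in> V n" by auto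
    have "t \<le> T"
      using LIMSEQ_le_const[OF LIMSEQ_inverse_real_of_nat_add[of T], of t] t by (auto simp: V_def)
    moreover have "0 \<le> t" using t[of 0] by (simp add: V_def)
    moreover have "(t, \<omega>) \<in> L"
    proof -
      have "(t, \<omega>) \<in> K0 n" for n using t[of n] LK(2)[of n] by (auto simp: V_def)
      then show ?thesis by (simp add: K0(2))
    qed
    ultimately show False using disj[OF \<omega>] by blast
  qed
  have meas: "{\<omega>\<in>E. \<theta> n \<omega> < ennreal T} \<in> sets P" for n
  proof -
    have "{\<omega>\<in>E. \<theta> n \<omega> < ennreal T} = E \<inter> {\<omega>\<in>space P. \<theta> n \<omega> < ennreal T}"
      using sets.sets_into_space[OF E] by auto
    then show ?thesis using sets.Int[OF E in_sets_F_imp[OF T stopD_less[OF \<theta>(1) T, of n]]] by simp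
  qed
  have "(\<lambda>n. \<integral>\<omega>. indicator {\<omega>\<in>E. \<theta> n \<omega> < ennreal T} \<omega> \<partial>P) \<longlonglongrightarrow> (\<integral>\<omega>. 0 \<partial>P :: real)"
  proof (rule integral_dominated_convergence[where w = "\<lambda>_. 1"])
    show "AE \<omega> in P. (\<lambda>n. indicat_real {\<omega>\<in>E. \<theta> n \<omega> < ennreal T} \<omega>) \<longlonglongrightarrow> 0"
    proof (intro AE_I2 tendsto_eventually)
      fix \<omega>
      show "\<forall>\<^sub>F n in sequentially. indicat_real {\<omega>\<in>E. \<theta> n \<omega> < ennreal T} \<omega> = 0"
      proof (cases "\<omega> \<in> E")
        case True
        from ev[OF this] show ?thesis by eventually_elim (simp add: indicator_def not_less)
      qed simp
    qed
    show "indicat_real {\<omega>\<in>E. \<theta> n \<omega> < ennreal T} \<in> borel_measurable P" for n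
      by (rule borel_measurable_indicator[OF meas])
  qed (auto simp: indicator_def)
  then have "(\<lambda>n. measure P {\<omega>\<in>E. \<theta> n \<omega> < ennreal T}) \<longlonglongrightarrow> 0"
    using meas by (simp add: sets.Int_space_eq2)
  then have "\<forall>\<^sub>F n in sequentially. measure P {\<omega>\<in>E. \<theta> n \<omega> < ennreal T} < e"
    using e by (rule order_tendstoD(2))
  then obtain n where "measure P {\<omega>\<in>E. \<theta> n \<omega> < ennreal T} < e"
    by (auto simp: eventually_sequentially)
  then show ?thesis using \<theta>(1)[of n] \<theta>(2)[of _ _ n] LK(1)[of n] by (intro exI[of _ "\<theta> n"]) blast
qed

section \<open>Inner regularity of finite measures on the predictable sigma-algebra\<close>

definition inner_regular :: "(real \<times> 'a) measure \<Rightarrow> (real \<times> 'a) set \<Rightarrow> bool" where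
  "inner_regular Q S \<longleftrightarrow> (\<forall>e>0. \<exists>L. lagged_delta L \<and> L \<subseteq> S \<and> measure Q (S - L) \<le> e)"

text \<open>The errors are \<open>e / 2, e / 4, ...\<close>. The defect of the union and that of the
  intersection both lie in the union of the single defects, so one bound serves both closure
  properties.\<close>

lemma inner_regular_seq:
  assumes Q: "finite_measure Q" "sets Q = sets (predictable_sigma P F)"
    and S: "\<And>i::nat. S i \<in> sets Q" "\<And>i. inner_regular Q (S i)" and e: "0 < e"
  obtains L where "\<And>i. lagged_delta (L i)" "\<And>i. L i \<in> sets Q" "\<And>i. L i \<subseteq> S i"
    "measure Q (\<Union>i. S i - L i) \<le> e"
proof -
  interpret Q: finite_measure Q by fact
  have "\<exists>L. lagged_delta L \<and> L \<subseteq> S i \<and> measure Q (S i - L) \<le> e * (1/2) ^ Suc i" for i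
    using S(2)[of i] e unfolding inner_regular_def by (elim allE[of _ "e * (1/2) ^ Suc i"]) simp
  then obtain L where L: "\<And>i. lagged_delta (L i)" "\<And>i. L i \<subseteq> S i"
    "\<And>i. measure Q (S i - L i) \<le> e * (1/2) ^ Suc i" by metis
  have Lm: "L i \<in> sets Q" for i using lagged_delta_predictable[OF L(1)] Q(2) by simp
  have sm: "(\<lambda>i. e * (1/2) ^ Suc i) sums (e * 1)" by (intro sums_mult power_half_series)
  have sm': "summable (\<lambda>i. measure Q (S i - L i))"
  proof (rule summable_comparison_test'[OF sums_summable[OF sm], of 0])
    show "norm (measure Q (S i - L i)) \<le> e * (1/2) ^ Suc i" for i
      using L(3)[of i] by (simp only: real_norm_def abs_of_nonneg measure_nonneg)
  qed
  have "measure Q (\<Union>i. S i - L i) \<le> (\<Sum>i. measure Q (S i - L i))"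
    by (intro Q.finite_measure_subadditive_countably sm' image_subsetI sets.Diff S(1) Lm)
  also have "\<dots> \<le> (\<Sum>i. e * (1/2) ^ Suc i)"
    by (intro suminf_le L(3) sm' sums_summable[OF sm])
  also have "\<dots> = e" using sums_unique[OF sm] by simp
  finally show ?thesis using that[of L] L Lm by blast
qed

lemma inner_regular_INT:
  assumes Q: "finite_measure Q" "sets Q = sets (predictable_sigma P F)"
    and S: "\<And>i::nat. S i \<in> sets Q" "\<And>i. inner_regular Q (S i)"
  shows "inner_regular Q (\<Inter>i. S i)"
  unfolding inner_regular_def
proof (intro allI impI)
  fix e :: real assume e: "0 < e"
  obtain L where
    L: "\<And>i. lagged_delta (L i)" "\<And>i. L i \<in> sets Q" "\<And>i. L i \<subseteq> S i"
    "measure Q (\<Union>i. S i - L i) \<le> e"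
    by (rule inner_regular_seq[of Q S e, OF Q S e]) blast
  interpret Q: finite_measure Q by fact
  have "measure Q ((\<Inter>i. S i) - (\<Inter>i. L i)) \<le> measure Q (\<Union>i. S i - L i)"
    using S(1) L(2) by (intro Q.finite_measure_mono) auto
  then show "\<exists>L. lagged_delta L \<and> L \<subseteq> (\<Inter>i. S i) \<and> measure Q ((\<Inter>i. S i) - L) \<le> e"
    using L(3,4) by (intro exI[of _ "\<Inter>i. L i"] conjI lagged_delta_INT L(1)) (blast, linarith)
qed

text \<open>Only finite unions of approximants are admissible, so the union is cut off by continuity
  of the measure from above; approximating up to \<open>e / 2\<close> leaves the slack that pays for
  the cut.\<close>

lemma inner_regular_UN:
  assumes Q: "finite_measure Q" "sets Q = sets (predictable_sigma P F)"
    and S: "\<And>i::nat. S i \<in> sets Q" "\<And>i. inner_regular Q (S i)"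
  shows "inner_regular Q (\<Union>i. S i)"
  unfolding inner_regular_def
proof (intro allI impI)
  fix e :: real assume e: "0 < e"
  obtain L where
    L: "\<And>i. lagged_delta (L i)" "\<And>i. L i \<in> sets Q" "\<And>i. L i \<subseteq> S i"
    "measure Q (\<Union>i. S i - L i) \<le> e / 2"
    by (rule inner_regular_seq[of Q S "e / 2", OF Q S half_gt_zero[OF e]]) blast
  interpret Q: finite_measure Q by fact
  let ?U = "\<lambda>n. \<Union>i\<le>n. L i"
  have UQ: "(\<Union>i. S i) - ?U n \<in> sets Q" for n using S(1) L(2) by (intro sets.Diff sets.finite_UN sets.countable_UN) auto
  have "(\<lambda>n. measure Q ((\<Union>i. S i) - ?U n)) \<longlonglongrightarrow> measure Q (\<Inter>n. (\<Union>i. S i) - ?U n)"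
  proof (rule Q.finite_Lim_measure_decseq)
    show "decseq (\<lambda>n. (\<Union>i. S i) - ?U n)" by (auto simp: decseq_def)
  qed (use UQ in auto)
  moreover have "measure Q (\<Inter>n. (\<Union>i. S i) - ?U n) \<le> measure Q (\<Union>i. S i - L i)"
    using S(1) L(2) by (intro Q.finite_measure_mono) (auto, blast)
  then have "measure Q (\<Inter>n. (\<Union>i. S i) - ?U n) < e" using L(4) e by linarith
  ultimately have "\<forall>\<^sub>F n in sequentially. measure Q ((\<Union>i. S i) - ?U n) < e"
    by (rule order_tendstoD(2))
  then obtain n where n: "measure Q ((\<Union>i. S i) - ?U n) < e" by (auto simp: eventually_sequentially)
  have "?U n \<subseteq> (\<Union>i. S i)" using L(3) by blast
  with n show "\<exists>L. lagged_delta L \<and> L \<subseteq> (\<Union>i. S i) \<and> measure Q ((\<Union>i. S i) - L) \<le> e"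
    by (intro exI[of _ "?U n"] conjI lagged_delta_UN L(1)) auto
qed

lemma inner_regular_Un:
  assumes Q: "finite_measure Q" "sets Q = sets (predictable_sigma P F)"
    and S: "S \<in> sets Q" "inner_regular Q S" "S' \<in> sets Q" "inner_regular Q S'"
  shows "inner_regular Q (S \<union> S')"
proof -
  have "inner_regular Q (\<Union>i::nat. if i = 0 then S else S')"
    using S by (intro inner_regular_UN[OF Q]) auto
  moreover have "(\<Union>i::nat. if i = 0 then S else S') = S \<union> S'" by (auto split: if_splits)
  ultimately show ?thesis by simp
qed

text \<open>As \<open>B\<close> is known at \<open>s\<close>, every
  \<open>[s + 1 / (n + 1), t] \<times> B\<close> is lagged with \<open>r = s\<close>, and these sets
  exhaust the rectangle.\<close>

lemma inner_regular_Ioc: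
  assumes Q: "finite_measure Q" "sets Q = sets (predictable_sigma P F)"
    and B: "0 \<le> s" "B \<in> sets (F s)"
  shows "inner_regular Q ({s<..t} \<times> B)"
proof -
  have K: "{s + inverse (real (Suc n))..t} \<times> B \<in> lagged_sets" for n
    using B by (intro lagged_sets.rect[of s]) auto
  have eq: "{s<..t} \<times> B = (\<Union>n. {s + inverse (real (Suc n))..t} \<times> B)"
  proof (intro equalityI subsetI)
    fix x assume x: "x \<in> {s<..t} \<times> B"
    then have "0 < fst x - s" by auto
    then obtain n where "inverse (real (Suc n)) < fst x - s" using reals_Archimedean by blast
    with x show "x \<in> (\<Union>n. {s + inverse (real (Suc n))..t} \<times> B)"
      by (intro UN_I[of n]) (auto simp del: of_nat_Suc)
  next
    fix x assume "x \<in> (\<Union>n. {s + inverse (real (Suc n))..t} \<times> B)"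
    then obtain n where n: "x \<in> {s + inverse (real (Suc n))..t} \<times> B" by blast
    have "0 < inverse (real (Suc n))" by simp
    moreover have "s + inverse (real (Suc n)) \<le> fst x" using n by auto
    ultimately have "s < fst x" by linarith
    with n show "x \<in> {s<..t} \<times> B" by auto
  qed
  show ?thesis unfolding eq
  proof (rule inner_regular_UN[OF Q])
    fix n
    show "{s + inverse (real (Suc n))..t} \<times> B \<in> sets Q" using lagged_predictable[OF K] Q(2) by blast
    show "inner_regular Q ({s + inverse (real (Suc n))..t} \<times> B)"
      unfolding inner_regular_def using lagged_deltaI[OF K] by (auto intro!: exI[of _ "{s + inverse (real (Suc n))..t} \<times> B"])
  qed
qed

lemma inner_regular_Ioi:
  assumes Q: "finite_measure Q" "sets Q = sets (predictable_sigma P F)"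
    and B: "0 \<le> s" "B \<in> sets (F s)"
  shows "inner_regular Q ({s<..} \<times> B)" and "{s<..} \<times> B \<in> sets Q"
proof -
  have eq: "{s<..} \<times> B = (\<Union>n. {s<..real n} \<times> B)"
    using real_arch_simple by auto
  show "inner_regular Q ({s<..} \<times> B)" unfolding eq
    using Q B by (intro inner_regular_UN inner_regular_Ioc) (auto intro: Ioc_predictable)
  show "{s<..} \<times> B \<in> sets Q" unfolding eq Q(2)
    using B by (intro sets.countable_UN image_subsetI Ioc_predictable) auto
qed

text \<open>Lagged sets do not meet time zero, so \<open>Q\<close> must not charge it.\<close>

lemma predictable_inner_regular:
  assumes Q: "finite_measure Q" "sets Q = sets (predictable_sigma P F)"
    and Q0: "measure Q ({0} \<times> space P) = 0" and S: "S \<in> sets Q"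
  shows "inner_regular Q S"
proof -
  interpret Q: finite_measure Q by fact
  let ?\<Omega> = "{0..} \<times> space P"
  have F: "space P \<in> sets (F t)" if "0 \<le> t" for t using space_F[OF that] sets.top[of "F t"] by simp
  have zero: "inner_regular Q ({0} \<times> B) \<and> {0} \<times> B \<in> sets Q" if "B \<in> sets (F 0)" for B
  proof -
    have "B \<subseteq> space P" using sets.sets_into_space[OF that] space_F[of 0] by simp
    then have "measure Q ({0} \<times> B) \<le> measure Q ({0} \<times> space P)"
      using Q(2) zero_predictable[OF F] by (intro Q.finite_measure_mono) auto
    then have "measure Q ({0} \<times> B) = 0" using Q0 measure_nonneg[of Q "{0} \<times> B"] by linarith
    then show ?thesis unfolding inner_regular_def
      using Q(2) zero_predictable[OF that] lagged_deltaI[OF lagged_sets.empty]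
      by (auto intro!: exI[of _ "{}"])
  qed
  have "S \<in> sigma_sets ?\<Omega> ({{0} \<times> B | B. B \<in> sets (F 0)} \<union>
      {{s<..t} \<times> B | s t B. 0 \<le> s \<and> s \<le> t \<and> B \<in> sets (F s)})"
    using S Q(2) sets_predictable_sigma by simp
  \<comment> \<open>The induction carries the complement too, as inner regularity of a set says
    nothing about its complement; the inclusion in \<open>?\<Omega>\<close> makes double complements
    harmless.\<close>
  then have "S \<in> sets Q \<and> S \<subseteq> ?\<Omega> \<and> inner_regular Q S \<and> inner_regular Q (?\<Omega> - S)"
  proof induction
    case (Basic a)
    then consider B where "a = {0} \<times> B" "B \<in> sets (F 0)"
      | s t B where "a = {s<..t} \<times> B" "0 \<le> s" "s \<le> t" "B \<in> sets (F s)" by blast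
    then show ?case
    proof cases
      case 1
      have B: "B \<subseteq> space P" using sets.sets_into_space[OF 1(2)] space_F[of 0] by simp
      have "?\<Omega> - a = {0} \<times> (space P - B) \<union> {0<..} \<times> space P" using B by (auto simp: 1(1))
      moreover have c: "space P - B \<in> sets (F 0)" using 1(2) F[of 0] by auto
      have "inner_regular Q ({0} \<times> (space P - B) \<union> {0<..} \<times> space P)"
        using zero[OF c] inner_regular_Ioi[OF Q order_refl F] by (intro inner_regular_Un[OF Q]) auto
      ultimately show ?thesis using zero[OF 1(2)] B by (auto simp: 1(1))
    next
      case 2
      have B: "B \<subseteq> space P" using sets.sets_into_space[OF 2(4)] space_F[OF 2(2)] by simp
      have eq: "?\<Omega> - a = (({0} \<times> space P \<union> {0<..s} \<times> space P) \<union> {t<..} \<times> space P) \<union> {s<..t} \<times> (space P - B)"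
        using B 2(2,3) by (auto simp: 2(1) not_le)
      have c: "space P - B \<in> sets (F s)" using 2(4) F[OF 2(2)] by auto
      have t: "0 \<le> t" using 2 by simp
      have m: "{0<..s} \<times> space P \<in> sets Q" "{s<..t} \<times> (space P - B) \<in> sets Q" "{s<..t} \<times> B \<in> sets Q"
        using Ioc_predictable[OF order_refl F] Ioc_predictable[OF 2(2) c] Ioc_predictable[OF 2(2,4)] Q(2) by auto
      have "inner_regular Q (?\<Omega> - a)" unfolding eq
        using m zero[OF F] inner_regular_Ioi[OF Q t F[OF t]]
          inner_regular_Ioc[OF Q order_refl F] inner_regular_Ioc[OF Q 2(2) c]
        by (intro inner_regular_Un[OF Q] sets.Un) auto
      then show ?thesis using m inner_regular_Ioc[OF Q 2(2,4)] B 2(2) by (auto simp: 2(1))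
    qed
  next
    case Empty
    have "?\<Omega> - {} = {0} \<times> space P \<union> {0::real<..} \<times> space P" by auto
    moreover have "inner_regular Q ({0} \<times> space P \<union> {0::real<..} \<times> space P)"
      using zero[OF F] inner_regular_Ioi[OF Q order_refl F] by (intro inner_regular_Un[OF Q]) auto
    ultimately show ?case
      using lagged_deltaI[OF lagged_sets.empty] by (auto simp: inner_regular_def)
  next
    case (Compl a)
    moreover have "?\<Omega> - (?\<Omega> - a) = a" using Compl by auto
    moreover have "?\<Omega> \<in> sets Q" using sets.top[of "predictable_sigma P F"] Q(2) by simp
    ultimately show ?case by auto
  next
    case (Union a)
    have "?\<Omega> - (\<Union>i. a i) = (\<Inter>i. ?\<Omega> - a i)" by auto
    moreover have "?\<Omega> \<in> sets Q" using sets.top[of "predictable_sigma P F"] Q(2) by simp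
    then have "inner_regular Q (\<Inter>i. ?\<Omega> - a i)"
      using Union by (intro inner_regular_INT[OF Q]) auto
    moreover have "inner_regular Q (\<Union>i. a i)"
      using Union by (intro inner_regular_UN[OF Q]) auto
    ultimately show ?case using Union by auto
  qed
  then show ?thesis by blast
qed

text \<open>At a fixed time \<open>t\<close> a generator \<open>{s<..u} \<times> B\<close>
  contributes \<open>B\<close> only if \<open>s < t\<close>, and then \<open>B\<close> is in
  \<open>F t\<close>.\<close>

lemma predictable_adapted:
  assumes A: "predictable P F A" and t: "0 \<le> t" shows "A t \<in> borel_measurable (F t)"
proof -
  have "(\<lambda>\<omega>. (t, \<omega>)) \<in> F t \<rightarrow>\<^sub>M predictable_sigma P F"
    unfolding predictable_sigma_def
  proof (rule measurable_measure_of)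
    show "{{0} \<times> B | B. B \<in> sets (F 0)} \<union>
      {{s<..t} \<times> B | s t B. 0 \<le> s \<and> s \<le> t \<and> B \<in> sets (F s)} \<subseteq> Pow ({0..} \<times> space P)"
      by (rule predictable_rectangles_subset)
    show "(\<lambda>\<omega>. (t, \<omega>)) \<in> space (F t) \<rightarrow> {0..} \<times> space P" using t space_F[OF t] by auto
    fix y assume "y \<in> {{0} \<times> B | B. B \<in> sets (F 0)} \<union>
      {{s<..t} \<times> B | s t B. 0 \<le> s \<and> s \<le> t \<and> B \<in> sets (F s)}"
    then consider B where "y = {0} \<times> B" "B \<in> sets (F 0)"
      | s u B where "y = {s<..u} \<times> B" "0 \<le> s" "s \<le> u" "B \<in> sets (F s)" by blast
    then show "(\<lambda>\<omega>. (t, \<omega>)) -` y \<inter> space (F t) \<in> sets (F t)"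
    proof cases
      case 1
      have "(\<lambda>\<omega>. (t, \<omega>)) -` y \<inter> space (F t) = (if t = 0 then B else {})"
        using sets.sets_into_space[OF 1(2)] by (auto simp: 1(1))
      then show ?thesis using 1 t by auto
    next
      case 2
      have "(\<lambda>\<omega>. (t, \<omega>)) -` y \<inter> space (F t) = (if s < t \<and> t \<le> u then B else {})"
        using sets.sets_into_space[OF 2(4)] space_F[OF 2(2)] space_F[OF t] by (auto simp: 2(1))
      moreover have "B \<in> sets (F t)" if "s < t"
        using that 2(2,4) sets_F_mono[of s t] by (auto dest: less_imp_le)
      ultimately show ?thesis by simp
    qed
  qed
  from measurable_compose[OF this A[unfolded predictable_def]] show ?thesis by simp
qed

end

lemma right_continuousD:
  "right_continuous f \<Longrightarrow> 0 \<le> t \<Longrightarrow> (f \<longlongrightarrow> f t) (at_right t)"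
  by (simp add: right_continuous_def continuous_within)

text \<open>Used at infima: the infimum of the times at which a right-continuous path is at least
  \<open>k\<close> is itself such a time.\<close>

lemma right_continuous_ge:
  assumes "right_continuous f" "0 \<le> t" "\<And>b. t < b \<Longrightarrow> \<exists>s. t \<le> s \<and> s < b \<and> k \<le> f s"
  shows "k \<le> f t"
proof (rule ccontr)
  assume "\<not> k \<le> f t"
  then have "\<forall>\<^sub>F s in at_right t. f s < k"
    by (intro order_tendstoD(2)[OF right_continuousD[OF assms(1,2)]]) simp
  then obtain b where b: "t < b" "\<And>s. t < s \<Longrightarrow> s < b \<Longrightarrow> f s < k"
    unfolding eventually_at_right_field by blast
  from assms(3)[OF b(1)] obtain s where s: "t \<le> s" "s < b" "k \<le> f s" by blast
  with b(2)[of s] \<open>\<not> k \<le> f t\<close> show False by (cases "s = t") auto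
qed

context usual_filtered_prob_space
begin

text \<open>The graph of the hitting time \<open>\<sigma>\<close> of \<open>[k,\<infinity>)\<close> lies in a predictable set, which is exhausted from
  inside by lagged sets up to probability \<open>2\<^sup>-\<^sup>j\<close>; each of these is foretold, and the infimum over \<open>j\<close> of
  the foretelling times is almost surely strictly below \<open>\<sigma>\<close>.\<close>

lemma predictable_level_foretell:
  assumes A: "predictable P F A"
    and A0: "\<And>\<omega>. \<omega> \<in> space P \<Longrightarrow> A 0 \<omega> = 0"
    and mono: "\<And>\<omega>. \<omega> \<in> space P \<Longrightarrow> mono_on {0..} (\<lambda>t. A t \<omega>)"
    and rc: "\<And>\<omega>. \<omega> \<in> space P \<Longrightarrow> right_continuous (\<lambda>t. A t \<omega>)"
    and k: "0 < k" and T: "0 \<le> T" and e: "0 < e"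
  shows "\<exists>\<rho>. is_stopping_time F \<rho> \<and> (AE \<omega> in P. A (stopped_time \<rho> T \<omega>) \<omega> \<le> min (A T \<omega>) k) \<and>
     measure P {\<omega>\<in>space P. \<rho> \<omega> < ennreal T \<and> A T \<omega> < k} \<le> e"
proof -
  have AP[measurable]: "A t \<in> borel_measurable P" if "0 \<le> t" for t
    using predictable_adapted[OF A that] measurable_F_imp[OF that] by blast
  have monoD: "A s \<omega> \<le> A t \<omega>" if "\<omega> \<in> space P" "0 \<le> s" "s \<le> t" for s t \<omega>
    using mono[OF that(1)] that(2,3) by (auto simp: mono_on_def)
  define E where "E = {\<omega>\<in>space P. k \<le> A T \<omega>}"
  have E[measurable]: "E \<in> sets P" unfolding E_def using AP[OF T] by measurable
  \<comment> \<open>\<open>E\<close> is the event that the level is reached by \<open>T\<close>. Off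
    \<open>E\<close> the value \<open>0\<close> is a dummy: the measure \<open>Q\<close> built below
    charges only the graph over \<open>E\<close>.\<close>
  define \<sigma> where "\<sigma> \<omega> = (if \<omega> \<in> E then Inf {t. 0 \<le> t \<and> k \<le> A t \<omega>} else 0)" for \<omega>
  have \<sigma>_le: "\<sigma> \<omega> \<le> t \<longleftrightarrow> \<omega> \<notin> E \<or> k \<le> A t \<omega>" if "\<omega> \<in> space P" "0 \<le> t" for \<omega> t
  proof (cases "\<omega> \<in> E")
    case True
    let ?S = "{t. 0 \<le> t \<and> k \<le> A t \<omega>}"
    have ne: "?S \<noteq> {}" and bb: "bdd_below ?S" using True T by (auto simp: E_def bdd_below_def)
    have nn: "0 \<le> Inf ?S" by (intro cInf_greatest ne) auto
    have "k \<le> A (Inf ?S) \<omega>"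
    proof (rule right_continuous_ge[OF rc[OF that(1)] nn])
      fix b assume "Inf ?S < b"
      then obtain s where "s \<in> ?S" "s < b" using cInf_less_iff[OF ne bb] by blast
      then show "\<exists>s\<ge>Inf ?S. s < b \<and> k \<le> A s \<omega>" using cInf_lower[OF _ bb] by blast
    qed
    then have "k \<le> A t \<omega>" if "Inf ?S \<le> t" using monoD[OF \<open>\<omega> \<in> space P\<close> nn that] by linarith
    moreover have "Inf ?S \<le> t" if "k \<le> A t \<omega>" using that \<open>0 \<le> t\<close> by (intro cInf_lower bb) auto
    ultimately show ?thesis using True by (auto simp: \<sigma>_def)
  qed (use that in \<open>simp add: \<sigma>_def\<close>)
  have \<sigma>_nn: "0 \<le> \<sigma> \<omega>" if "\<omega> \<in> space P" for \<omega>
    using T by (auto simp: \<sigma>_def E_def intro!: cInf_greatest)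
  have \<sigma>_pos: "0 < \<sigma> \<omega>" if "\<omega> \<in> E" for \<omega>
    using \<sigma>_le[of \<omega> 0] that A0[of \<omega>] k \<sigma>_nn[of \<omega>] by (auto simp: E_def not_le[symmetric])
  have \<sigma>_meas: "\<sigma> \<in> borel_measurable P"
  proof (rule borel_measurableI_le)
    fix t :: real
    show "{\<omega>\<in>space P. \<sigma> \<omega> \<le> t} \<in> sets P"
    proof (cases "0 \<le> t")
      case True
      have "{\<omega>\<in>space P. \<sigma> \<omega> \<le> t} = (space P - E) \<union> {\<omega>\<in>space P. k \<le> A t \<omega>}"
        using \<sigma>_le[OF _ True] by auto
      moreover have "(space P - E) \<union> {\<omega>\<in>space P. k \<le> A t \<omega>} \<in> sets P"
        using AP[OF True] by measurable
      ultimately show ?thesis by (simp only:)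
    next
      case False
      then have "{\<omega>\<in>space P. \<sigma> \<omega> \<le> t} = {}" using \<sigma>_nn by fastforce
      then show ?thesis by (simp only: sets.empty_sets)
    qed
  qed
  have g: "(\<lambda>\<omega>. (\<sigma> \<omega>, \<omega>)) \<in> P \<rightarrow>\<^sub>M predictable_sigma P F"
    unfolding predictable_sigma_def
  proof (rule measurable_measure_of[OF predictable_rectangles_subset])
    show "(\<lambda>\<omega>. (\<sigma> \<omega>, \<omega>)) \<in> space P \<rightarrow> {0..} \<times> space P" using \<sigma>_nn by auto
    fix y assume "y \<in> {{0} \<times> B | B. B \<in> sets (F 0)} \<union>
      {{s<..t} \<times> B | s t B. 0 \<le> s \<and> s \<le> t \<and> B \<in> sets (F s)}"
    then consider B where "y = {0} \<times> B" "B \<in> sets (F 0)"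
      | s u B where "y = {s<..u} \<times> B" "0 \<le> s" "s \<le> u" "B \<in> sets (F s)" by blast
    then show "(\<lambda>\<omega>. (\<sigma> \<omega>, \<omega>)) -` y \<inter> space P \<in> sets P"
    proof cases
      case 1
      have "B \<in> sets P" using in_sets_F_imp[OF order_refl 1(2)] .
      moreover have "(\<lambda>\<omega>. (\<sigma> \<omega>, \<omega>)) -` y \<inter> space P = {\<omega>\<in>space P. \<sigma> \<omega> = 0} \<inter> B"
        by (auto simp: 1(1))
      ultimately show ?thesis using \<sigma>_meas by simp
    next
      case 2
      have "B \<in> sets P" using in_sets_F_imp[OF 2(2,4)] .
      moreover have "(\<lambda>\<omega>. (\<sigma> \<omega>, \<omega>)) -` y \<inter> space P = {\<omega>\<in>space P. s < \<sigma> \<omega> \<and> \<sigma> \<omega> \<le> u} \<inter> B"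
        by (auto simp: 2(1))
      ultimately show ?thesis using \<sigma>_meas by simp
    qed
  qed
  \<comment> \<open>The image of \<open>P\<close>, restricted to \<open>E\<close>, under the graph
    map of \<open>\<sigma>\<close>, so that \<open>Q\<close> measures how much of the graph a
    predictable set covers. As \<open>A 0 = 0 < k\<close>, the graph over \<open>E\<close> avoids
    time zero.\<close>
  define Q where "Q = distr (density P (indicator E)) (predictable_sigma P F) (\<lambda>\<omega>. (\<sigma> \<omega>, \<omega>))"
  have Qs: "sets Q = sets (predictable_sigma P F)" by (simp add: Q_def)
  have gd: "(\<lambda>\<omega>. (\<sigma> \<omega>, \<omega>)) \<in> density P (indicator E) \<rightarrow>\<^sub>M predictable_sigma P F"
    using g by (simp cong: measurable_cong_sets)
  have Qe: "emeasure Q S = emeasure P (E \<inter> ((\<lambda>\<omega>. (\<sigma> \<omega>, \<omega>)) -` S \<inter> space P))" if "S \<in> sets Q" for S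
  proof -
    have S: "S \<in> sets (predictable_sigma P F)" using that Qs by simp
    have "(\<lambda>\<omega>. (\<sigma> \<omega>, \<omega>)) -` S \<inter> space P \<in> sets P" using measurable_sets[OF g S] .
    then show ?thesis
      unfolding Q_def emeasure_distr[OF gd S] space_density
      by (subst emeasure_restricted) auto
  qed
  have fin: "finite_measure Q"
  proof (rule finite_measureI)
    have "emeasure Q (space Q) \<le> emeasure P (space P)"
      using Qe[OF sets.top] by (metis Int_lower2 Int_left_absorb emeasure_space sets.sets_into_space E emeasure_mono sets.top le_infI1 order_refl)
    then show "emeasure Q (space Q) \<noteq> \<infinity>" by (auto simp: emeasure_space_1 top_unique)
  qed
  interpret Q: finite_measure Q by fact
  have sP: "space P \<in> sets (F 0)" using space_F[of 0] sets.top[of "F 0"] by simp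
  have "E \<inter> ((\<lambda>\<omega>. (\<sigma> \<omega>, \<omega>)) -` ({0} \<times> space P) \<inter> space P) = {}" using \<sigma>_pos by fastforce
  then have Q0: "measure Q ({0} \<times> space P) = 0"
    using Qe[of "{0} \<times> space P"] zero_predictable[OF sP] Qs by (simp add: measure_def)
  define C where "C = {z \<in> space (predictable_sigma P F). k \<le> (case z of (t, \<omega>) \<Rightarrow> A t \<omega>)}"
  have C: "C \<in> sets Q" unfolding Qs C_def using A unfolding predictable_def by measurable
  have reg: "inner_regular Q C" by (rule predictable_inner_regular[OF fin Qs Q0 C])
  \<comment> \<open>This error only has to vanish as \<open>j\<close> grows, so that almost every
    path of \<open>E\<close> has its graph point in some \<open>L j\<close>; a summable budget is
    needed further on, for the false alarms.\<close>
  have "\<exists>L. lagged_delta L \<and> L \<subseteq> C \<and> measure Q (C - L) \<le> inverse (real (Suc j))" for j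
    using reg unfolding inner_regular_def by simp
  then obtain L where L: "\<And>j. lagged_delta (L j)" "\<And>j. L j \<subseteq> C"
    "\<And>j. measure Q (C - L j) \<le> inverse (real (Suc j))" by metis
  have LQ: "L j \<in> sets Q" for j using lagged_delta_predictable[OF L(1)] Qs by simp
  define N where "N = (\<Inter>j. C - L j)"
  have NQ: "N \<in> sets Q" unfolding N_def using C LQ by (intro sets.countable_INT) auto
  have "measure Q N \<le> inverse (real (Suc j))" for j
  proof -
    have "measure Q N \<le> measure Q (C - L j)" using C LQ by (intro Q.finite_measure_mono) (auto simp: N_def)
    then show ?thesis using L(3)[of j] by linarith
  qed
  then have "measure Q N \<le> 0" using LIMSEQ_le_const[OF LIMSEQ_inverse_real_of_nat] by blast
  then have "emeasure Q N = 0" by (simp add: Q.emeasure_eq_measure measure_le_0_iff)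
  then have "emeasure P (E \<inter> ((\<lambda>\<omega>. (\<sigma> \<omega>, \<omega>)) -` N \<inter> space P)) = 0" using Qe[OF NQ] by simp
  moreover have "E \<inter> ((\<lambda>\<omega>. (\<sigma> \<omega>, \<omega>)) -` N \<inter> space P) \<in> sets P"
    using measurable_sets[OF g, of N] NQ Qs by auto
  ultimately have "AE \<omega> in P. \<omega> \<notin> E \<inter> ((\<lambda>\<omega>. (\<sigma> \<omega>, \<omega>)) -` N \<inter> space P)"
    by (intro AE_not_in) (simp add: null_sets_def)
  then have AEL: "AE \<omega> in P. \<omega> \<in> E \<longrightarrow> (\<exists>j. (\<sigma> \<omega>, \<omega>) \<in> L j)"
  proof (rule AE_mp, intro AE_I2 impI)
    fix \<omega> assume \<omega>: "\<omega> \<in> space P" "\<omega> \<in> E" and n: "\<omega> \<notin> E \<inter> ((\<lambda>\<omega>. (\<sigma> \<omega>, \<omega>)) -` N \<inter> space P)"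
    have "(\<sigma> \<omega>, \<omega>) \<in> C" using \<sigma>_le[OF \<omega>(1) \<sigma>_nn[OF \<omega>(1)]] \<omega> \<sigma>_nn[OF \<omega>(1)] by (auto simp: C_def)
    moreover have "(\<sigma> \<omega>, \<omega>) \<notin> N" using n \<omega> by auto
    ultimately show "\<exists>j. (\<sigma> \<omega>, \<omega>) \<in> L j" by (auto simp: N_def)
  qed
  \<comment> \<open>Off \<open>E\<close> the level is not reached by \<open>T\<close>, so
    \<open>C\<close> has no point there up to \<open>T\<close> and an announcement before
    \<open>T\<close> is a false alarm. Since an infimum over \<open>j\<close> is taken below, the
    probabilities of the false alarms must add up to at most \<open>e\<close>.\<close>
  have "\<exists>\<theta>. is_stopping_time F \<theta> \<and> (\<forall>t \<omega>. (t, \<omega>) \<in> L j \<longrightarrow> \<theta> \<omega> < ennreal t) \<and>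
    measure P {\<omega>\<in>space P - E. \<theta> \<omega> < ennreal T} < e * (1/2) ^ Suc j" for j
  proof (rule lagged_delta_foretell[OF L(1) T])
    show "(t, \<omega>) \<notin> L j" if "\<omega> \<in> space P - E" "0 \<le> t" "t \<le> T" for t \<omega>
    proof
      assume "(t, \<omega>) \<in> L j"
      then have "k \<le> A t \<omega>" using L(2)[of j] by (auto simp: C_def)
      also have "\<dots> \<le> A T \<omega>" using monoD that by simp
      finally show False using that by (simp add: E_def)
    qed
  qed (use e in auto)
  then obtain \<theta> where \<theta>: "\<And>j. is_stopping_time F (\<theta> j)" "\<And>j t \<omega>. (t, \<omega>) \<in> L j \<Longrightarrow> \<theta> j \<omega> < ennreal t"
    "\<And>j. measure P {\<omega>\<in>space P - E. \<theta> j \<omega> < ennreal T} < e * (1/2) ^ Suc j" by metis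
  define \<rho> where "\<rho> \<omega> = (INF j. \<theta> j \<omega>)" for \<omega>
  have 1: "is_stopping_time F \<rho>" unfolding \<rho>_def[abs_def] by (rule stop_INF[OF \<theta>(1)])
  have 2: "AE \<omega> in P. A (stopped_time \<rho> T \<omega>) \<omega> \<le> min (A T \<omega>) k"
    using AEL
  proof (rule AE_mp, intro AE_I2 impI)
    fix \<omega> assume \<omega>: "\<omega> \<in> space P" and n: "\<omega> \<in> E \<longrightarrow> (\<exists>j. (\<sigma> \<omega>, \<omega>) \<in> L j)"
    have AT: "A (stopped_time \<rho> T \<omega>) \<omega> \<le> A T \<omega>"
      using monoD[OF \<omega> stopped_time_nonneg stopped_time_le[OF T]] .
    moreover have "A (stopped_time \<rho> T \<omega>) \<omega> \<le> k"
    proof (cases "\<omega> \<in> E")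
      case True
      with n obtain j where "(\<sigma> \<omega>, \<omega>) \<in> L j" by blast
      then have "\<rho> \<omega> < ennreal (\<sigma> \<omega>)" unfolding \<rho>_def using \<theta>(2) by (auto simp: INF_less_iff)
      then have "ennreal (stopped_time \<rho> T \<omega>) < ennreal (\<sigma> \<omega>)"
        unfolding ennreal_stopped_time[OF T] by (simp add: min_less_iff_disj)
      then have "\<not> \<sigma> \<omega> \<le> stopped_time \<rho> T \<omega>" using ennreal_leI not_le by blast
      then show ?thesis using \<sigma>_le[OF \<omega> stopped_time_nonneg] by fastforce
    next
      case False
      then show ?thesis using AT \<omega> by (simp add: E_def)
    qed
    ultimately show "A (stopped_time \<rho> T \<omega>) \<omega> \<le> min (A T \<omega>) k" by simp
  qed
  have 3: "measure P {\<omega>\<in>space P. \<rho> \<omega> < ennreal T \<and> A T \<omega> < k} \<le> e"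
  proof -
    let ?B = "\<lambda>j. {\<omega>\<in>space P - E. \<theta> j \<omega> < ennreal T}"
    have BP: "?B j \<in> sets P" for j
    proof -
      have "?B j = (space P - E) \<inter> {\<omega>\<in>space P. \<theta> j \<omega> < ennreal T}" by auto
      then show ?thesis
        using sets.Int[OF sets.compl_sets[OF E] in_sets_F_imp[OF T stopD_less[OF \<theta>(1)[of j] T]]] by simp
    qed
    have sm: "(\<lambda>i. e * (1/2) ^ Suc i) sums (e * 1)" by (intro sums_mult power_half_series)
    have sm': "summable (\<lambda>i. measure P (?B i))"
    proof (rule summable_comparison_test'[OF sums_summable[OF sm], of 0])
      show "norm (measure P (?B i)) \<le> e * (1/2) ^ Suc i" for i
        using \<theta>(3)[of i] by (simp only: real_norm_def abs_of_nonneg measure_nonneg less_imp_le)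
    qed
    have "{\<omega>\<in>space P. \<rho> \<omega> < ennreal T \<and> A T \<omega> < k} = (\<Union>j. ?B j)"
      by (auto simp: \<rho>_def INF_less_iff E_def)
    then have "measure P {\<omega>\<in>space P. \<rho> \<omega> < ennreal T \<and> A T \<omega> < k} \<le> (\<Sum>i. measure P (?B i))"
      using finite_measure_subadditive_countably[OF image_subsetI sm'] BP by simp
    also have "\<dots> \<le> (\<Sum>i. e * (1/2) ^ Suc i)"
      by (intro suminf_le sm' sums_summable[OF sm] less_imp_le[OF \<theta>(3)])
    also have "\<dots> = e" using sums_unique[OF sm] by simp
    finally show ?thesis .
  qed
  show ?thesis using 1 2 3 by blast
qed

end

section \<open>Hitting times and Stieltjes integrals\<close>

definition hitting :: "(real \<Rightarrow> 'a \<Rightarrow> real) \<Rightarrow> real \<Rightarrow> 'a \<Rightarrow> ennreal" where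
  "hitting X u \<omega> = (INF t\<in>{t. 0 \<le> t \<and> u < X t \<omega>}. ennreal t)"

lemma hitting_less_iff: "hitting X u \<omega> < x \<longleftrightarrow> (\<exists>t\<ge>0. u < X t \<omega> \<and> ennreal t < x)"
  by (auto simp: hitting_def INF_less_iff)

lemma le_before_hitting: "0 \<le> s \<Longrightarrow> ennreal s < hitting X u \<omega> \<Longrightarrow> X s \<omega> \<le> u"
  using hitting_less_iff[of X u \<omega> "hitting X u \<omega>"] by (meson less_irrefl not_le)

lemma ge_at_hitting:
  assumes rc: "right_continuous (\<lambda>t. X t \<omega>)" and t: "0 \<le> t" "hitting X u \<omega> = ennreal t"
  shows "u \<le> X t \<omega>"
proof (rule right_continuous_ge[OF rc t(1)])
  fix b assume b: "t < b"
  then have "hitting X u \<omega> < ennreal b" using t by (simp add: ennreal_less_iff)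
  then obtain s where s: "0 \<le> s" "u < X s \<omega>" "ennreal s < ennreal b" unfolding hitting_less_iff by blast
  then have "s < b" using b t by (simp add: ennreal_less_iff)
  moreover have "t \<le> s"
  proof (rule ccontr)
    assume "\<not> t \<le> s"
    then have "ennreal s < hitting X u \<omega>" using s t by (simp add: ennreal_less_iff)
    with le_before_hitting[OF s(1) this] s(2) show False by simp
  qed
  ultimately show "\<exists>s\<ge>t. s < b \<and> u \<le> X s \<omega>" using s(2) by (intro exI[of _ s]) auto
qed

lemma right_continuous_rational:
  assumes "right_continuous f" "0 \<le> t" "t < b" "u < f t"
  shows "\<exists>q\<in>\<rat>. t < q \<and> q < b \<and> u < f q"
proof -
  have "\<forall>\<^sub>F s in at_right t. u < f s"
    using order_tendstoD(1)[OF right_continuousD[OF assms(1,2)] assms(4)] .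
  then obtain d where d: "t < d" "\<And>s. t < s \<Longrightarrow> s < d \<Longrightarrow> u < f s"
    unfolding eventually_at_right_field by blast
  then obtain q where "q \<in> \<rat>" "t < q" "q < min b d"
    using Rats_dense_in_real[of t "min b d"] assms(3) by auto
  with d show ?thesis by auto
qed

lemma rational_seq_right:
  fixes t b :: real assumes "t < b"
  obtains q where "\<And>n. q n \<in> \<rat>" "\<And>n. t < q n" "\<And>n. q n < b" "q \<longlonglongrightarrow> t"
proof -
  have "\<exists>q\<in>\<rat>. t < q \<and> q < min b (t + inverse (real (Suc n)))" for n
    using Rats_dense_in_real[of t "min b (t + inverse (real (Suc n)))"] assms by auto
  then obtain q where q: "\<And>n. q n \<in> \<rat>" "\<And>n. t < q n" "\<And>n. q n < min b (t + inverse (real (Suc n)))"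
    by metis
  have "q \<longlonglongrightarrow> t"
    by (rule tendsto_sandwich[OF _ _ tendsto_const LIMSEQ_inverse_real_of_nat_add[of t]])
      (use q in \<open>auto intro!: always_eventually less_imp_le\<close>)
  then show ?thesis using that[of q] q by auto
qed

context usual_filtered_prob_space
begin

text \<open>Because the passage is strict, a right-continuous path that exceeds \<open>u\<close>
  before \<open>t\<close> does so at a rational time before \<open>t\<close>. Hence the event of
  passage before \<open>t\<close> is in \<open>F t\<close>, and right-continuity of the filtration
  does the rest.\<close>

lemma stop_hitting:
  assumes X: "adapted F X" and rc: "\<And>\<omega>. \<omega> \<in> space P \<Longrightarrow> right_continuous (\<lambda>t. X t \<omega>)"
  shows "is_stopping_time F (hitting X u)"
proof (rule stopI_less)
  fix t :: real assume t: "0 < t"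
  have "hitting X u \<omega> < ennreal t \<longleftrightarrow> (\<exists>q\<in>\<rat> \<inter> {0..<t}. u < X q \<omega>)" if "\<omega> \<in> space P" for \<omega>
  proof
    assume "hitting X u \<omega> < ennreal t"
    then obtain s where s: "0 \<le> s" "u < X s \<omega>" "ennreal s < ennreal t" unfolding hitting_less_iff by blast
    then have "s < t" using t by (simp add: ennreal_less_iff)
    from right_continuous_rational[OF rc[OF that] s(1) this s(2)] s(1)
    show "\<exists>q\<in>\<rat> \<inter> {0..<t}. u < X q \<omega>" by auto
  next
    assume "\<exists>q\<in>\<rat> \<inter> {0..<t}. u < X q \<omega>"
    then show "hitting X u \<omega> < ennreal t" by (auto simp: hitting_less_iff ennreal_less_iff)
  qed
  then have "{\<omega>\<in>space P. hitting X u \<omega> < ennreal t} = (\<Union>q\<in>\<rat> \<inter> {0..<t}. {\<omega>\<in>space P. u < X q \<omega>})"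
    by auto
  also have "\<dots> \<in> sets (F t)"
  proof (intro sets.countable_UN' image_subsetI)
    fix q assume q: "q \<in> \<rat> \<inter> {0..<t}"
    then have "X q \<in> borel_measurable (F t)"
      using X measurable_F_mono[of q t "X q"] by (auto simp: adapted_def)
    then have "{\<omega>\<in>space (F t). u < X q \<omega>} \<in> sets (F t)" by measurable
    then show "{\<omega>\<in>space P. u < X q \<omega>} \<in> sets (F t)" using space_F[of t] t by simp
  qed (auto intro!: countable_subset[OF _ countable_rat])
  finally show "{\<omega>\<in>space P. hitting X u \<omega> < ennreal t} \<in> sets (F t)" .
qed

end

lemma right_continuous_extend:
  fixes a :: "real \<Rightarrow> real"
  assumes "right_continuous a"
  shows "continuous (at_right t) (\<lambda>s. a (max 0 s))"
proof (cases "0 \<le> t")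
  case True
  have "\<forall>\<^sub>F s in at_right t. a s = a (max 0 s)"
    using True by (auto intro!: eventually_at_rightI[of t "t + 1"] simp: max_def)
  from Lim_transform_eventually[OF right_continuousD[OF assms True] this] True
  show ?thesis by (simp add: continuous_within max_def)
next
  case False
  then have "\<forall>\<^sub>F s in at_right t. a (max 0 s) = a (max 0 t)"
    by (auto intro!: eventually_at_rightI[of t 0] simp: max_def)
  then show ?thesis by (simp add: continuous_within tendsto_eventually)
qed

lemma mono_extend:
  fixes a :: "real \<Rightarrow> real"
  assumes "mono_on {0..} a" "x \<le> y" shows "a (max 0 x) \<le> a (max 0 y)"
  using assms by (auto simp: mono_on_def max_def)

lemma emeasure_stieltjes_Ioc:
  assumes "mono_on {0..} a" "right_continuous a" "0 \<le> x" "x \<le> y"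
  shows "emeasure (interval_measure (\<lambda>s. a (max 0 s))) {x<..y} = ennreal (a y - a x)"
  using emeasure_interval_measure_Ioc[of x y "\<lambda>s. a (max 0 s)", OF assms(4) mono_extend[OF assms(1)]
      right_continuous_extend[OF assms(2)]] assms(3,4) by (simp add: max_def)

lemma stieltjes_integral_step:
  assumes a: "mono_on {0..} a" "right_continuous a"
    and st: "0 \<le> s" "s \<le> t" and K: "\<And>r. s < r \<Longrightarrow> r \<le> t \<Longrightarrow> f r \<le> ennreal K" "0 \<le> K"
    and f: "f \<in> borel_measurable borel"
  shows "stieltjes_integral f a t \<le> stieltjes_integral f a s + ennreal (K * (a t - a s))"
proof -
  let ?\<mu> = "interval_measure (\<lambda>s. a (max 0 s))"
  have [measurable]: "f \<in> borel_measurable ?\<mu>" using f by simp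
  have "stieltjes_integral f a t
      \<le> (\<integral>\<^sup>+r. f r * indicator {0<..s} r + ennreal K * indicator {s<..t} r \<partial>?\<mu>)"
    unfolding stieltjes_integral_def using K st
    by (intro nn_integral_mono) (auto simp: indicator_def not_le)
  also have "\<dots> = stieltjes_integral f a s + ennreal K * emeasure ?\<mu> {s<..t}"
    unfolding stieltjes_integral_def
    by (subst nn_integral_add) (auto simp: nn_integral_cmult_indicator)
  also have "\<dots> = stieltjes_integral f a s + ennreal (K * (a t - a s))"
    using K(2) emeasure_stieltjes_Ioc[OF a st] by (simp add: ennreal_mult')
  finally show ?thesis .
qed

lemma running_sup_left_le:
  assumes "0 < b" "s \<le> b" "\<And>r. 0 \<le> r \<Longrightarrow> r < b \<Longrightarrow> X r \<omega> \<le> K"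
  shows "running_sup_left X s \<omega> \<le> ennreal K"
  unfolding running_sup_left_def using assms by (auto intro!: SUP_least ennreal_leI)

lemma running_sup_left_mono:
  assumes "s \<le> t" shows "running_sup_left X s \<omega> \<le> running_sup_left X t \<omega>"
proof (cases "0 < t")
  case True
  then have "ennreal (X 0 \<omega>) \<le> (SUP s\<in>{0..<t}. ennreal (X s \<omega>))" by (intro SUP_upper) auto
  then show ?thesis using assms True by (auto simp: running_sup_left_def intro!: SUP_subset_mono)
qed (use assms in \<open>auto simp: running_sup_left_def\<close>)

lemma running_sup_left_measurable_path: "(\<lambda>s. running_sup_left X s \<omega>) \<in> borel_measurable borel"
proof (rule borel_measurableI_greater)
  fix y
  define S where "S = {s. y < running_sup_left X s \<omega>}"
  have up: "t \<in> S" if "s \<in> S" "s \<le> t" for s t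
    using that running_sup_left_mono[OF that(2), of X \<omega>] unfolding S_def by (auto intro: less_le_trans)
  then have "is_interval S" unfolding is_interval_1 by blast
  then have "S \<in> sets borel" by (rule real_interval_borel_measurable)
  then show "{x \<in> space borel. y < running_sup_left X x \<omega>} \<in> sets borel" by (simp add: S_def)
qed

lemma eta_ext_measurable:
  assumes "continuous_on {0..} \<eta>"
  shows "eta_ext \<eta> \<in> borel_measurable borel"
proof -
  have "continuous_on UNIV (\<lambda>x. \<eta> (max 0 x))"
    by (rule continuous_on_compose2[OF assms]) (auto intro!: continuous_intros)
  then have [measurable]: "(\<lambda>x. \<eta> (max 0 x)) \<in> borel_measurable borel"
    by (rule borel_measurable_continuous_onI)
  have "eta_ext \<eta> = (\<lambda>x. if x = \<top> then Lim at_top (\<lambda>r. ennreal (\<eta> r)) else ennreal (\<eta> (max 0 (enn2real x))))"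
    by (auto simp: eta_ext_def fun_eq_iff max_def)
  then show ?thesis by simp
qed

text \<open>The inequality of condition \<open>A_sup\<close> extends from rational times to a time \<open>t\<close> by right-continuity
  as long as \<open>X\<close> has not exploded before \<open>t\<close>; otherwise the Stieltjes integral may jump to infinity
  immediately after \<open>t\<close>.\<close>

lemma inequality_extends:
  assumes rational: "\<And>q. q \<in> \<rat> \<Longrightarrow> 0 \<le> q \<Longrightarrow> ereal (X q \<omega>)
      \<le> enn2ereal (stieltjes_integral (\<lambda>s. eta_ext \<eta> (running_sup_left X s \<omega>)) a q) + ereal (m q) + ereal (h q)"
    and a: "mono_on {0..} a" "right_continuous a"
    and x: "right_continuous (\<lambda>t. X t \<omega>)" "\<And>t. 0 \<le> t \<Longrightarrow> 0 \<le> X t \<omega>"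
    and m: "right_continuous m" and h: "right_continuous h"
    and \<eta>: "continuous_on {0..} \<eta>" "mono_on {0..} \<eta>" "\<And>x. 0 \<le> x \<Longrightarrow> 0 \<le> \<eta> x"
    and t: "0 \<le> t" and before: "\<And>s. 0 \<le> s \<Longrightarrow> s < t \<Longrightarrow> X s \<omega> \<le> u"
  defines "I \<equiv> stieltjes_integral (\<lambda>s. eta_ext \<eta> (running_sup_left X s \<omega>)) a t"
  shows "I < \<top>" "X t \<omega> \<le> enn2real I + m t + h t"
proof -
  let ?f = "\<lambda>s. eta_ext \<eta> (running_sup_left X s \<omega>)"
  let ?I = "stieltjes_integral ?f a"
  have f: "?f \<in> borel_measurable borel"
    using measurable_compose[OF running_sup_left_measurable_path eta_ext_measurable[OF \<eta>(1)]] .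
  \<comment> \<open>Bounds \<open>X\<close> on \<open>[0, b)\<close> for some \<open>b > t\<close>:
    by \<open>u\<close> before \<open>t\<close>, and by \<open>X t + 1\<close> at \<open>t\<close>
    and just after it. So the integrand stays bounded a little beyond \<open>t\<close>.\<close>
  define K where "K = max u (X t \<omega> + 1)"
  have K0: "0 \<le> K" using x(2)[OF t] by (simp add: K_def)
  have "\<forall>\<^sub>F s in at_right t. X s \<omega> < X t \<omega> + 1"
    by (intro order_tendstoD(2)[OF right_continuousD[OF x(1) t]]) simp
  then obtain b where b: "t < b" "\<And>s. t < s \<Longrightarrow> s < b \<Longrightarrow> X s \<omega> < X t \<omega> + 1"
    unfolding eventually_at_right_field by blast
  have XK: "X r \<omega> \<le> K" if "0 \<le> r" "r < b" for r
    using before[OF that(1)] b(2)[OF _ that(2)] by (cases r t rule: linorder_cases) (auto simp: K_def)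
  have fK: "?f r \<le> ennreal (\<eta> K)" if "r \<le> b" for r
  proof -
    have le: "running_sup_left X r \<omega> \<le> ennreal K"
      using b(1) t that XK by (intro running_sup_left_le[of b]) auto
    then have "running_sup_left X r \<omega> \<noteq> \<top>" by (auto simp: top_unique)
    moreover have "enn2real (running_sup_left X r \<omega>) \<le> K" using enn2real_mono[OF le] K0 by simp
    ultimately show ?thesis using \<eta>(2) K0 by (auto simp: eta_ext_def mono_on_def intro!: ennreal_leI)
  qed
  have e0: "0 \<le> \<eta> K" using \<eta>(3) K0 by simp
  have "?I t \<le> ?I 0 + ennreal (\<eta> K * (a t - a 0))"
    using b by (intro stieltjes_integral_step[OF a] fK f e0 t) auto
  moreover have "?I 0 = 0" by (simp add: stieltjes_integral_def)
  ultimately show fin: "I < \<top>" by (simp add: I_def le_less_trans)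
  obtain q where q: "\<And>n. q n \<in> \<rat>" "\<And>n. t < q n" "\<And>n. q n < b" "q \<longlonglongrightarrow> t"
    using rational_seq_right[OF b(1)] by blast
  have q0: "0 \<le> q n" for n using q(2)[of n] t by simp
  \<comment> \<open>At rational times just after \<open>t\<close> the integral exceeds its value at
    \<open>t\<close> by at most \<open>\<eta> K\<close> times the increment of \<open>a\<close>,
    which vanishes in the limit.\<close>
  have le: "X (q n) \<omega> \<le> enn2real I + \<eta> K * (a (q n) - a t) + m (q n) + h (q n)" for n
  proof -
    have mon: "0 \<le> \<eta> K * (a (q n) - a t)"
      using e0 a(1) q(2)[of n] t by (auto simp: mono_on_def)
    have "?I (q n) \<le> I + ennreal (\<eta> K * (a (q n) - a t))"
      unfolding I_def using q(2,3)[of n] by (intro stieltjes_integral_step[OF a] fK f e0 t) auto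
    also have "\<dots> = ennreal (enn2real I + \<eta> K * (a (q n) - a t))"
      using fin mon by (subst ennreal_plus) auto
    finally have "enn2ereal (?I (q n)) \<le> ereal (enn2real I + \<eta> K * (a (q n) - a t))"
      using mon enn2ereal_ennreal[of "enn2real I + \<eta> K * (a (q n) - a t)"]
      unfolding less_eq_ennreal.rep_eq by simp
    then have "enn2ereal (?I (q n)) + ereal (m (q n)) + ereal (h (q n))
       \<le> ereal (enn2real I + \<eta> K * (a (q n) - a t)) + ereal (m (q n)) + ereal (h (q n))"
      by (intro add_right_mono)
    with rational[OF q(1) q0, of n] show ?thesis by (auto dest: order_trans)
  qed
  have lim: "(\<lambda>n. f (q n)) \<longlonglongrightarrow> f t" if "right_continuous f" for f :: "real \<Rightarrow> real"
    using right_continuous_seq[OF that t q(4,2)] .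
  have "(\<lambda>n. enn2real I + \<eta> K * (a (q n) - a t) + m (q n) + h (q n)) \<longlonglongrightarrow> enn2real I + \<eta> K * (a t - a t) + m t + h t"
    by (intro tendsto_intros lim a m h)
  from LIMSEQ_le[OF lim[OF x(1)] this] le show "X t \<omega> \<le> enn2real I + m t + h t" by simp
qed

section \<open>Processes satisfying condition A_sup\<close>

locale A_sup = usual_filtered_prob_space P F for P :: "'a measure" and F +
  fixes \<eta> :: "real \<Rightarrow> real" and X A H M :: "real \<Rightarrow> 'a \<Rightarrow> real"
  assumes cond: "condition_A_sup P F \<eta> X A H M"
begin

lemma X_nonneg: "\<omega> \<in> space P \<Longrightarrow> 0 \<le> t \<Longrightarrow> 0 \<le> X t \<omega>"
  and X_rc: "\<omega> \<in> space P \<Longrightarrow> right_continuous (\<lambda>t. X t \<omega>)"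
  and X_adapted: "adapted F X"
  and A_predictable: "predictable P F A"
  and A_0: "\<omega> \<in> space P \<Longrightarrow> A 0 \<omega> = 0"
  and A_mono_on: "\<omega> \<in> space P \<Longrightarrow> mono_on {0..} (\<lambda>t. A t \<omega>)"
  and A_rc: "\<omega> \<in> space P \<Longrightarrow> right_continuous (\<lambda>t. A t \<omega>)"
  and H_nonneg: "\<omega> \<in> space P \<Longrightarrow> 0 \<le> t \<Longrightarrow> 0 \<le> H t \<omega>"
  and H_mono_on: "\<omega> \<in> space P \<Longrightarrow> mono_on {0..} (\<lambda>t. H t \<omega>)"
  and H_rc: "\<omega> \<in> space P \<Longrightarrow> right_continuous (\<lambda>t. H t \<omega>)"
  and H_adapted: "adapted F H"
  and M_loc: "cadlag_local_martingale P F M"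
  and M_0: "\<omega> \<in> space P \<Longrightarrow> M 0 \<omega> = 0"
  and M_rc: "\<omega> \<in> space P \<Longrightarrow> right_continuous (\<lambda>t. M t \<omega>)"
  and eta_cont: "continuous_on {0..} \<eta>"
  and eta_mono: "mono_on {0..} \<eta>"
  and eta_nonneg: "0 \<le> x \<Longrightarrow> 0 \<le> \<eta> x"
  and eta_pos: "0 < x \<Longrightarrow> 0 < \<eta> x"
  using cond by (auto simp: condition_A_sup_def cadlag_def cadlag_local_martingale_def)

lemma X_meas: "0 \<le> t \<Longrightarrow> X t \<in> borel_measurable P"
  using X_adapted measurable_F_imp by (auto simp: adapted_def)

lemma A_meas: "0 \<le> t \<Longrightarrow> A t \<in> borel_measurable P"
  using predictable_adapted[OF A_predictable] measurable_F_imp by blast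

lemma H_meas: "0 \<le> t \<Longrightarrow> H t \<in> borel_measurable P"
  using H_adapted measurable_F_imp by (auto simp: adapted_def)

lemma A_mono: "\<omega> \<in> space P \<Longrightarrow> 0 \<le> s \<Longrightarrow> s \<le> t \<Longrightarrow> A s \<omega> \<le> A t \<omega>"
  using A_mono_on[of \<omega>] by (auto simp: mono_on_def)

lemma A_nonneg: "\<omega> \<in> space P \<Longrightarrow> 0 \<le> t \<Longrightarrow> 0 \<le> A t \<omega>"
  using A_mono[of \<omega> 0 t] A_0[of \<omega>] by simp

lemma H_mono: "\<omega> \<in> space P \<Longrightarrow> 0 \<le> s \<Longrightarrow> s \<le> t \<Longrightarrow> H s \<omega> \<le> H t \<omega>"
  using H_mono_on[of \<omega>] by (auto simp: mono_on_def)

section \<open>The random measure \<open>dA\<close> and joint measurability of its integrals\<close>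

definition dA :: "'a \<Rightarrow> real measure" where
  "dA \<omega> = interval_measure (\<lambda>s. A (max 0 s) \<omega>)"

lemma sets_dA [measurable_cong, simp]: "sets (dA \<omega>) = sets borel"
  by (simp add: dA_def)

lemma space_dA [simp]: "space (dA \<omega>) = UNIV"
  by (simp add: dA_def)

lemma emeasure_dA_Ioc:
  "\<omega> \<in> space P \<Longrightarrow> 0 \<le> x \<Longrightarrow> x \<le> y \<Longrightarrow> emeasure (dA \<omega>) {x<..y} = ennreal (A y \<omega> - A x \<omega>)"
  unfolding dA_def by (rule emeasure_stieltjes_Ioc[OF A_mono_on A_rc])

lemma sigma_finite_dA: "\<omega> \<in> space P \<Longrightarrow> sigma_finite_measure (dA \<omega>)"
  unfolding dA_def by (intro sigma_finite_interval_measure mono_extend A_mono_on right_continuous_extend A_rc)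

text \<open>Before the passage above \<open>u\<close> this agrees with
  \<open>eta_ext \<eta>\<close>, and afterwards it vanishes once the running supremum exceeds
  \<open>u\<close>, including the value \<open>\<top>\<close>. Its integral can therefore be
  extended past the passage without loss of control.\<close>

definition eta_trunc :: "real \<Rightarrow> ennreal \<Rightarrow> ennreal" where
  "eta_trunc u r = (if r \<le> ennreal u then ennreal (\<eta> (enn2real r)) else 0)"

definition trunc_integral :: "real \<Rightarrow> real \<Rightarrow> 'a \<Rightarrow> ennreal" where
  "trunc_integral u t \<omega> = (\<integral>\<^sup>+s. indicator {0<..t} s * eta_trunc u (running_sup_left X s \<omega>) \<partial>dA \<omega>)"

lemma eta_trunc_measurable [measurable]:
  "(\<lambda>(u, r). eta_trunc u r) \<in> borel_measurable (borel \<Otimes>\<^sub>M borel)"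
proof -
  have "continuous_on UNIV (\<lambda>x. \<eta> (max 0 x))"
    by (rule continuous_on_compose2[OF eta_cont]) (auto intro!: continuous_intros)
  then have [measurable]: "(\<lambda>x. \<eta> (max 0 x)) \<in> borel_measurable borel"
    by (rule borel_measurable_continuous_onI)
  have "(\<lambda>(u, r). eta_trunc u r)
    = (\<lambda>(u, r). if r \<le> ennreal u then ennreal (\<eta> (max 0 (enn2real r))) else 0)"
    by (auto simp: eta_trunc_def fun_eq_iff max_def)
  then show ?thesis by simp
qed

text \<open>Joint measurability in \<open>\<omega>\<close> and \<open>s\<close> needs a countable
  supremum: right-continuity approximates every time below \<open>s\<close> by rationals to its
  right that are still below \<open>s\<close>. The separate term \<open>X 0\<close> is the
  convention for \<open>s \<le> 0\<close>.\<close>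

lemma running_sup_left_countable:
  assumes \<omega>: "\<omega> \<in> space P"
  shows "running_sup_left X s \<omega>
    = max (ennreal (X 0 \<omega>)) (SUP q\<in>\<rat> \<inter> {0..}. (if q < s then ennreal (X q \<omega>) else 0))"
    (is "_ = max _ (SUP q\<in>?Q. ?g q)")
proof (rule antisym)
  show "running_sup_left X s \<omega> \<le> max (ennreal (X 0 \<omega>)) (SUP q\<in>?Q. ?g q)"
  proof (cases "0 < s")
    case True
    have "ennreal (X r \<omega>) \<le> (SUP q\<in>?Q. ?g q)" if r: "0 \<le> r" "r < s" for r
    proof -
      obtain q where q: "\<And>n. q n \<in> \<rat>" "\<And>n. r < q n" "\<And>n. q n < s" "q \<longlonglongrightarrow> r"
        using rational_seq_right[OF r(2)] by blast
      have "(\<lambda>n. ennreal (X (q n) \<omega>)) \<longlonglongrightarrow> ennreal (X r \<omega>)"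
        using right_continuous_seq[OF X_rc[OF \<omega>] r(1) q(4,2)] by (rule tendsto_ennrealI)
      moreover have "ennreal (X (q n) \<omega>) \<le> (SUP q\<in>?Q. ?g q)" for n
      proof -
        have "q n \<in> ?Q" using q(1,2)[of n] r by auto
        then have "?g (q n) \<le> (SUP q\<in>?Q. ?g q)" by (rule SUP_upper)
        then show ?thesis using q(3)[of n] by simp
      qed
      ultimately show ?thesis by (intro LIMSEQ_le_const2) auto
    qed
    then have "running_sup_left X s \<omega> \<le> (SUP q\<in>?Q. ?g q)"
      unfolding running_sup_left_def using True by (auto intro!: SUP_least)
    then show ?thesis by (simp add: le_max_iff_disj)
  qed (simp add: running_sup_left_def)
  have "?g q \<le> running_sup_left X s \<omega>" if "q \<in> ?Q" for q
    using that unfolding running_sup_left_def by (auto intro: SUP_upper)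
  moreover have "ennreal (X 0 \<omega>) \<le> running_sup_left X s \<omega>"
    unfolding running_sup_left_def by (auto intro: SUP_upper)
  ultimately show "max (ennreal (X 0 \<omega>)) (SUP q\<in>?Q. ?g q) \<le> running_sup_left X s \<omega>"
    by (intro max.boundedI SUP_least)
qed

lemma running_sup_left_measurable:
  "(\<lambda>(\<omega>, s). running_sup_left X s \<omega>) \<in> borel_measurable (P \<Otimes>\<^sub>M borel)"
proof -
  have c: "countable (\<rat> \<inter> {0::real..})" using countable_subset[OF _ countable_rat] by blast
  have "(\<lambda>z. ennreal (X 0 (fst z))) \<in> borel_measurable (P \<Otimes>\<^sub>M (borel :: real measure))"
    using X_meas[of 0] by measurable
  moreover have "(\<lambda>z. SUP q\<in>\<rat> \<inter> {0..}. (if q < snd z then ennreal (X q (fst z)) else 0)) \<in> borel_measurable (P \<Otimes>\<^sub>M borel)"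
  proof (rule borel_measurable_SUP[OF c])
    fix q :: real assume "q \<in> \<rat> \<inter> {0..}"
    then have [measurable]: "X q \<in> borel_measurable P" using X_meas by auto
    show "(\<lambda>z. if q < snd z then ennreal (X q (fst z)) else 0) \<in> borel_measurable (P \<Otimes>\<^sub>M borel)"
      by measurable
  qed
  ultimately have "(\<lambda>z. max (ennreal (X 0 (fst z)))
      (SUP q\<in>\<rat> \<inter> {0..}. (if q < snd z then ennreal (X q (fst z)) else 0))) \<in> borel_measurable (P \<Otimes>\<^sub>M borel)"
    by (intro borel_measurable_max)
  then show ?thesis
    by (rule measurable_cong[THEN iffD1, rotated])
      (auto simp: space_pair_measure running_sup_left_countable)
qed

text \<open>Normalising by \<open>1 + A\<^sub>T\<close> gives sub-probability kernels, for which the Giry monad provides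
  measurability.\<close>

lemma dA_kernel:
  assumes T: "0 \<le> T"
  shows "(\<lambda>\<omega>. density (dA \<omega>) (\<lambda>s. indicator {0<..T} s * ennreal (1 / (1 + A T \<omega>))))
    \<in> P \<rightarrow>\<^sub>M subprob_algebra borel" (is "?K \<in> _")
proof -
  have ems: "emeasure (?K \<omega>) S = ennreal (1 / (1 + A T \<omega>)) * emeasure (dA \<omega>) (S \<inter> {0<..T})"
    if "S \<in> sets borel" for S \<omega>
  proof -
    have "emeasure (?K \<omega>) S = (\<integral>\<^sup>+s. indicator {0<..T} s * ennreal (1 / (1 + A T \<omega>)) * indicator S s \<partial>dA \<omega>)"
      using that by (subst emeasure_density) auto
    also have "\<dots> = (\<integral>\<^sup>+s. ennreal (1 / (1 + A T \<omega>)) * indicator (S \<inter> {0<..T}) s \<partial>dA \<omega>)"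
      by (intro nn_integral_cong) (auto simp: indicator_def)
    also have "\<dots> = ennreal (1 / (1 + A T \<omega>)) * emeasure (dA \<omega>) (S \<inter> {0<..T})"
      using that by (intro nn_integral_cmult_indicator) simp
    finally show ?thesis .
  qed
  have emU: "emeasure (?K \<omega>) UNIV = ennreal (A T \<omega> / (1 + A T \<omega>))" if \<omega>: "\<omega> \<in> space P" for \<omega>
    using ems[of UNIV \<omega>] emeasure_dA_Ioc[OF \<omega> order_refl T] A_0[OF \<omega>] A_nonneg[OF \<omega> T]
    by (simp flip: ennreal_mult)
  show ?thesis
  proof (rule measurable_subprob_algebra_generated[where \<Omega> = UNIV and G = "range (\<lambda>(a, b). {a <.. b::real})"])
    show "sets borel = sigma_sets UNIV (range (\<lambda>(a, b). {a<..b::real}))"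
      by (subst borel_sigma_sets_Ioc) (rule sets_measure_of, simp)
    show "Int_stable (range (\<lambda>(a, b). {a<..b::real}))"
      by (auto simp: Int_stable_def)
    show "subprob_space (?K \<omega>)" if \<omega>: "\<omega> \<in> space P" for \<omega>
    proof (rule subprob_spaceI)
      have "A T \<omega> / (1 + A T \<omega>) \<le> 1" using A_nonneg[OF \<omega> T] by (simp add: divide_le_eq)
      then show "emeasure (?K \<omega>) (space (?K \<omega>)) \<le> 1" using emU[OF \<omega>] by (simp add: ennreal_le_1)
    qed simp
    show "(\<lambda>\<omega>. emeasure (?K \<omega>) UNIV) \<in> borel_measurable P"
      using A_meas[OF T] by (subst measurable_cong[OF emU]) auto
    fix S :: "real set" assume "S \<in> range (\<lambda>(a, b). {a <.. b::real})"
    then obtain a b where S: "S = {a<..b}" by auto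
    define a' b' where ab: "a' = max a 0" "b' = max (min b T) 0"
    have "emeasure (?K \<omega>) S = (if a' \<le> b' then ennreal (1 / (1 + A T \<omega>)) * ennreal (A b' \<omega> - A a' \<omega>) else 0)"
      if \<omega>: "\<omega> \<in> space P" for \<omega>
    proof -
      have "S \<inter> {0<..T} = {a'<..b'}" by (auto simp: S ab)
      moreover have "S \<in> sets borel" "0 \<le> a'" by (auto simp: S ab)
      ultimately show ?thesis
        using ems[of S \<omega>] emeasure_dA_Ioc[OF \<omega>, of a' b'] by (cases "a' \<le> b'") auto
    qed
    moreover have "0 \<le> a'" "0 \<le> b'" by (simp_all add: ab)
    note [measurable] = A_meas[OF T] A_meas[OF this(1)] A_meas[OF this(2)]
    have "(\<lambda>\<omega>. if a' \<le> b' then ennreal (1 / (1 + A T \<omega>)) * ennreal (A b' \<omega> - A a' \<omega>) else 0) \<in> borel_measurable P"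
      by measurable
    ultimately show "(\<lambda>\<omega>. emeasure (?K \<omega>) S) \<in> borel_measurable P"
      by (simp only: cong: measurable_cong)
  qed auto
qed

text \<open>Measurability jointly with \<open>u\<close> is required for the later exchange of
  \<open>P\<close> with the measure \<open>-d(1/\<eta>)\<close>. The integral is taken against the
  normalised kernel and multiplied back by \<open>1 + A T\<close>.\<close>

lemma trunc_integral_measurable:
  assumes T: "0 \<le> T" and \<theta>[measurable]: "\<theta> \<in> borel_measurable P" and \<theta>T: "\<And>\<omega>. \<theta> \<omega> \<le> T"
  shows "(\<lambda>(\<omega>, u). trunc_integral u (\<theta> \<omega>) \<omega>) \<in> borel_measurable (P \<Otimes>\<^sub>M borel)"
proof -
  let ?K = "\<lambda>\<omega>. density (dA \<omega>) (\<lambda>s. indicator {0<..T} s * ennreal (1 / (1 + A T \<omega>)))"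
  let ?g = "\<lambda>z s. indicator {0<..\<theta> (fst z)} s * eta_trunc (snd z) (running_sup_left X s (fst z))"
  have K: "(\<lambda>z. ?K (fst z)) \<in> P \<Otimes>\<^sub>M (borel :: real measure) \<rightarrow>\<^sub>M subprob_algebra borel"
    by (rule measurable_compose[OF measurable_fst dA_kernel[OF T]])
  note running_sup_left_measurable[measurable]
  have R: "(\<lambda>(z, s). running_sup_left X s (fst z)) \<in> borel_measurable ((P \<Otimes>\<^sub>M (borel :: real measure)) \<Otimes>\<^sub>M borel)"
    using measurable_compose[OF _ running_sup_left_measurable,
        of "\<lambda>(z, s). (fst z, s)" "(P \<Otimes>\<^sub>M (borel :: real measure)) \<Otimes>\<^sub>M borel"]
    by (simp add: split_beta')
  have "(\<lambda>(z, s). (snd z, running_sup_left X s (fst z)))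
      \<in> (P \<Otimes>\<^sub>M (borel :: real measure)) \<Otimes>\<^sub>M borel \<rightarrow>\<^sub>M borel \<Otimes>\<^sub>M borel"
    using R by (simp add: split_beta')
  from measurable_compose[OF this eta_trunc_measurable]
  have E[measurable]: "(\<lambda>(z, s). eta_trunc (snd z) (running_sup_left X s (fst z)))
      \<in> borel_measurable ((P \<Otimes>\<^sub>M (borel :: real measure)) \<Otimes>\<^sub>M borel)"
    by (simp add: split_beta')
  have "(\<lambda>(z, s). ?g z s) = (\<lambda>(z, s). if 0 < s \<and> s \<le> \<theta> (fst z) then eta_trunc (snd z) (running_sup_left X s (fst z)) else 0)"
    by (auto simp: fun_eq_iff indicator_def)
  moreover have "\<dots> \<in> borel_measurable ((P \<Otimes>\<^sub>M (borel :: real measure)) \<Otimes>\<^sub>M borel)"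
    using E unfolding split_beta' by measurable
  ultimately have g: "(\<lambda>(z, s). ?g z s) \<in> borel_measurable ((P \<Otimes>\<^sub>M (borel :: real measure)) \<Otimes>\<^sub>M borel)"
    by simp
  have [measurable]: "A T \<in> borel_measurable P" by (rule A_meas[OF T])
  have [measurable]: "(\<lambda>z. \<integral>\<^sup>+s. ?g z s \<partial>?K (fst z)) \<in> borel_measurable (P \<Otimes>\<^sub>M borel)"
    by (rule nn_integral_measurable_subprob_algebra2[OF g K])
  have "(\<lambda>z. ennreal (1 + A T (fst z)) * (\<integral>\<^sup>+s. ?g z s \<partial>?K (fst z))) \<in> borel_measurable (P \<Otimes>\<^sub>M borel)"
    by measurable
  moreover have "ennreal (1 + A T \<omega>) * (\<integral>\<^sup>+s. ?g (\<omega>, u) s \<partial>?K \<omega>) = trunc_integral u (\<theta> \<omega>) \<omega>"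
    if \<omega>: "\<omega> \<in> space P" for \<omega> u
  proof -
    have gs: "?g (\<omega>, u) \<in> borel_measurable borel"
      using measurable_compose[OF _ g, of "\<lambda>s. ((\<omega>, u), s)" borel] \<omega> by (simp add: space_pair_measure)
    have "(\<integral>\<^sup>+s. ?g (\<omega>, u) s \<partial>?K \<omega>)
        = (\<integral>\<^sup>+s. indicator {0<..T} s * ennreal (1 / (1 + A T \<omega>)) * ?g (\<omega>, u) s \<partial>dA \<omega>)"
      using gs by (intro nn_integral_density) auto
    also have "\<dots> = (\<integral>\<^sup>+s. ennreal (1 / (1 + A T \<omega>)) * ?g (\<omega>, u) s \<partial>dA \<omega>)"
      using \<theta>T[of \<omega>] by (intro nn_integral_cong) (auto simp: indicator_def)
    also have "\<dots> = ennreal (1 / (1 + A T \<omega>)) * (\<integral>\<^sup>+s. ?g (\<omega>, u) s \<partial>dA \<omega>)"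
      using gs by (intro nn_integral_cmult) simp
    finally have "ennreal (1 + A T \<omega>) * (\<integral>\<^sup>+s. ?g (\<omega>, u) s \<partial>?K \<omega>)
        = (ennreal (1 + A T \<omega>) * ennreal (1 / (1 + A T \<omega>))) * (\<integral>\<^sup>+s. ?g (\<omega>, u) s \<partial>dA \<omega>)"
      by (simp add: mult.assoc)
    also have "ennreal (1 + A T \<omega>) * ennreal (1 / (1 + A T \<omega>)) = 1"
      using A_nonneg[OF \<omega> T] by (subst ennreal_mult[symmetric]) auto
    finally show ?thesis by (simp add: trunc_integral_def)
  qed
  ultimately show ?thesis
    by (subst (asm) measurable_cong[where g = "\<lambda>(\<omega>, u). trunc_integral u (\<theta> \<omega>) \<omega>"])
      (auto simp: space_pair_measure)
qed

section \<open>The inequality truncated at a level\<close>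

text \<open>The exceptional null set is that of the rational times and does not depend on
  \<open>t\<close> or \<open>u\<close>, so random times may be inserted path by path. The positive
  and negative part of \<open>M\<close> stand on different sides (\<open>ennreal\<close> cuts at
  \<open>0\<close>), which avoids any subtraction.\<close>

lemma inequality_before_hitting:
  "AE \<omega> in P. \<forall>t u. 0 \<le> t \<longrightarrow> (\<forall>s. 0 \<le> s \<longrightarrow> s < t \<longrightarrow> X s \<omega> \<le> u) \<longrightarrow>
     ennreal (X t \<omega>) + ennreal (- M t \<omega>) \<le> trunc_integral u t \<omega> + ennreal (H t \<omega>) + ennreal (M t \<omega>)"
proof -
  let ?I = "\<lambda>\<omega>. stieltjes_integral (\<lambda>s. eta_ext \<eta> (running_sup_left X s \<omega>)) (\<lambda>s. A s \<omega>)"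
  have "AE \<omega> in P. \<forall>q\<in>\<rat> \<inter> {0..}. ereal (X q \<omega>) \<le> enn2ereal (?I \<omega> q) + ereal (M q \<omega>) + ereal (H q \<omega>)"
    using cond by (subst AE_ball_countable) (auto simp: condition_A_sup_def intro!: countable_subset[OF _ countable_rat])
  then show ?thesis
  proof (rule AE_mp, intro AE_I2 impI allI)
    fix \<omega> t u
    assume \<omega>: "\<omega> \<in> space P"
      and rat: "\<forall>q\<in>\<rat> \<inter> {0..}. ereal (X q \<omega>) \<le> enn2ereal (?I \<omega> q) + ereal (M q \<omega>) + ereal (H q \<omega>)"
      and t: "0 \<le> t" and before: "\<forall>s. 0 \<le> s \<longrightarrow> s < t \<longrightarrow> X s \<omega> \<le> u"
    have ext: "?I \<omega> t < \<top>" "X t \<omega> \<le> enn2real (?I \<omega> t) + M t \<omega> + H t \<omega>"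
      by (rule inequality_extends[where X = X and \<omega> = \<omega> and \<eta> = \<eta> and a = "\<lambda>s. A s \<omega>" and m = "\<lambda>t. M t \<omega>" and h = "\<lambda>t. H t \<omega>" and u = u];
          use \<omega> t rat before X_nonneg X_rc A_mono_on A_rc M_rc H_rc eta_cont eta_mono eta_nonneg in blast)+
    have "eta_ext \<eta> (running_sup_left X s \<omega>) = eta_trunc u (running_sup_left X s \<omega>)" if "0 < s" "s \<le> t" for s
    proof -
      have "running_sup_left X s \<omega> \<le> ennreal u"
        using that before by (intro running_sup_left_le[of t]) auto
      then show ?thesis by (auto simp: eta_ext_def eta_trunc_def top_unique)
    qed
    then have I: "?I \<omega> t = trunc_integral u t \<omega>"
      unfolding stieltjes_integral_def trunc_integral_def dA_def
      by (intro nn_integral_cong) (auto simp: indicator_def)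
    have "ennreal (X t \<omega>) + ennreal (- M t \<omega>) = ennreal (X t \<omega> + max 0 (- M t \<omega>))"
      using X_nonneg[OF \<omega> t] by (subst ennreal_plus) (auto simp: max_def ennreal_neg)
    also have "\<dots> \<le> ennreal (enn2real (?I \<omega> t) + H t \<omega> + max 0 (M t \<omega>))"
      using ext(2) by (intro ennreal_leI) (auto simp: max_def)
    also have "\<dots> = ?I \<omega> t + ennreal (H t \<omega>) + ennreal (M t \<omega>)"
      using ext(1) H_nonneg[OF \<omega> t] by (auto simp: max_def ennreal_neg)
    finally show "ennreal (X t \<omega>) + ennreal (- M t \<omega>) \<le> trunc_integral u t \<omega> + ennreal (H t \<omega>) + ennreal (M t \<omega>)"
      using I by simp
  qed
qed

lemma trunc_integral_mono: "s \<le> t \<Longrightarrow> trunc_integral u s \<omega> \<le> trunc_integral u t \<omega>"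
  unfolding trunc_integral_def by (intro nn_integral_mono) (auto simp: indicator_def)

lemma truncated_inequality:
  assumes \<theta>: "is_stopping_time F \<theta>" and T: "0 \<le> T"
  shows "(\<integral>\<^sup>+\<omega>. min (ennreal (X (stopped_time \<theta> T \<omega>) \<omega>)) (ennreal u) \<partial>P)
    \<le> (\<integral>\<^sup>+\<omega>. trunc_integral u (stopped_time \<theta> T \<omega>) \<omega> \<partial>P) + (\<integral>\<^sup>+\<omega>. ennreal (H (stopped_time \<theta> T \<omega>) \<omega>) \<partial>P)"
    (is "_ \<le> ?B")
proof -
  define \<zeta> where "\<zeta> \<omega> = min (\<theta> \<omega>) (hitting X u \<omega>)" for \<omega>
  have \<zeta>: "is_stopping_time F \<zeta>"
    unfolding \<zeta>_def[abs_def] by (intro stop_min \<theta> stop_hitting X_adapted X_rc)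
  define S where "S = stopped_time \<zeta> T"
  have S: "0 \<le> S \<omega>" "S \<omega> \<le> stopped_time \<theta> T \<omega>" "ennreal (S \<omega>) \<le> hitting X u \<omega>" for \<omega>
  proof -
    show "0 \<le> S \<omega>" by (simp add: S_def)
    have e: "ennreal (S \<omega>) = min (\<zeta> \<omega>) (ennreal T)" unfolding S_def by (rule ennreal_stopped_time[OF T])
    then show "ennreal (S \<omega>) \<le> hitting X u \<omega>" by (simp add: \<zeta>_def min_le_iff_disj)
    have "ennreal (S \<omega>) \<le> ennreal (stopped_time \<theta> T \<omega>)"
      unfolding e ennreal_stopped_time[OF T] by (simp add: \<zeta>_def min_le_iff_disj)
    then show "S \<omega> \<le> stopped_time \<theta> T \<omega>" by simp
  qed
  have S_meas[measurable]: "S \<in> borel_measurable P" unfolding S_def by (rule stopped_time_measurable[OF \<zeta>])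
  have \<theta>_meas: "stopped_time \<theta> T \<in> borel_measurable P" by (rule stopped_time_measurable[OF \<theta>])
  obtain \<tau> :: "nat \<Rightarrow> 'a \<Rightarrow> ennreal" where \<tau>: "\<And>n. is_stopping_time F (\<tau> n)"
    "AE \<omega> in P. incseq (\<lambda>n. \<tau> n \<omega>) \<and> (\<lambda>n. \<tau> n \<omega>) \<longlonglongrightarrow> \<top>"
    "\<And>n. martingale P F (\<lambda>t \<omega>. M (stopped_time (\<tau> n) t \<omega>) \<omega> - M 0 \<omega>)"
    using M_loc unfolding cadlag_local_martingale_def by blast
  \<comment> \<open>The stopping time cut by the localising sequence: \<open>M\<close> at
    \<open>v n\<close> has expectation \<open>0\<close>, and almost surely \<open>v n\<close> equals
    \<open>S\<close> for large \<open>n\<close>.\<close>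
  define v where "v n \<omega> = stopped_time (\<tau> n) (S \<omega>) \<omega>" for n \<omega>
  have v: "0 \<le> v n \<omega>" "v n \<omega> \<le> S \<omega>" for n \<omega>
    unfolding v_def using S(1) by (auto intro: stopped_time_le)
  have v_meas: "v n \<in> borel_measurable P" for n
    using stop_measurable[OF \<tau>(1)] unfolding v_def[abs_def] stopped_time_def by measurable
  have Xv_meas: "(\<lambda>\<omega>. X (v n \<omega>) \<omega>) \<in> borel_measurable P" for n
    by (rule measurable_right_continuous_at[OF X_meas X_rc v_meas v(1)])
  have J_meas: "(\<lambda>\<omega>. trunc_integral u (stopped_time \<theta> T \<omega>) \<omega>) \<in> borel_measurable P"
    using measurable_compose[OF _ trunc_integral_measurable[OF T \<theta>_meas stopped_time_le[OF T]],
        of "\<lambda>\<omega>. (\<omega>, u)" P] by simp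
  have H_meas': "(\<lambda>\<omega>. H (stopped_time \<theta> T \<omega>) \<omega>) \<in> borel_measurable P"
    by (rule measurable_right_continuous_at[OF H_meas H_rc \<theta>_meas]) auto
  have bound: "(\<integral>\<^sup>+\<omega>. ennreal (X (v n \<omega>) \<omega>) \<partial>P) \<le> ?B" for n
  proof -
    have rcN: "right_continuous (\<lambda>t. M (stopped_time (\<tau> n) t \<omega>) \<omega> - M 0 \<omega>)" if "\<omega> \<in> space P" for \<omega>
      using right_continuous_stopped[OF M_rc[OF that], of "\<tau> n" \<omega>] M_0[OF that] by simp
    note os = optional_stopping[OF \<tau>(3)[of n] \<zeta> T rcN, folded S_def]
    have s0: "stopped_time (\<tau> n) 0 \<omega> = 0" for \<omega> by (simp add: stopped_time_def)
    have int: "integrable P (\<lambda>\<omega>. M (v n \<omega>) \<omega>)"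
      using os(1) by (rule Bochner_Integration.integrable_cong[THEN iffD1, rotated 2]) (auto simp: v_def M_0)
    have "(\<integral>\<omega>. M (v n \<omega>) \<omega> \<partial>P) = (\<integral>\<omega>. M (stopped_time (\<tau> n) (S \<omega>) \<omega>) \<omega> - M 0 \<omega> \<partial>P)"
      by (intro Bochner_Integration.integral_cong) (auto simp: v_def M_0)
    also have "\<dots> = 0" using os(2) by (simp add: s0)
    finally have zero: "(\<integral>\<omega>. M (v n \<omega>) \<omega> \<partial>P) = 0" .
    \<comment> \<open>The integrals of the positive and negative part of \<open>M\<close> at
      \<open>v n\<close>. Both are finite and, the mean being \<open>0\<close>, equal, so they
      cancel from the two sides of an \<open>ennreal\<close> inequality.\<close>
    let ?p = "\<integral>\<^sup>+\<omega>. ennreal (M (v n \<omega>) \<omega>) \<partial>P" and ?m = "\<integral>\<^sup>+\<omega>. ennreal (- M (v n \<omega>) \<omega>) \<partial>P"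
    have fin: "?p < \<top>" "?m < \<top>"
      using integrableD(2,3)[OF int] by (auto simp: less_top)
    have "enn2real ?p = enn2real ?m" using real_lebesgue_integral_def[OF int] zero by simp
    then have pm: "?p = ?m" using fin by (metis ennreal_enn2real)
    have Mv: "(\<lambda>\<omega>. M (v n \<omega>) \<omega>) \<in> borel_measurable P" using int by (rule borel_measurable_integrable)
    have "(\<integral>\<^sup>+\<omega>. ennreal (X (v n \<omega>) \<omega>) \<partial>P) + ?m
       = (\<integral>\<^sup>+\<omega>. ennreal (X (v n \<omega>) \<omega>) + ennreal (- M (v n \<omega>) \<omega>) \<partial>P)"
      using Xv_meas Mv by (intro nn_integral_add[symmetric]) auto
    also have "\<dots> \<le> (\<integral>\<^sup>+\<omega>. trunc_integral u (stopped_time \<theta> T \<omega>) \<omega> + ennreal (H (stopped_time \<theta> T \<omega>) \<omega>)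
         + ennreal (M (v n \<omega>) \<omega>) \<partial>P)"
    proof (rule nn_integral_mono_AE, rule AE_mp[OF inequality_before_hitting], intro AE_I2 impI)
      fix \<omega> assume \<omega>: "\<omega> \<in> space P"
        and ineq: "\<forall>t u. 0 \<le> t \<longrightarrow> (\<forall>s. 0 \<le> s \<longrightarrow> s < t \<longrightarrow> X s \<omega> \<le> u) \<longrightarrow>
          ennreal (X t \<omega>) + ennreal (- M t \<omega>) \<le> trunc_integral u t \<omega> + ennreal (H t \<omega>) + ennreal (M t \<omega>)"
      have "X s \<omega> \<le> u" if s: "0 \<le> s" "s < v n \<omega>" for s
      proof (rule le_before_hitting[where X = X and \<omega> = \<omega>, OF s(1)])
        have "s < S \<omega>" using s v(2)[of n \<omega>] by simp
        then have "ennreal s < ennreal (S \<omega>)" using s(1) by (simp add: ennreal_less_iff)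
        then show "ennreal s < hitting X u \<omega>" using S(3) less_le_trans by blast
      qed
      then have "ennreal (X (v n \<omega>) \<omega>) + ennreal (- M (v n \<omega>) \<omega>)
          \<le> trunc_integral u (v n \<omega>) \<omega> + ennreal (H (v n \<omega>) \<omega>) + ennreal (M (v n \<omega>) \<omega>)"
        using ineq v(1) by blast
      \<comment> \<open>The right side is enlarged to a bound that depends neither on
        \<open>n\<close> nor on the passage; the truncation in \<open>u\<close> keeps this
        harmless.\<close>
      also have "\<dots> \<le> trunc_integral u (stopped_time \<theta> T \<omega>) \<omega> + ennreal (H (stopped_time \<theta> T \<omega>) \<omega>)
         + ennreal (M (v n \<omega>) \<omega>)"
        using v[of n \<omega>] S(2)[of \<omega>]
        by (intro add_mono order_refl trunc_integral_mono ennreal_leI H_mono[OF \<omega>]) auto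
      finally show "ennreal (X (v n \<omega>) \<omega>) + ennreal (- M (v n \<omega>) \<omega>)
        \<le> trunc_integral u (stopped_time \<theta> T \<omega>) \<omega> + ennreal (H (stopped_time \<theta> T \<omega>) \<omega>) + ennreal (M (v n \<omega>) \<omega>)" .
    qed
    also have "\<dots> = ?B + ?m"
      using J_meas H_meas' Mv pm by (simp add: nn_integral_add)
    finally show ?thesis using fin(2) by (auto simp: ennreal_add_left_cancel_le add.commute[of _ ?m])
  qed
  have "(\<integral>\<^sup>+\<omega>. min (ennreal (X (stopped_time \<theta> T \<omega>) \<omega>)) (ennreal u) \<partial>P)
     \<le> (\<integral>\<^sup>+\<omega>. liminf (\<lambda>n. ennreal (X (v n \<omega>) \<omega>)) \<partial>P)"
  proof (rule nn_integral_mono_AE, rule AE_mp[OF \<tau>(2)], intro AE_I2 impI)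
    fix \<omega> assume \<omega>: "\<omega> \<in> space P" and lim: "incseq (\<lambda>n. \<tau> n \<omega>) \<and> (\<lambda>n. \<tau> n \<omega>) \<longlonglongrightarrow> \<top>"
    have "\<forall>\<^sub>F n in sequentially. ennreal (S \<omega>) < \<tau> n \<omega>"
      using lim by (intro order_tendstoD(1)) auto
    then have "\<forall>\<^sub>F n in sequentially. ennreal (X (v n \<omega>) \<omega>) = ennreal (X (S \<omega>) \<omega>)"
      by eventually_elim (simp add: v_def stopped_time_eq S(1))
    then have "liminf (\<lambda>n. ennreal (X (v n \<omega>) \<omega>)) = ennreal (X (S \<omega>) \<omega>)"
      by (intro lim_imp_Liminf tendsto_eventually) auto
    \<comment> \<open>Either the passage does not come first and \<open>S\<close> is the original
      time, or it does and \<open>X\<close> is at least \<open>u\<close> there by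
      right-continuity.\<close>
    moreover have "min (ennreal (X (stopped_time \<theta> T \<omega>) \<omega>)) (ennreal u) \<le> ennreal (X (S \<omega>) \<omega>)"
    proof (cases "S \<omega> = stopped_time \<theta> T \<omega>")
      case False
      have "ennreal (S \<omega>) = min (min (\<theta> \<omega>) (ennreal T)) (hitting X u \<omega>)"
        unfolding S_def ennreal_stopped_time[OF T] by (simp add: \<zeta>_def ac_simps)
      then have "ennreal (S \<omega>) = min (ennreal (stopped_time \<theta> T \<omega>)) (hitting X u \<omega>)"
        by (simp add: ennreal_stopped_time[OF T])
      then have "hitting X u \<omega> = ennreal (S \<omega>)" using False S(1)[of \<omega>] by (auto simp: min_def split: if_splits)
      then have "u \<le> X (S \<omega>) \<omega>" by (rule ge_at_hitting[where X = X, OF X_rc[OF \<omega>] S(1)])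
      then show ?thesis by (auto intro: min.coboundedI2 ennreal_leI)
    qed simp
    ultimately show "min (ennreal (X (stopped_time \<theta> T \<omega>) \<omega>)) (ennreal u) \<le> liminf (\<lambda>n. ennreal (X (v n \<omega>) \<omega>))"
      by simp
  qed
  also have "\<dots> \<le> liminf (\<lambda>n. \<integral>\<^sup>+\<omega>. ennreal (X (v n \<omega>) \<omega>) \<partial>P)"
    using Xv_meas by (intro nn_integral_liminf) auto
  also have "\<dots> \<le> liminf (\<lambda>n. ?B)"
    by (intro Liminf_mono always_eventually allI bound)
  finally show ?thesis by (simp add: Liminf_const)
qed

end

section \<open>The key inequality\<close>

text \<open>The \<open>\<Gamma>\<close> of the overview, with extended argument because
  \<open>E[H]\<close> may be infinite.\<close>

definition recip_integral :: "(real \<Rightarrow> real) \<Rightarrow> ennreal \<Rightarrow> ennreal" where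
  "recip_integral \<eta> z = (\<integral>\<^sup>+v\<in>{v. 0 < v \<and> ennreal v < z}. ennreal (1 / \<eta> v) \<partial>lborel)"

text \<open>Positivity at \<open>0\<close> included: then \<open>1 / \<eta>\<close> is bounded, and
  the measure whose tail it is has the finite total mass \<open>1 / \<eta> 0\<close>.\<close>

locale growth_function =
  fixes \<eta> :: "real \<Rightarrow> real"
  assumes cont: "continuous_on {0..} \<eta>"
    and mono: "mono_on {0..} \<eta>"
    and pos: "0 \<le> x \<Longrightarrow> 0 < \<eta> x"
    and unbounded: "filterlim \<eta> at_top at_top"
begin

text \<open>The measure \<open>-d(1/\<eta>)\<close>.\<close>

definition decay :: "real measure" where
  "decay = interval_measure (\<lambda>x. - (1 / \<eta> (max 0 x)))"

lemma sets_decay [measurable_cong, simp]: "sets decay = sets borel"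
  by (simp add: decay_def)

lemma space_decay [simp]: "space decay = UNIV"
  by (simp add: decay_def)

lemma decay_mono: "x \<le> y \<Longrightarrow> - (1 / \<eta> (max 0 x)) \<le> - (1 / \<eta> (max 0 y))"
  using mono pos[of "max 0 x"] by (auto simp: mono_on_def intro!: divide_left_mono mult_pos_pos pos)

lemma decay_cont: "continuous_on UNIV (\<lambda>x. - (1 / \<eta> (max 0 x)))"
proof -
  have "continuous_on UNIV (\<lambda>x. \<eta> (max 0 x))"
    by (rule continuous_on_compose2[OF cont]) (auto intro!: continuous_intros)
  moreover have "\<eta> (max 0 x) \<noteq> 0" for x using pos[of "max 0 x"] by simp
  ultimately show ?thesis by (intro continuous_intros) auto
qed

lemma decay_right_cont: "continuous (at_right a) (\<lambda>x. - (1 / \<eta> (max 0 x)))"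
  using decay_cont by (meson continuous_at_imp_continuous_within continuous_on_eq_continuous_at open_UNIV UNIV_I)

lemma sigma_finite_decay: "sigma_finite_measure decay"
  unfolding decay_def by (intro sigma_finite_interval_measure decay_mono decay_right_cont)

text \<open>Unboundedness of \<open>\<eta>\<close> enters here: \<open>1 / \<eta>\<close> vanishes
  at infinity, so the increments up to \<open>w + n\<close> exhaust it.\<close>

lemma decay_tail:
  assumes S: "\<And>n. S n \<in> sets borel" "incseq S"
    and e: "\<And>n::nat. emeasure decay (S n) = ennreal (1 / \<eta> v - 1 / \<eta> (max 0 (w + real n)))"
  shows "emeasure decay (\<Union>n. S n) = ennreal (1 / \<eta> v)"
proof -
  have "(\<lambda>n. emeasure decay (S n)) \<longlonglongrightarrow> emeasure decay (\<Union>n. S n)"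
    using S by (intro Lim_emeasure_incseq) auto
  moreover have "(\<lambda>n. emeasure decay (S n)) \<longlonglongrightarrow> ennreal (1 / \<eta> v - 0)"
    unfolding e
  proof (intro tendsto_ennrealI tendsto_diff tendsto_const)
    have "filterlim (\<lambda>n. w + real n) at_top sequentially"
      by (intro filterlim_tendsto_add_at_top[OF tendsto_const] filterlim_real_sequentially)
    then have "filterlim (\<lambda>n. max 0 (w + real n)) at_top sequentially"
      by (rule filterlim_at_top_mono) simp
    from filterlim_compose[OF unbounded this]
    show "(\<lambda>n. 1 / \<eta> (max 0 (w + real n))) \<longlonglongrightarrow> 0"
      by (intro tendsto_divide_0[OF tendsto_const] filterlim_at_top_imp_at_infinity)
  qed
  ultimately show ?thesis using LIMSEQ_unique by fastforce
qed

lemma emeasure_decay_greaterThan: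
  assumes "0 \<le> v" shows "emeasure decay {v<..} = ennreal (1 / \<eta> v)"
proof -
  have eq: "{v<..} = (\<Union>n. {v<..v + real n})"
  proof (intro equalityI subsetI)
    fix x assume "x \<in> {v<..}"
    moreover obtain n where "x - v \<le> real n" using real_arch_simple by blast
    ultimately show "x \<in> (\<Union>n. {v<..v + real n})" by (intro UN_I[of n]) auto
  qed auto
  show ?thesis unfolding eq
  proof (rule decay_tail)
    show "emeasure decay {v<..v + real n} = ennreal (1 / \<eta> v - 1 / \<eta> (max 0 (v + real n)))" for n
      unfolding decay_def using assms
      by (subst emeasure_interval_measure_Ioc[OF _ decay_mono decay_right_cont]) auto
  qed (auto simp: incseq_def)
qed

text \<open>By continuity of \<open>\<eta>\<close> there are no atoms, so the closed half-line
  weighs as much as the open one.\<close>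

lemma emeasure_decay_atLeast:
  assumes "0 \<le> v" shows "emeasure decay {v..} = ennreal (1 / \<eta> v)"
proof -
  have eq: "{v..} = (\<Union>n. {v..v + real n})"
  proof (intro equalityI subsetI)
    fix x assume "x \<in> {v..}"
    moreover obtain n where "x - v \<le> real n" using real_arch_simple by blast
    ultimately show "x \<in> (\<Union>n. {v..v + real n})" by (intro UN_I[of n]) auto
  qed auto
  show ?thesis unfolding eq
  proof (rule decay_tail)
    show "emeasure decay {v..v + real n} = ennreal (1 / \<eta> v - 1 / \<eta> (max 0 (v + real n)))" for n
      unfolding decay_def using assms
      by (subst emeasure_interval_measure_Icc[OF _ decay_mono decay_cont]) auto
  qed (auto simp: incseq_def)
qed

lemma emeasure_decay_UNIV: "emeasure decay UNIV = ennreal (1 / \<eta> 0)"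
proof -
  have eq: "UNIV = (\<Union>n. {- real n..real n})"
  proof (intro equalityI subsetI)
    fix x :: real
    obtain n where "\<bar>x\<bar> \<le> real n" using real_arch_simple by blast
    then show "x \<in> (\<Union>n. {- real n..real n})" by (intro UN_I[of n]) auto
  qed auto
  show ?thesis unfolding eq
  proof (rule decay_tail[where w = 0])
    show "emeasure decay {- real n..real n} = ennreal (1 / \<eta> 0 - 1 / \<eta> (max 0 (0 + real n)))" for n
      unfolding decay_def
      by (subst emeasure_interval_measure_Icc[OF _ decay_mono decay_cont]) auto
  qed (auto simp: incseq_def)
qed

lemma emeasure_decay_ge:
  assumes "r \<noteq> \<top>" shows "emeasure decay {u. r \<le> ennreal u} \<le> ennreal (1 / \<eta> (enn2real r))"
proof (cases "r = 0")
  case True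
  \<comment> \<open>\<open>ennreal u\<close> is \<open>0\<close> for negative \<open>u\<close>, so
    the set is the whole line; the constant continuation of \<open>\<eta>\<close> puts no mass on
    the negative half.\<close>
  then show ?thesis by (simp add: emeasure_decay_UNIV)
next
  case False
  with assms have r: "0 < enn2real r" "r = ennreal (enn2real r)"
    by (auto simp: enn2real_positive_iff less_top zero_less_iff_neq_zero)
  have "{u. r \<le> ennreal u} = {enn2real r..}"
    by (subst r(2)) (use r(1) in \<open>auto simp: ennreal_le_iff2\<close>)
  then show ?thesis using emeasure_decay_atLeast[of "enn2real r"] r(1) by simp
qed

lemma emeasure_lborel_truncated:
  "emeasure lborel {v. 0 < v \<and> ennreal v < z \<and> v < u} = min z (ennreal u)"
proof (cases "0 < u")
  case True
  show ?thesis
  proof (cases z)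
    case (real x)
    then have "{v. 0 < v \<and> ennreal v < z \<and> v < u} = {0<..<min x u}"
      by (auto simp: ennreal_less_iff)
    then have "emeasure lborel {v. 0 < v \<and> ennreal v < z \<and> v < u} = ennreal (min x u)"
      using real True by simp
    then show ?thesis using real True by (simp add: min_def)
  next
    case top
    then have "{v. 0 < v \<and> ennreal v < z \<and> v < u} = {0<..<u}" by auto
    then show ?thesis using top True by (simp add: min_absorb2)
  qed
next
  case False
  then have e: "{v. 0 < v \<and> ennreal v < z \<and> v < u} = {}" by auto
  show ?thesis unfolding e using False by (simp add: ennreal_neg)
qed

text \<open>Tonelli on \<open>{(v, u). 0 < v < min z u}\<close>: the section in \<open>u\<close> has
  mass \<open>1 / \<eta> v\<close> by the tail formula, the section in \<open>v\<close> has length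
  \<open>min z u\<close>.\<close>

lemma recip_integral_layer: "recip_integral \<eta> z = (\<integral>\<^sup>+u. min z (ennreal u) \<partial>decay)"
proof -
  interpret D: sigma_finite_measure decay by (rule sigma_finite_decay)
  interpret pair_sigma_finite lborel decay ..
  have S[measurable]: "{p. 0 < fst p \<and> ennreal (fst p) < z \<and> fst p < snd p} \<in> sets (lborel \<Otimes>\<^sub>M decay)"
  proof -
    have "{p \<in> space (lborel \<Otimes>\<^sub>M decay). 0 < fst p \<and> ennreal (fst p) < z \<and> fst p < snd p} \<in> sets (lborel \<Otimes>\<^sub>M decay)"
      by measurable
    then show ?thesis by (simp add: space_pair_measure)
  qed
  let ?i = "\<lambda>v u. indicator {p. 0 < fst p \<and> ennreal (fst p) < z \<and> fst p < snd p} (v, u) :: ennreal"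
  have "recip_integral \<eta> z = (\<integral>\<^sup>+v. (\<integral>\<^sup>+u. ?i v u \<partial>decay) \<partial>lborel)"
    unfolding recip_integral_def
  proof (intro nn_integral_cong)
    fix v :: real
    have "(\<integral>\<^sup>+u. ?i v u \<partial>decay) = (\<integral>\<^sup>+u. indicator {v. 0 < v \<and> ennreal v < z} v * indicator {v<..} u \<partial>decay)"
      by (intro nn_integral_cong) (auto simp: indicator_def)
    also have "\<dots> = ennreal (1 / \<eta> v) * indicator {v. 0 < v \<and> ennreal v < z} v"
      by (simp add: nn_integral_cmult_indicator) (auto simp: indicator_def emeasure_decay_greaterThan)
    finally show "ennreal (1 / \<eta> v) * indicator {v. 0 < v \<and> ennreal v < z} v = (\<integral>\<^sup>+u. ?i v u \<partial>decay)" ..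
  qed
  also have "\<dots> = (\<integral>\<^sup>+u. (\<integral>\<^sup>+v. ?i v u \<partial>lborel) \<partial>decay)"
    by (rule Fubini'[symmetric]) simp
  also have "\<dots> = (\<integral>\<^sup>+u. min z (ennreal u) \<partial>decay)"
  proof (intro nn_integral_cong)
    fix u :: real
    have "(\<integral>\<^sup>+v. ?i v u \<partial>lborel) = (\<integral>\<^sup>+v. indicator {v. 0 < v \<and> ennreal v < z \<and> v < u} v \<partial>lborel)"
      by (intro nn_integral_cong) (auto simp: indicator_def)
    then show "(\<integral>\<^sup>+v. ?i v u \<partial>lborel) = min z (ennreal u)"
      by (simp add: emeasure_lborel_truncated)
  qed
  finally show ?thesis .
qed

end

context A_sup
begin

text \<open>For fixed \<open>s\<close>, with \<open>r\<close> the running supremum before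
  \<open>s\<close>, the integral over \<open>u\<close> is at most
  \<open>\<eta> r / \<eta>' r\<close>, hence at most \<open>1\<close>: raising \<open>\<eta>\<close>
  to \<open>\<eta>'\<close> only helps. If \<open>r\<close> is infinite, the truncated integrand is
  \<open>0\<close>.\<close>

lemma trunc_integral_decay:
  assumes \<eta>': "growth_function \<eta>'" and le: "\<And>x. 0 \<le> x \<Longrightarrow> \<eta> x \<le> \<eta>' x"
    and \<omega>: "\<omega> \<in> space P" and t: "0 \<le> t"
  shows "(\<integral>\<^sup>+u. trunc_integral u t \<omega> \<partial>growth_function.decay \<eta>') \<le> ennreal (A t \<omega>)"
proof -
  interpret G: growth_function \<eta>' by fact
  interpret D: sigma_finite_measure G.decay by (rule G.sigma_finite_decay)
  interpret dA: sigma_finite_measure "dA \<omega>" by (rule sigma_finite_dA[OF \<omega>])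
  interpret pair_sigma_finite G.decay "dA \<omega>" ..
  have R[measurable]: "(\<lambda>s. running_sup_left X s \<omega>) \<in> borel_measurable borel"
    by (rule running_sup_left_measurable_path)
  have "(\<lambda>(u, s). (u, running_sup_left X s \<omega>)) \<in> borel \<Otimes>\<^sub>M borel \<rightarrow>\<^sub>M (borel :: real measure) \<Otimes>\<^sub>M borel"
    by measurable
  from measurable_compose[OF this eta_trunc_measurable]
  have [measurable]: "(\<lambda>p. eta_trunc (fst p) (running_sup_left X (snd p) \<omega>)) \<in> borel_measurable (borel \<Otimes>\<^sub>M borel)"
    by (simp add: split_beta')
  have "(\<lambda>p. indicator {0<..t} (snd p) * eta_trunc (fst p) (running_sup_left X (snd p) \<omega>))
      \<in> borel_measurable (borel \<Otimes>\<^sub>M borel)" by measurable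
  then have m: "case_prod (\<lambda>u s. indicator {0<..t} s * eta_trunc u (running_sup_left X s \<omega>))
      \<in> borel_measurable (G.decay \<Otimes>\<^sub>M dA \<omega>)"
    by (simp add: split_beta' cong: measurable_cong_sets sets_pair_measure_cong)
  have "(\<integral>\<^sup>+u. trunc_integral u t \<omega> \<partial>G.decay)
      = (\<integral>\<^sup>+s. \<integral>\<^sup>+u. indicator {0<..t} s * eta_trunc u (running_sup_left X s \<omega>) \<partial>G.decay \<partial>dA \<omega>)"
    unfolding trunc_integral_def by (rule Fubini'[OF m, symmetric])
  also have "\<dots> \<le> (\<integral>\<^sup>+s. indicator {0<..t} s \<partial>dA \<omega>)"
  proof (intro nn_integral_mono)
    fix s
    let ?r = "running_sup_left X s \<omega>"
    have "(\<integral>\<^sup>+u. eta_trunc u ?r \<partial>G.decay) \<le> 1"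
    proof (cases "?r = \<top>")
      case True
      then show ?thesis by (simp add: eta_trunc_def top_unique)
    next
      case False
      have [measurable]: "{u. ?r \<le> ennreal u} \<in> sets borel"
      proof -
        have "{u \<in> space borel. ?r \<le> ennreal u} \<in> sets borel" by measurable
        then show ?thesis by simp
      qed
      have "(\<integral>\<^sup>+u. eta_trunc u ?r \<partial>G.decay)
         = (\<integral>\<^sup>+u. ennreal (\<eta> (enn2real ?r)) * indicator {u. ?r \<le> ennreal u} u \<partial>G.decay)"
        by (intro nn_integral_cong) (auto simp: eta_trunc_def)
      also have "\<dots> = ennreal (\<eta> (enn2real ?r)) * emeasure G.decay {u. ?r \<le> ennreal u}"
        by (intro nn_integral_cmult_indicator) simp
      also have "\<dots> \<le> ennreal (\<eta> (enn2real ?r)) * ennreal (1 / \<eta>' (enn2real ?r))"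
        by (intro mult_left_mono G.emeasure_decay_ge False) simp
      also have "\<dots> = ennreal (\<eta> (enn2real ?r) / \<eta>' (enn2real ?r))"
        using eta_nonneg[of "enn2real ?r"] G.pos[of "enn2real ?r"] by (simp flip: ennreal_mult)
      also have "\<dots> \<le> 1"
        using le[of "enn2real ?r"] G.pos[of "enn2real ?r"] by (simp add: ennreal_le_1 divide_le_eq_1)
      finally show ?thesis .
    qed
    then show "(\<integral>\<^sup>+u. indicator {0<..t} s * eta_trunc u ?r \<partial>G.decay) \<le> indicator {0<..t} s"
      by (auto simp: indicator_def)
  qed
  also have "\<dots> = ennreal (A t \<omega>)"
    using emeasure_dA_Ioc[OF \<omega> order_refl t] A_0[OF \<omega>] by simp
  finally show ?thesis .
qed

text \<open>Integrating the truncated inequality against \<open>-d(1/\<eta>')\<close> turns the truncations of \<open>X\<close> and \<open>H\<close> into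
  the primitive of \<open>1/\<eta>'\<close> and cancels the integrand \<open>\<eta>\<close>, so that only \<open>A\<close> is left.\<close>

lemma key_inequality:
  assumes \<eta>': "growth_function \<eta>'" and le: "\<And>x. 0 \<le> x \<Longrightarrow> \<eta> x \<le> \<eta>' x"
    and \<theta>: "is_stopping_time F \<theta>" and T: "0 \<le> T"
  shows "(\<integral>\<^sup>+\<omega>. recip_integral \<eta>' (ennreal (X (stopped_time \<theta> T \<omega>) \<omega>)) \<partial>P)
    \<le> (\<integral>\<^sup>+\<omega>. ennreal (A (stopped_time \<theta> T \<omega>) \<omega>) \<partial>P)
      + recip_integral \<eta>' (\<integral>\<^sup>+\<omega>. ennreal (H (stopped_time \<theta> T \<omega>) \<omega>) \<partial>P)"
    (is "_ \<le> _ + recip_integral \<eta>' ?h")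
proof -
  interpret G: growth_function \<eta>' by fact
  interpret D: sigma_finite_measure G.decay by (rule G.sigma_finite_decay)
  interpret PD: pair_sigma_finite P G.decay ..
  have \<theta>_meas: "stopped_time \<theta> T \<in> borel_measurable P" by (rule stopped_time_measurable[OF \<theta>])
  have X_meas'[measurable]: "(\<lambda>\<omega>. X (stopped_time \<theta> T \<omega>) \<omega>) \<in> borel_measurable P"
    by (rule measurable_right_continuous_at[OF X_meas X_rc \<theta>_meas]) auto
  have J: "(\<lambda>p. trunc_integral (snd p) (stopped_time \<theta> T (fst p)) (fst p)) \<in> borel_measurable (P \<Otimes>\<^sub>M borel)"
    using trunc_integral_measurable[OF T \<theta>_meas stopped_time_le[OF T]] by (simp add: split_beta')
  then have J': "case_prod (\<lambda>\<omega> u. trunc_integral u (stopped_time \<theta> T \<omega>) \<omega>) \<in> borel_measurable (P \<Otimes>\<^sub>M G.decay)"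
    by (simp add: split_beta' cong: measurable_cong_sets sets_pair_measure_cong)
  have Ju: "(\<lambda>u. \<integral>\<^sup>+\<omega>. trunc_integral u (stopped_time \<theta> T \<omega>) \<omega> \<partial>P) \<in> borel_measurable G.decay"
  proof (rule borel_measurable_nn_integral)
    show "case_prod (\<lambda>u \<omega>. trunc_integral u (stopped_time \<theta> T \<omega>) \<omega>) \<in> borel_measurable (G.decay \<Otimes>\<^sub>M P)"
      using measurable_pair_swap[OF J'] by (simp add: split_beta')
  qed
  have m: "case_prod (\<lambda>\<omega> u. min (ennreal (X (stopped_time \<theta> T \<omega>) \<omega>)) (ennreal u)) \<in> borel_measurable (P \<Otimes>\<^sub>M G.decay)"
    by measurable
  have "(\<integral>\<^sup>+\<omega>. recip_integral \<eta>' (ennreal (X (stopped_time \<theta> T \<omega>) \<omega>)) \<partial>P)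
     = (\<integral>\<^sup>+\<omega>. \<integral>\<^sup>+u. min (ennreal (X (stopped_time \<theta> T \<omega>) \<omega>)) (ennreal u) \<partial>G.decay \<partial>P)"
    by (simp add: G.recip_integral_layer)
  also have "\<dots> = (\<integral>\<^sup>+u. \<integral>\<^sup>+\<omega>. min (ennreal (X (stopped_time \<theta> T \<omega>) \<omega>)) (ennreal u) \<partial>P \<partial>G.decay)"
    by (rule PD.Fubini'[OF m, symmetric])
  also have "\<dots> \<le> (\<integral>\<^sup>+u. min ?h (ennreal u) + (\<integral>\<^sup>+\<omega>. trunc_integral u (stopped_time \<theta> T \<omega>) \<omega> \<partial>P) \<partial>G.decay)"
  proof (intro nn_integral_mono)
    fix u
    let ?l = "\<integral>\<^sup>+\<omega>. min (ennreal (X (stopped_time \<theta> T \<omega>) \<omega>)) (ennreal u) \<partial>P"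
    let ?j = "\<integral>\<^sup>+\<omega>. trunc_integral u (stopped_time \<theta> T \<omega>) \<omega> \<partial>P"
    \<comment> \<open>The trivial bound \<open>u\<close> is what truncates the
      \<open>H\<close>-term: together with \<open>?l \<le> ?j + ?h\<close> it gives the bound with
      \<open>min ?h u\<close>, whose integral over \<open>u\<close> is \<open>\<Gamma>\<close> of
      \<open>?h\<close>.\<close>
    have "?l \<le> (\<integral>\<^sup>+\<omega>. ennreal u \<partial>P)" by (intro nn_integral_mono) simp
    then have "?l \<le> ennreal u" by (simp add: emeasure_space_1)
    moreover have "?l \<le> ?j + ?h" by (rule truncated_inequality[OF \<theta> T])
    ultimately show "?l \<le> min ?h (ennreal u) + ?j"
      by (cases "?h \<le> ennreal u") (auto simp: min_def add.commute intro: order_trans add_increasing2)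
  qed
  also have "\<dots> = recip_integral \<eta>' ?h + (\<integral>\<^sup>+u. \<integral>\<^sup>+\<omega>. trunc_integral u (stopped_time \<theta> T \<omega>) \<omega> \<partial>P \<partial>G.decay)"
    unfolding G.recip_integral_layer using Ju by (intro nn_integral_add) auto
  also have "(\<integral>\<^sup>+u. \<integral>\<^sup>+\<omega>. trunc_integral u (stopped_time \<theta> T \<omega>) \<omega> \<partial>P \<partial>G.decay)
     = (\<integral>\<^sup>+\<omega>. \<integral>\<^sup>+u. trunc_integral u (stopped_time \<theta> T \<omega>) \<omega> \<partial>G.decay \<partial>P)"
    by (rule PD.Fubini'[OF J'])
  also have "\<dots> \<le> (\<integral>\<^sup>+\<omega>. ennreal (A (stopped_time \<theta> T \<omega>) \<omega>) \<partial>P)"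
    by (intro nn_integral_mono trunc_integral_decay[OF \<eta>' le]) auto
  finally show ?thesis by (simp add: add.commute add_left_mono)
qed

end

section \<open>\<open>G\<close> through its positive and negative part\<close>

text \<open>The positive part of \<open>G\<close>, as \<open>lower_integral\<close> below is the
  negative part. Keeping them apart in \<open>ennreal\<close> postpones every difference, and with
  it \<open>\<infinity> - \<infinity>\<close>, to the end.\<close>

definition upper_integral :: "(real \<Rightarrow> real) \<Rightarrow> real \<Rightarrow> ennreal \<Rightarrow> ennreal" where
  "upper_integral \<eta> c z = (\<integral>\<^sup>+v\<in>{v. c < v \<and> ennreal v < z}. ennreal (1 / \<eta> v) \<partial>lborel)"

definition lower_integral :: "(real \<Rightarrow> real) \<Rightarrow> real \<Rightarrow> real \<Rightarrow> ennreal" where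
  "lower_integral \<eta> c x = (\<integral>\<^sup>+v\<in>{x<..<c}. ennreal (1 / \<eta> v) \<partial>lborel)"

lemma G_eq:
  assumes "0 \<le> x" "0 < c"
  shows "G \<eta> c x = (if c \<le> x then enn2ereal (upper_integral \<eta> c (ennreal x)) else - enn2ereal (lower_integral \<eta> c x))"
proof -
  have "{c<..<x} = {v. c < v \<and> ennreal v < ennreal x}" using assms by (auto simp: ennreal_less_iff)
  then show ?thesis by (simp add: G_def upper_integral_def lower_integral_def)
qed

lemma e2ennreal_G:
  assumes "0 \<le> x" "0 < c"
  shows "e2ennreal (G \<eta> c x) = (if c \<le> x then upper_integral \<eta> c (ennreal x) else 0)"
    "e2ennreal (- G \<eta> c x) = (if c \<le> x then 0 else lower_integral \<eta> c x)"
  by (auto simp: G_eq[OF assms] e2ennreal_neg)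

lemma upper_integral_mono: "y \<le> z \<Longrightarrow> upper_integral \<eta> c y \<le> upper_integral \<eta> c z"
  unfolding upper_integral_def by (intro nn_integral_mono) (auto simp: indicator_def)

locale eta_function =
  fixes \<eta> :: "real \<Rightarrow> real"
  assumes cont: "continuous_on {0..} \<eta>"
    and mono: "mono_on {0..} \<eta>"
    and pos: "0 < x \<Longrightarrow> 0 < \<eta> x"
    and unbounded: "filterlim \<eta> at_top at_top"
begin

text \<open>Raising \<open>\<eta>\<close> to a positive minimum only weakens condition \<open>A_sup\<close>, and makes \<open>1/\<eta>\<close> integrable at the
  origin.\<close>

definition lift :: "real \<Rightarrow> real \<Rightarrow> real" where
  "lift e x = max (\<eta> x) (\<eta> e)"

lemma eta_monoD: "0 \<le> x \<Longrightarrow> x \<le> y \<Longrightarrow> \<eta> x \<le> \<eta> y"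
  using mono by (auto simp: mono_on_def)

lemma eta_nonneg: "0 \<le> x \<Longrightarrow> 0 \<le> \<eta> x"
proof (cases "x = 0")
  case True
  have "(\<eta> \<longlongrightarrow> \<eta> 0) (at 0 within {0..})" using cont by (auto simp: continuous_on_def)
  then have "(\<eta> \<longlongrightarrow> \<eta> 0) (at_right 0)" by (rule tendsto_within_subset) auto
  moreover have "\<forall>\<^sub>F x in at_right 0. 0 \<le> \<eta> x"
    using pos by (auto intro!: eventually_at_rightI[of 0 1] less_imp_le)
  ultimately show ?thesis using True by (intro tendsto_lowerbound[of \<eta> _ "at_right 0"]) auto
qed (auto intro!: less_imp_le pos)

lemma lift_ge: "\<eta> x \<le> lift e x" "\<eta> e \<le> lift e x"
  by (simp_all add: lift_def)

lemma lift_eq: "0 \<le> e \<Longrightarrow> e \<le> x \<Longrightarrow> lift e x = \<eta> x"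
  using eta_monoD[of e x] by (simp add: lift_def)

lemma growth_lift: "0 < e \<Longrightarrow> growth_function (lift e)"
proof
  assume e: "0 < e"
  show "continuous_on {0..} (lift e)" unfolding lift_def by (intro continuous_intros cont)
  show "mono_on {0..} (lift e)" unfolding lift_def by (intro mono_onI max.mono order_refl eta_monoD) auto
  show "0 < lift e x" for x using pos[OF e] by (simp add: lift_def less_max_iff_disj)
  show "filterlim (lift e) at_top at_top"
    by (rule filterlim_at_top_mono[OF unbounded]) (simp add: lift_ge)
qed

lemma eta_max_measurable [measurable]: "(\<lambda>x. \<eta> (max 0 x)) \<in> borel_measurable borel"
proof -
  have "continuous_on UNIV (\<lambda>x. \<eta> (max 0 x))"
    by (rule continuous_on_compose2[OF cont]) (auto intro!: continuous_intros)
  then show ?thesis by (rule borel_measurable_continuous_onI)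
qed

text \<open>Nothing is assumed about \<open>\<eta>\<close> on the negative axis. With
  \<open>max 0 v\<close> the integrand is measurable on the whole line and unchanged where it
  counts.\<close>

lemma recip_eq: "recip_integral (lift e) z
    = (\<integral>\<^sup>+v. ennreal (1 / max (\<eta> (max 0 v)) (\<eta> e)) * indicator {v. 0 < v \<and> ennreal v < z} v \<partial>lborel)"
  unfolding recip_integral_def by (intro nn_integral_cong) (auto simp: indicator_def lift_def max_def)

lemma upper_eq: "0 \<le> c \<Longrightarrow> upper_integral \<eta> c z
    = (\<integral>\<^sup>+v. ennreal (1 / \<eta> (max 0 v)) * indicator {v. c < v \<and> ennreal v < z} v \<partial>lborel)"
  unfolding upper_integral_def by (intro nn_integral_cong) (auto simp: indicator_def max_def)

lemma lower_eq: "0 \<le> x \<Longrightarrow> lower_integral \<eta> c x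
    = (\<integral>\<^sup>+v. ennreal (1 / \<eta> (max 0 v)) * indicator {x<..<c} v \<partial>lborel)"
  unfolding lower_integral_def by (intro nn_integral_cong) (auto simp: indicator_def max_def)

lemma ennreal_less_measurable [measurable]: "{v. a < v \<and> ennreal v < z} \<in> sets (borel :: real measure)"
proof -
  have "{v \<in> space borel. a < v \<and> ennreal v < z} \<in> sets (borel :: real measure)" by measurable
  then show ?thesis by simp
qed

text \<open>Above \<open>e\<close> the lift is invisible, so beyond \<open>c\<close> the primitive
  grows exactly like \<open>G\<close>.\<close>

lemma recip_split:
  assumes e: "0 < e" "e \<le> c" and z: "ennreal c \<le> z"
  shows "recip_integral (lift e) z = recip_integral (lift e) (ennreal c) + upper_integral \<eta> c z"
proof -
  let ?f = "\<lambda>v. ennreal (1 / max (\<eta> (max 0 v)) (\<eta> e))" and ?g = "\<lambda>v. ennreal (1 / \<eta> (max 0 v))"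
  have c0: "0 \<le> c" using e by simp
  have "recip_integral (lift e) z
    = (\<integral>\<^sup>+v. ?f v * indicator {v. 0 < v \<and> ennreal v < ennreal c} v + ?g v * indicator {v. c < v \<and> ennreal v < z} v \<partial>lborel)"
    unfolding recip_eq
  proof (rule nn_integral_cong_AE, rule AE_mp[OF AE_lborel_singleton[of c]], intro AE_I2 impI)
    fix v assume v: "v \<noteq> c"
    consider "v < c" "ennreal v < z \<or> v \<le> 0" | "c < v"
    proof (cases "v < c")
      case True
      then have "ennreal v < ennreal c \<or> v \<le> 0" by (auto simp: ennreal_less_iff)
      then show ?thesis using z True that(1) by (auto intro: less_le_trans)
    qed (use v that(2) in auto)
    then show "?f v * indicator {v. 0 < v \<and> ennreal v < z} v
       = ?f v * indicator {v. 0 < v \<and> ennreal v < ennreal c} v + ?g v * indicator {v. c < v \<and> ennreal v < z} v"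
    proof cases
      case 1
      then have "ennreal v < ennreal c" if "0 < v" using that by (simp add: ennreal_less_iff)
      with 1 show ?thesis by (auto simp: indicator_def)
    next
      case 2
      then have "max (\<eta> (max 0 v)) (\<eta> e) = \<eta> v" using e lift_eq[of e v] by (simp add: lift_def)
      moreover have "\<not> ennreal v < ennreal c" using 2 c0 by (simp add: not_less ennreal_leI)
      ultimately show ?thesis using 2 c0 by (auto simp: indicator_def max_def)
    qed
  qed
  also have "\<dots> = recip_integral (lift e) (ennreal c) + upper_integral \<eta> c z"
    unfolding recip_eq upper_eq[OF c0] by (intro nn_integral_add) measurable
  finally show ?thesis .
qed

text \<open>On \<open>(x, c)\<close> the lifted reciprocal is at most \<open>1 / \<eta>\<close>,
  with equality once \<open>e \<le> x\<close>. The inequality serves the values of \<open>X\<close>,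
  which may fall below any \<open>e\<close>; the equality serves \<open>E[H]\<close>, to which
  \<open>e\<close> can be adapted.\<close>

lemma recip_lower:
  assumes e: "0 < e" "e \<le> c" and x: "0 \<le> x" "x < c"
  shows "recip_integral (lift e) (ennreal c) \<le> recip_integral (lift e) (ennreal x) + lower_integral \<eta> c x"
    and "e \<le> x \<Longrightarrow> recip_integral (lift e) (ennreal c) = recip_integral (lift e) (ennreal x) + lower_integral \<eta> c x"
proof -
  let ?f = "\<lambda>v. ennreal (1 / max (\<eta> (max 0 v)) (\<eta> e))" and ?g = "\<lambda>v. ennreal (1 / \<eta> (max 0 v))"
  have sum: "recip_integral (lift e) (ennreal x) + lower_integral \<eta> c x
     = (\<integral>\<^sup>+v. ?f v * indicator {v. 0 < v \<and> ennreal v < ennreal x} v + ?g v * indicator {x<..<c} v \<partial>lborel)"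
    unfolding recip_eq lower_eq[OF x(1)] by (intro nn_integral_add[symmetric]) measurable
  have pt: "v < x \<or> x < v \<and> v < c \<or> c \<le> v" if "v \<noteq> x" for v using that by auto
  have fg: "?f v \<le> ?g v" if "0 < v" for v
    using pos[OF that] that by (intro ennreal_leI divide_left_mono) (auto simp: max_def)
  show "recip_integral (lift e) (ennreal c) \<le> recip_integral (lift e) (ennreal x) + lower_integral \<eta> c x"
    unfolding sum unfolding recip_eq
  proof (rule nn_integral_mono_AE, rule AE_mp[OF AE_lborel_singleton[of x]], intro AE_I2 impI)
    fix v assume "v \<noteq> x"
    with pt[OF this] x fg[of v] show "?f v * indicator {v. 0 < v \<and> ennreal v < ennreal c} v
      \<le> ?f v * indicator {v. 0 < v \<and> ennreal v < ennreal x} v + ?g v * indicator {x<..<c} v"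
      by (auto simp: indicator_def ennreal_less_iff)
  qed
  assume ex: "e \<le> x"
  have fg': "?f v = ?g v" if "x < v" for v
    using that ex e lift_eq[of e v] by (simp add: lift_def)
  show "recip_integral (lift e) (ennreal c) = recip_integral (lift e) (ennreal x) + lower_integral \<eta> c x"
    unfolding sum unfolding recip_eq
  proof (rule nn_integral_cong_AE, rule AE_mp[OF AE_lborel_singleton[of x]], intro AE_I2 impI)
    fix v assume "v \<noteq> x"
    with pt[OF this] x fg'[of v] show "?f v * indicator {v. 0 < v \<and> ennreal v < ennreal c} v
      = ?f v * indicator {v. 0 < v \<and> ennreal v < ennreal x} v + ?g v * indicator {x<..<c} v"
      by (auto simp: indicator_def ennreal_less_iff)
  qed
qed

lemma recip_le:
  assumes "0 < e" "0 \<le> x" shows "recip_integral (lift e) (ennreal x) \<le> ennreal (x / \<eta> e)"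
proof -
  have "recip_integral (lift e) (ennreal x) \<le> (\<integral>\<^sup>+v. ennreal (1 / \<eta> e) * indicator {0<..<x} v \<partial>lborel)"
    unfolding recip_integral_def
  proof (intro nn_integral_mono)
    fix v
    have "1 / lift e v \<le> 1 / \<eta> e" using pos[OF assms(1)] lift_ge(2)[of e v] by (intro divide_left_mono) auto
    then show "ennreal (1 / lift e v) * indicator {v. 0 < v \<and> ennreal v < ennreal x} v
       \<le> ennreal (1 / \<eta> e) * indicator {0<..<x} v"
      using assms(2) by (auto simp: indicator_def ennreal_less_iff intro: ennreal_leI)
  qed
  also have "\<dots> = ennreal (1 / \<eta> e) * ennreal x"
    using assms(2) by (subst nn_integral_cmult_indicator) auto
  also have "\<dots> = ennreal (x / \<eta> e)" using assms pos[OF assms(1)] by (simp flip: ennreal_mult)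
  finally show ?thesis .
qed

lemma recip_finite: "0 < e \<Longrightarrow> 0 \<le> x \<Longrightarrow> recip_integral (lift e) (ennreal x) < \<top>"
  using recip_le[of e x] by (simp add: le_less_trans)

lemma recip_mono: "y \<le> z \<Longrightarrow> recip_integral \<eta>' y \<le> recip_integral \<eta>' z"
  unfolding recip_integral_def by (intro nn_integral_mono) (auto simp: indicator_def)

lemma recip_zero: "recip_integral \<eta>' 0 = 0"
  by (simp add: recip_integral_def)

lemma upper_finite:
  assumes "0 < c" "0 \<le> x" shows "upper_integral \<eta> c (ennreal x) < \<top>"
proof (cases "c \<le> x")
  case True
  then have "recip_integral (lift c) (ennreal x)
     = recip_integral (lift c) (ennreal c) + upper_integral \<eta> c (ennreal x)"
    using assms by (intro recip_split) (auto intro: ennreal_leI)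
  then show ?thesis using recip_finite[OF assms] by (simp add: less_top)
next
  case False
  then have "{v. c < v \<and> ennreal v < ennreal x} = {}" using assms by (auto simp: ennreal_less_iff)
  then show ?thesis by (simp add: upper_integral_def)
qed

lemma lower_integral_limit:
  assumes "0 < c"
  shows "(\<lambda>n. lower_integral \<eta> c (c * inverse (real (Suc n)))) \<longlonglongrightarrow> lower_integral \<eta> c 0"
proof -
  let ?g = "\<lambda>v. ennreal (1 / \<eta> (max 0 v))" and ?e = "\<lambda>n. c * inverse (real (Suc n))"
  have dec: "?e n \<le> ?e m" if "m \<le> n" for m n
    using that assms by (intro mult_left_mono) auto
  have inc: "incseq (\<lambda>n v. ?g v * indicator {?e n<..<c} v)"
  proof (intro incseq_SucI le_funI)
    fix n v
    show "?g v * indicator {?e n<..<c} v \<le> ?g v * indicator {?e (Suc n)<..<c} v"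
      using dec[of n "Suc n"] by (auto simp: indicator_def simp del: of_nat_Suc)
  qed
  have sup: "(SUP n. ?g v * indicator {?e n<..<c} v) = ?g v * indicator {0<..<c} v" for v
  proof (rule antisym)
    have e0: "0 \<le> ?e n" for n using assms by simp
    show "(SUP n. ?g v * indicator {?e n<..<c} v) \<le> ?g v * indicator {0<..<c} v"
      using e0 by (intro SUP_least) (auto simp: indicator_def intro: le_less_trans simp del: of_nat_Suc)
    show "?g v * indicator {0<..<c} v \<le> (SUP n. ?g v * indicator {?e n<..<c} v)"
    proof (cases "v \<in> {0<..<c}")
      case True
      then have "0 < v / c" using assms by simp
      then obtain n where "inverse (real (Suc n)) < v / c" using reals_Archimedean by blast
      then have "?e n < v" using assms by (simp add: pos_less_divide_eq mult.commute)
      then show ?thesis using True by (intro SUP_upper2[of n]) auto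
    qed simp
  qed
  have "lower_integral \<eta> c 0 = (SUP n. lower_integral \<eta> c (?e n))"
    using assms by (simp add: lower_eq sup[symmetric] nn_integral_monotone_convergence_SUP[OF inc] del: of_nat_Suc)
  moreover have "incseq (\<lambda>n. lower_integral \<eta> c (?e n))"
  proof (rule incseq_SucI)
    fix n
    have "{?e n<..<c} \<subseteq> {?e (Suc n)<..<c}" using dec[of n "Suc n"] by auto
    then show "lower_integral \<eta> c (?e n) \<le> lower_integral \<eta> c (?e (Suc n))"
      unfolding lower_integral_def by (intro nn_integral_mono) (auto simp: indicator_def)
  qed
  ultimately show ?thesis using LIMSEQ_SUP by metis
qed

lemma upper_integral_top:
  assumes c: "0 < c"
  shows "upper_integral \<eta> c \<top> = (SUP n. upper_integral \<eta> c (ennreal (real n)))"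
proof -
  let ?g = "\<lambda>v. ennreal (1 / \<eta> (max 0 v))"
  have inc: "incseq (\<lambda>n v. ?g v * indicator {v. c < v \<and> ennreal v < ennreal (real n)} v)"
    by (auto simp: incseq_def le_fun_def indicator_def intro: less_le_trans)
  have sup: "(SUP n. ?g v * indicator {v. c < v \<and> ennreal v < ennreal (real n)} v) = ?g v * indicator {v. c < v \<and> ennreal v < \<top>} v" for v
  proof (rule antisym)
    show "(SUP n. ?g v * indicator {v. c < v \<and> ennreal v < ennreal (real n)} v) \<le> ?g v * indicator {v. c < v \<and> ennreal v < \<top>} v"
      by (intro SUP_least) (auto simp: indicator_def)
    obtain n where "v < real n" using reals_Archimedean2 by blast
    then show "?g v * indicator {v. c < v \<and> ennreal v < \<top>} v \<le> (SUP n. ?g v * indicator {v. c < v \<and> ennreal v < ennreal (real n)} v)"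
      using c by (intro SUP_upper2[of n]) (auto simp: indicator_def ennreal_less_iff)
  qed
  show ?thesis
  proof -
    have "upper_integral \<eta> c \<top> = (\<integral>\<^sup>+v. (SUP n. ?g v * indicator {v. c < v \<and> ennreal v < ennreal (real n)} v) \<partial>lborel)"
      unfolding sup using c by (intro upper_eq) simp
    also have "\<dots> = (SUP n. \<integral>\<^sup>+v. ?g v * indicator {v. c < v \<and> ennreal v < ennreal (real n)} v \<partial>lborel)"
      by (intro nn_integral_monotone_convergence_SUP[OF inc]) measurable
    also have "\<dots> = (SUP n. upper_integral \<eta> c (ennreal (real n)))"
      using c by (intro SUP_cong refl upper_eq[symmetric]) simp
    finally show ?thesis .
  qed
qed

lemma G_ext_top:
  assumes c: "0 < c" shows "G_ext \<eta> c \<top> = enn2ereal (upper_integral \<eta> c \<top>)"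
proof -
  have "(G \<eta> c \<longlongrightarrow> enn2ereal (upper_integral \<eta> c \<top>)) at_top"
  proof (rule order_tendstoI)
    fix a assume "a < enn2ereal (upper_integral \<eta> c \<top>)"
    show "\<forall>\<^sub>F x in at_top. a < G \<eta> c x"
    proof (cases "0 \<le> a")
      case True
      then obtain a' where a': "a = enn2ereal a'" using enn2ereal_e2ennreal by metis
      with \<open>a < _\<close> obtain n where n: "a' < upper_integral \<eta> c (ennreal (real n))"
        unfolding upper_integral_top[OF c] by (auto simp: less_ennreal.rep_eq[symmetric] less_SUP_iff)
      have "a < G \<eta> c x" if "max c (real n) \<le> x" for x
      proof -
        have "a' < upper_integral \<eta> c (ennreal x)"
          using n upper_integral_mono[of "ennreal (real n)" "ennreal x" \<eta> c] that by (auto intro: ennreal_leI less_le_trans)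
        then show ?thesis using that c by (simp add: G_eq a' less_ennreal.rep_eq)
      qed
      then show ?thesis unfolding eventually_at_top_linorder by blast
    next
      case False
      have "a < G \<eta> c x" if "c \<le> x" for x
      proof -
        have "0 \<le> G \<eta> c x" using that c by (simp add: G_eq)
        with False show ?thesis by auto
      qed
      then show ?thesis unfolding eventually_at_top_linorder by blast
    qed
  next
    fix a assume a: "enn2ereal (upper_integral \<eta> c \<top>) < a"
    have "G \<eta> c x < a" if "c \<le> x" for x
    proof -
      have "G \<eta> c x \<le> enn2ereal (upper_integral \<eta> c \<top>)"
        using that c upper_integral_mono[of "ennreal x" \<top> \<eta> c] by (simp add: G_eq less_eq_ennreal.rep_eq)
      then show ?thesis using a by (rule le_less_trans)
    qed
    then show "\<forall>\<^sub>F x in at_top. G \<eta> c x < a" unfolding eventually_at_top_linorder by blast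
  qed
  then show ?thesis unfolding G_ext_def by (simp add: tendsto_Lim)
qed

lemma G_ext_eq:
  assumes c: "0 < c"
  shows "G_ext \<eta> c z = (if ennreal c \<le> z then enn2ereal (upper_integral \<eta> c z) else - enn2ereal (lower_integral \<eta> c (enn2real z)))"
proof (cases "z = \<top>")
  case True then show ?thesis by (simp add: G_ext_top[OF c])
next
  case False
  then have z: "z = ennreal (enn2real z)" by (simp add: less_top)
  have "c \<le> enn2real z \<longleftrightarrow> ennreal c \<le> z" by (subst (2) z) (simp add: ennreal_le_iff)
  then show ?thesis using False z c by (simp add: G_ext_def G_eq)
qed

end

section \<open>The expectation of G\<close>

lemma (in growth_function) recip_integral_measurable [measurable]:
  "recip_integral \<eta> \<in> borel_measurable borel"
proof -
  interpret D: sigma_finite_measure decay by (rule sigma_finite_decay)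
  have "(\<lambda>z. \<integral>\<^sup>+u. min z (ennreal u) \<partial>decay) \<in> borel_measurable borel"
    by (rule D.borel_measurable_nn_integral) measurable
  then show ?thesis by (simp add: recip_integral_layer[abs_def])
qed

lemma (in eta_function) upper_integral_measurable:
  assumes "0 \<le> c" shows "upper_integral \<eta> c \<in> borel_measurable borel"
proof -
  have "(\<lambda>z. \<integral>\<^sup>+v. (if c < v \<and> ennreal v < z then ennreal (1 / \<eta> (max 0 v)) else 0) \<partial>lborel) \<in> borel_measurable borel"
    by measurable
  moreover have "upper_integral \<eta> c = (\<lambda>z. \<integral>\<^sup>+v. (if c < v \<and> ennreal v < z then ennreal (1 / \<eta> (max 0 v)) else 0) \<partial>lborel)"
    unfolding upper_eq[OF assms, abs_def] by (intro ext nn_integral_cong) (auto simp: indicator_def)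
  ultimately show ?thesis by simp
qed

lemma (in eta_function) lower_integral_measurable:
  "(\<lambda>x. lower_integral \<eta> c (max 0 x)) \<in> borel_measurable borel"
proof -
  have "(\<lambda>x. \<integral>\<^sup>+v. (if max 0 x < v \<and> v < c then ennreal (1 / \<eta> (max 0 v)) else 0) \<partial>lborel) \<in> borel_measurable borel"
    by measurable
  moreover have "lower_integral \<eta> c (max 0 x) = (\<integral>\<^sup>+v. (if max 0 x < v \<and> v < c then ennreal (1 / \<eta> (max 0 v)) else 0) \<partial>lborel)" for x
    by (subst lower_eq) (auto intro!: nn_integral_cong simp: indicator_def)
  ultimately show ?thesis by simp
qed

locale A_sup_unbounded = A_sup +
  assumes eta_unbounded: "filterlim \<eta> at_top at_top"

sublocale A_sup_unbounded \<subseteq> E: eta_function \<eta>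
  by standard (use eta_cont eta_mono eta_pos eta_unbounded in auto)

context A_sup_unbounded
begin

lemma key_inequality_lift:
  assumes "0 < e" "is_stopping_time F \<theta>" "0 \<le> T"
  shows "(\<integral>\<^sup>+\<omega>. recip_integral (E.lift e) (ennreal (X (stopped_time \<theta> T \<omega>) \<omega>)) \<partial>P)
    \<le> (\<integral>\<^sup>+\<omega>. ennreal (A (stopped_time \<theta> T \<omega>) \<omega>) \<partial>P)
      + recip_integral (E.lift e) (\<integral>\<^sup>+\<omega>. ennreal (H (stopped_time \<theta> T \<omega>) \<omega>) \<partial>P)"
  by (rule key_inequality[OF E.growth_lift[OF assms(1)] E.lift_ge(1) assms(2,3)])

lemma stopped_X_measurable:
  "is_stopping_time F \<theta> \<Longrightarrow> (\<lambda>\<omega>. X (stopped_time \<theta> T \<omega>) \<omega>) \<in> borel_measurable P"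
  by (rule measurable_right_continuous_at[OF X_meas X_rc stopped_time_measurable]) auto

text \<open>\<open>p\<close> and \<open>q\<close> are the expectations of the positive and negative
  part of \<open>G\<close>. In \<open>main\<close>, \<open>\<Gamma>(c)\<close> is added rather than
  subtracted, and cancelled only when finite. If \<open>E[H] \<ge> c\<close>, the choice
  \<open>e = c\<close> suffices; if \<open>E[H] = x\<close> with \<open>0 < x < c\<close>, then
  \<open>e = x\<close> gives the claim; if \<open>E[H] = 0\<close>, then
  \<open>\<Gamma>(0) = 0\<close> and the limit \<open>e = c / (n + 1)\<close> recovers
  \<open>G(0)\<close>, finite or not.\<close>

lemma expectation_G_le:
  assumes c: "0 < c" and \<theta>: "is_stopping_time F \<theta>" and T: "0 \<le> T"
  shows "ereal_expectation P (\<lambda>\<omega>. G \<eta> c (X (stopped_time \<theta> T \<omega>) \<omega>))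
    \<le> enn2ereal (\<integral>\<^sup>+\<omega>. ennreal (A (stopped_time \<theta> T \<omega>) \<omega>) \<partial>P)
      + G_ext \<eta> c (\<integral>\<^sup>+\<omega>. ennreal (H (stopped_time \<theta> T \<omega>) \<omega>) \<partial>P)"
proof -
  define Y where "Y \<omega> = X (stopped_time \<theta> T \<omega>) \<omega>" for \<omega>
  define a where "a = (\<integral>\<^sup>+\<omega>. ennreal (A (stopped_time \<theta> T \<omega>) \<omega>) \<partial>P)"
  define h where "h = (\<integral>\<^sup>+\<omega>. ennreal (H (stopped_time \<theta> T \<omega>) \<omega>) \<partial>P)"
  define p where "p = (\<integral>\<^sup>+\<omega>. e2ennreal (G \<eta> c (Y \<omega>)) \<partial>P)"
  define q where "q = (\<integral>\<^sup>+\<omega>. e2ennreal (- G \<eta> c (Y \<omega>)) \<partial>P)"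
  have Y[measurable]: "Y \<in> borel_measurable P" unfolding Y_def[abs_def] by (rule stopped_X_measurable[OF \<theta>])
  have Y0: "0 \<le> Y \<omega>" if "\<omega> \<in> space P" for \<omega> unfolding Y_def by (rule X_nonneg[OF that]) simp
  let ?\<Gamma> = "\<lambda>e. recip_integral (E.lift e)"
  have key: "(\<integral>\<^sup>+\<omega>. ?\<Gamma> e (ennreal (Y \<omega>)) \<partial>P) \<le> a + ?\<Gamma> e h" if "0 < e" for e
    using key_inequality_lift[OF that \<theta> T] by (simp add: Y_def a_def h_def)
  have \<Gamma>_meas: "(\<lambda>\<omega>. ?\<Gamma> e (ennreal (Y \<omega>))) \<in> borel_measurable P" if "0 < e" for e
    using growth_function.recip_integral_measurable[OF E.growth_lift[OF that]] by measurable
  have p_meas: "(\<lambda>\<omega>. e2ennreal (G \<eta> c (Y \<omega>))) \<in> borel_measurable P"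
  proof -
    have "(\<lambda>\<omega>. upper_integral \<eta> c (ennreal (Y \<omega>))) \<in> borel_measurable P"
      by (rule measurable_compose[OF _ E.upper_integral_measurable]) (use c in \<open>measurable, simp\<close>)
    then have "(\<lambda>\<omega>. if c \<le> Y \<omega> then upper_integral \<eta> c (ennreal (Y \<omega>)) else 0) \<in> borel_measurable P"
      by measurable
    then show ?thesis using e2ennreal_G(1)[OF Y0 c] by (simp cong: measurable_cong)
  qed
  have q_meas: "(\<lambda>\<omega>. e2ennreal (- G \<eta> c (Y \<omega>))) \<in> borel_measurable P"
  proof -
    have "(\<lambda>\<omega>. lower_integral \<eta> c (max 0 (Y \<omega>))) \<in> borel_measurable P"
      using measurable_compose[OF Y E.lower_integral_measurable] .
    then have "(\<lambda>\<omega>. if c \<le> Y \<omega> then 0 else lower_integral \<eta> c (max 0 (Y \<omega>))) \<in> borel_measurable P"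
      by measurable
    moreover have "e2ennreal (- G \<eta> c (Y \<omega>)) = (if c \<le> Y \<omega> then 0 else lower_integral \<eta> c (max 0 (Y \<omega>)))"
      if "\<omega> \<in> space P" for \<omega>
      using e2ennreal_G(2)[OF Y0[OF that] c] Y0[OF that] by (simp add: max_absorb2)
    ultimately show ?thesis by (simp cong: measurable_cong)
  qed
  have main: "p + ?\<Gamma> e (ennreal c) \<le> a + ?\<Gamma> e h + q" if e: "0 < e" "e \<le> c" for e
  proof -
    have pt: "e2ennreal (G \<eta> c y) + ?\<Gamma> e (ennreal c) \<le> ?\<Gamma> e (ennreal y) + e2ennreal (- G \<eta> c y)"
      if y: "0 \<le> y" for y
    proof (cases "c \<le> y")
      case True
      then show ?thesis
        using E.recip_split[OF e, of "ennreal y"] y by (simp add: e2ennreal_G[OF y c] ennreal_leI add.commute)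
    next
      case False
      then show ?thesis using E.recip_lower(1)[OF e y] by (simp add: e2ennreal_G[OF y c])
    qed
    have "p + ?\<Gamma> e (ennreal c) = (\<integral>\<^sup>+\<omega>. e2ennreal (G \<eta> c (Y \<omega>)) + ?\<Gamma> e (ennreal c) \<partial>P)"
      unfolding p_def using p_meas by (simp add: nn_integral_add emeasure_space_1)
    also have "\<dots> \<le> (\<integral>\<^sup>+\<omega>. ?\<Gamma> e (ennreal (Y \<omega>)) + e2ennreal (- G \<eta> c (Y \<omega>)) \<partial>P)"
      by (intro nn_integral_mono pt Y0)
    also have "\<dots> = (\<integral>\<^sup>+\<omega>. ?\<Gamma> e (ennreal (Y \<omega>)) \<partial>P) + q"
      unfolding q_def by (intro nn_integral_add \<Gamma>_meas e q_meas)
    also have "\<dots> \<le> a + ?\<Gamma> e h + q" by (intro add_right_mono key e)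
    finally show ?thesis .
  qed
  \<comment> \<open>Settles the case \<open>q = \<top>\<close>: the left side is then
    \<open>-\<infinity>\<close> and not the value \<open>\<infinity>\<close> that
    \<open>ereal\<close> gives to \<open>\<infinity> - \<infinity>\<close>.\<close>
  have p_fin: "p < \<top>" if "a < \<top>" "?\<Gamma> c h < \<top>"
  proof -
    have "p \<le> (\<integral>\<^sup>+\<omega>. ?\<Gamma> c (ennreal (Y \<omega>)) \<partial>P)"
      unfolding p_def
    proof (intro nn_integral_mono)
      fix \<omega> assume "\<omega> \<in> space P"
      from Y0[OF this] show "e2ennreal (G \<eta> c (Y \<omega>)) \<le> ?\<Gamma> c (ennreal (Y \<omega>))"
        using E.recip_split[OF c order_refl, of "ennreal (Y \<omega>)"] c
        by (auto simp: e2ennreal_G ennreal_leI add_increasing)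
    qed
    also have "\<dots> \<le> a + ?\<Gamma> c h" by (rule key[OF c])
    also have "\<dots> < \<top>" using that by (simp add: less_top)
    finally show ?thesis .
  qed
  have lhs: "ereal_expectation P (\<lambda>\<omega>. G \<eta> c (X (stopped_time \<theta> T \<omega>) \<omega>)) = enn2ereal p - enn2ereal q"
    by (simp add: ereal_expectation_def p_def q_def Y_def)
  have "enn2ereal p - enn2ereal q \<le> enn2ereal a + G_ext \<eta> c h"
  proof (cases "a = \<top>")
    case True
    then show ?thesis by simp
  next
    case a: False
    show ?thesis
    proof (cases "ennreal c \<le> h")
      case True
      have G: "G_ext \<eta> c h = enn2ereal (upper_integral \<eta> c h)" using True by (simp add: E.G_ext_eq[OF c])
      have sp: "?\<Gamma> c h = ?\<Gamma> c (ennreal c) + upper_integral \<eta> c h"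
        by (rule E.recip_split[OF c order_refl True])
      have fin: "?\<Gamma> c (ennreal c) < \<top>" using c by (intro E.recip_finite) auto
      show ?thesis
      proof (cases "upper_integral \<eta> c h = \<top>")
        case True
        then show ?thesis by (simp add: G)
      next
        case False
        then have pf: "p < \<top>" using p_fin a sp fin by (simp add: less_top)
        have "?\<Gamma> c (ennreal c) + p \<le> ?\<Gamma> c (ennreal c) + (a + upper_integral \<eta> c h + q)"
          using main[OF c order_refl] unfolding sp by (simp add: ac_simps)
        then have le: "p \<le> a + upper_integral \<eta> c h + q" using fin by (auto simp: ennreal_add_left_cancel_le)
        show ?thesis
        proof (cases "q = \<top>")
          case True
          then show ?thesis using pf by (cases p) auto
        next
          case q: False
          from le have "enn2ereal p \<le> enn2ereal (a + upper_integral \<eta> c h + q)" by (simp add: less_eq_ennreal.rep_eq)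
          then show ?thesis using pf a False q unfolding G
            by (cases p; cases a; cases q; cases "upper_integral \<eta> c h")
              (auto simp: plus_ennreal.rep_eq enn2ereal_ennreal simp flip: ennreal_plus)
        qed
      qed
    next
      case False
      then have h: "h = ennreal (enn2real h)" "enn2real h < c"
      proof -
        have "h < \<top>" using False by (cases h) auto
        then show e: "h = ennreal (enn2real h)" by simp
        show "enn2real h < c" using False c by (subst (asm) e) (simp add: ennreal_le_iff not_le)
      qed
      define x where "x = enn2real h"
      have x: "0 \<le> x" "x < c" "h = ennreal x" using h by (auto simp: x_def)
      have G: "G_ext \<eta> c h = - enn2ereal (lower_integral \<eta> c x)" using False by (simp add: E.G_ext_eq[OF c] x_def)
      have fin: "?\<Gamma> e h < \<top>" if "0 < e" for e unfolding x(3) using that x(1) by (rule E.recip_finite)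
      have pf: "p < \<top>" using a fin[OF c] by (intro p_fin) (simp_all add: less_top)
      have le: "p + lower_integral \<eta> c x \<le> a + q"
      proof (cases "x = 0")
        case False
        then have e: "0 < x" "x \<le> c" using x by auto
        have "?\<Gamma> x h + (p + lower_integral \<eta> c x) \<le> ?\<Gamma> x h + (a + q)"
          using main[OF e] E.recip_lower(2)[OF e x(1,2)] x(3) by (simp add: ac_simps)
        then show ?thesis using fin[OF e(1)] by (auto simp: ennreal_add_left_cancel_le)
      next
        case True
        have "p + lower_integral \<eta> c e \<le> a + q" if e: "0 < e" "e \<le> c" for e
        proof (cases "e = c")
          case True
          then have "lower_integral \<eta> c e = 0" by (simp add: lower_integral_def)
          then show ?thesis using main[OF e] x(3) \<open>x = 0\<close> E.recip_zero
            by (auto intro: order_trans[rotated] add_increasing2)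
        next
          case False
          then have "lower_integral \<eta> c e \<le> ?\<Gamma> e (ennreal c)"
            using E.recip_lower(2)[OF e, of e] e by (simp add: add_increasing)
          then have "p + lower_integral \<eta> c e \<le> p + ?\<Gamma> e (ennreal c)" by (rule add_left_mono)
          also have "\<dots> \<le> a + q" using main[OF e] x(3) \<open>x = 0\<close> E.recip_zero by simp
          finally show ?thesis .
        qed
        then have "p + lower_integral \<eta> c (c * inverse (real (Suc n))) \<le> a + q" for n
          using c mult_left_mono[of "inverse (real (Suc n))" 1 c] by (simp add: inverse_le_1_iff del: of_nat_Suc)
        moreover have "(\<lambda>n. p + lower_integral \<eta> c (c * inverse (real (Suc n)))) \<longlonglongrightarrow> p + lower_integral \<eta> c 0"
          by (intro tendsto_add tendsto_const E.lower_integral_limit c)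
        ultimately show ?thesis using True by (auto intro: LIMSEQ_le_const2)
      qed
      show ?thesis
      proof (cases "q = \<top>")
        case True
        then show ?thesis using pf by (cases p) auto
      next
        case q: False
        have "a + q < \<top>" using a q by (simp add: less_top)
        then have l: "lower_integral \<eta> c x < \<top>" using le by (metis le_less_trans le_iff_add add.commute)
        from le have "enn2ereal (p + lower_integral \<eta> c x) \<le> enn2ereal (a + q)" by (simp add: less_eq_ennreal.rep_eq)
        then show ?thesis using pf a l q unfolding G
          by (cases p; cases a; cases q; cases "lower_integral \<eta> c x")
            (auto simp: plus_ennreal.rep_eq enn2ereal_ennreal simp flip: ennreal_plus)
      qed
    qed
  qed
  then show ?thesis using lhs by (simp add: a_def h_def)
qed

end

section \<open>Tail bounds for the running supremum\<close>

context A_sup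
begin

lemma running_sup_eq:
  assumes "0 \<le> T"
  shows "running_sup X T \<omega> = max (running_sup_left X T \<omega>) (ennreal (X T \<omega>))"
proof (cases "T = 0")
  case False
  then have e: "{0..T} = {0..<T} \<union> {T}" using assms by auto
  show ?thesis unfolding running_sup_def e using assms False
    by (simp add: running_sup_left_def SUP_union sup_max max.commute)
qed (simp add: running_sup_def running_sup_left_def)

lemma running_sup_measurable:
  assumes T: "0 \<le> T" shows "running_sup X T \<in> borel_measurable P"
proof -
  have [measurable]: "X T \<in> borel_measurable P" by (rule X_meas[OF T])
  have "(\<lambda>\<omega>. running_sup_left X T \<omega>) \<in> borel_measurable P"
    using measurable_compose[OF _ running_sup_left_measurable, of "\<lambda>\<omega>. (\<omega>, T)" P] by simp
  then have "(\<lambda>\<omega>. max (running_sup_left X T \<omega>) (ennreal (X T \<omega>))) \<in> borel_measurable P" by measurable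
  then show ?thesis by (simp add: running_sup_eq[OF T, abs_def])
qed

text \<open>Stopping at the first passage of \<open>X\<close> above \<open>u\<close>, but strictly before \<open>A\<close> reaches \<open>k\<close>; this is where
  predictability of \<open>A\<close> enters.\<close>

lemma passage_before_level:
  assumes T: "0 \<le> T" and k: "0 < k" and d: "0 < d"
  shows "\<exists>\<theta>. is_stopping_time F \<theta> \<and> (AE \<omega> in P. A (stopped_time \<theta> T \<omega>) \<omega> \<le> min (A T \<omega>) k) \<and>
    measure P {\<omega>\<in>space P. ennreal u < running_sup X T \<omega>}
      \<le> measure P {\<omega>\<in>space P. u \<le> X (stopped_time \<theta> T \<omega>) \<omega>} + measure P {\<omega>\<in>space P. k \<le> A T \<omega>} + d"
proof -
  obtain \<rho> where \<rho>: "is_stopping_time F \<rho>" "AE \<omega> in P. A (stopped_time \<rho> T \<omega>) \<omega> \<le> min (A T \<omega>) k"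
    "measure P {\<omega>\<in>space P. \<rho> \<omega> < ennreal T \<and> A T \<omega> < k} \<le> d"
    using predictable_level_foretell[OF A_predictable A_0 A_mono_on A_rc k T d] by blast
  define \<theta> where "\<theta> \<omega> = min (\<rho> \<omega>) (hitting X u \<omega>)" for \<omega>
  have \<theta>: "is_stopping_time F \<theta>"
    unfolding \<theta>_def[abs_def] by (intro stop_min \<rho> stop_hitting X_adapted X_rc)
  have le: "stopped_time \<theta> T \<omega> \<le> stopped_time \<rho> T \<omega>" for \<omega>
  proof -
    have "ennreal (stopped_time \<theta> T \<omega>) \<le> ennreal (stopped_time \<rho> T \<omega>)"
      unfolding ennreal_stopped_time[OF T] by (simp add: \<theta>_def min_le_iff_disj)
    then show ?thesis by simp
  qed
  have 1: "AE \<omega> in P. A (stopped_time \<theta> T \<omega>) \<omega> \<le> min (A T \<omega>) k"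
    using \<rho>(2)
  proof (rule AE_mp, intro AE_I2 impI)
    fix \<omega> assume "\<omega> \<in> space P" "A (stopped_time \<rho> T \<omega>) \<omega> \<le> min (A T \<omega>) k"
    then show "A (stopped_time \<theta> T \<omega>) \<omega> \<le> min (A T \<omega>) k"
      using A_mono[of \<omega> "stopped_time \<theta> T \<omega>" "stopped_time \<rho> T \<omega>"] le[of \<omega>] by simp
  qed
  let ?S = "{\<omega>\<in>space P. u \<le> X (stopped_time \<theta> T \<omega>) \<omega>}"
  let ?E = "{\<omega>\<in>space P. k \<le> A T \<omega>}"
  let ?N = "{\<omega>\<in>space P. \<rho> \<omega> < ennreal T \<and> A T \<omega> < k}"
  have AT: "A T \<in> borel_measurable P" by (rule A_meas[OF T])
  have S: "?S \<in> sets P"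
    using measurable_right_continuous_at[OF X_meas X_rc stopped_time_measurable[OF \<theta>]] by measurable
  have E: "?E \<in> sets P" using AT by measurable
  have N: "?N \<in> sets P" using AT stop_measurable[OF \<rho>(1)] by measurable
  \<comment> \<open>If the announcement does not come before \<open>T\<close>, the stopped time is
    the passage itself and \<open>X\<close> is at least \<open>u\<close> there. If it does, then
    either \<open>A\<close> reaches the level by \<open>T\<close> or the announcement is a false
    alarm.\<close>
  have "{\<omega>\<in>space P. ennreal u < running_sup X T \<omega>} \<subseteq> ?S \<union> ?E \<union> ?N"
  proof
    fix \<omega> assume "\<omega> \<in> {\<omega>\<in>space P. ennreal u < running_sup X T \<omega>}"
    then have \<omega>: "\<omega> \<in> space P" and "ennreal u < running_sup X T \<omega>" by auto
    then obtain s where s: "0 \<le> s" "s \<le> T" "ennreal u < ennreal (X s \<omega>)"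
      by (auto simp: running_sup_def less_SUP_iff)
    then have us: "u < X s \<omega>" by (metis ennreal_leI not_le)
    show "\<omega> \<in> ?S \<union> ?E \<union> ?N"
    proof (cases "\<rho> \<omega> < ennreal T")
      case False
      have e: "ennreal (stopped_time \<theta> T \<omega>) = min (hitting X u \<omega>) (ennreal T)"
        unfolding ennreal_stopped_time[OF T] using False by (auto simp: \<theta>_def min_def)
      have hs: "hitting X u \<omega> \<le> ennreal s" unfolding hitting_def using s us by (intro INF_lower) auto
      also have "\<dots> \<le> ennreal T" using s by (intro ennreal_leI)
      finally have "hitting X u \<omega> = ennreal (stopped_time \<theta> T \<omega>)" using e by (simp add: min_absorb1)
      from ge_at_hitting[where X = X, OF X_rc[OF \<omega>] stopped_time_nonneg this] show ?thesis using \<omega> by simp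
    qed (use \<omega> in auto)
  qed
  then have "measure P {\<omega>\<in>space P. ennreal u < running_sup X T \<omega>} \<le> measure P (?S \<union> ?E \<union> ?N)"
    using S E N by (intro finite_measure_mono) auto
  also have "\<dots> \<le> measure P ?S + measure P ?E + measure P ?N"
    using S E N measure_Un_le[of "?S \<union> ?E" P ?N] measure_Un_le[of ?S P ?E] by auto
  finally show ?thesis using \<theta> 1 \<rho>(3) by (intro exI[of _ \<theta>]) auto
qed

lemma A_level_tendsto:
  assumes T: "0 \<le> T" shows "(\<lambda>n. measure P {\<omega>\<in>space P. real n \<le> A T \<omega>}) \<longlonglongrightarrow> 0"
proof -
  have AT: "A T \<in> borel_measurable P" by (rule A_meas[OF T])
  have "(\<lambda>n. measure P {\<omega>\<in>space P. real n \<le> A T \<omega>}) \<longlonglongrightarrow> measure P (\<Inter>n. {\<omega>\<in>space P. real n \<le> A T \<omega>})"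
  proof (rule finite_Lim_measure_decseq)
    have "{\<omega>\<in>space P. real n \<le> A T \<omega>} \<in> sets P" for n using AT by measurable
    then show "range (\<lambda>n. {\<omega>\<in>space P. real n \<le> A T \<omega>}) \<subseteq> sets P" by blast
  qed (auto simp: decseq_def)
  moreover have "(\<Inter>n. {\<omega>\<in>space P. real n \<le> A T \<omega>}) = {}"
  proof (rule equals0I)
    fix \<omega> assume \<omega>: "\<omega> \<in> (\<Inter>n. {\<omega>\<in>space P. real n \<le> A T \<omega>})"
    obtain n where "A T \<omega> < real n" using reals_Archimedean2 by blast
    moreover have "real n \<le> A T \<omega>" using \<omega> by blast
    ultimately show False by simp
  qed
  ultimately show ?thesis by simp
qed

lemma stopped_A_le:
  assumes "AE \<omega> in P. A (stopped_time \<theta> T \<omega>) \<omega> \<le> min (A T \<omega>) k"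
  shows "(\<integral>\<^sup>+\<omega>. ennreal (A (stopped_time \<theta> T \<omega>) \<omega>) \<partial>P) \<le> (\<integral>\<^sup>+\<omega>. ennreal (min (A T \<omega>) k) \<partial>P)"
  by (rule nn_integral_mono_AE, rule eventually_mono[OF assms]) (rule ennreal_leI)

lemma stopped_H_le:
  assumes "0 \<le> T"
  shows "(\<integral>\<^sup>+\<omega>. ennreal (H (stopped_time \<theta> T \<omega>) \<omega>) \<partial>P) \<le> (\<integral>\<^sup>+\<omega>. ennreal (H T \<omega>) \<partial>P)"
  by (intro nn_integral_mono ennreal_leI H_mono stopped_time_le assms) auto

end

context A_sup_unbounded
begin

text \<open>Markov's inequality for \<open>\<Gamma>\<close> of the stopped \<open>X\<close>: each
  path of the event costs at least \<open>g\<close>, while the budget is \<open>k\<close> from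
  \<open>A\<close> and, since \<open>1 / lift e\<close> is at most \<open>1 / \<eta> e\<close>, no
  more than \<open>h / \<eta> e\<close> from \<open>H\<close>. For fixed \<open>e\<close> the latter
  is linear in \<open>h\<close>.\<close>

lemma tail_bound:
  assumes T: "0 \<le> T" and k: "0 < k" and e: "0 < e" and \<delta>: "0 \<le> \<delta>"
    and g: "0 < g" "ennreal g \<le> recip_integral (E.lift e) (ennreal \<delta>)"
    and h: "0 \<le> h" "(\<integral>\<^sup>+\<omega>. ennreal (H T \<omega>) \<partial>P) \<le> ennreal h"
  shows "measure P {\<omega>\<in>space P. ennreal \<delta> < running_sup X T \<omega>}
    \<le> (k + h / \<eta> e) / g + measure P {\<omega>\<in>space P. k \<le> A T \<omega>}"
proof (rule field_le_epsilon)
  fix d :: real assume d: "0 < d"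
  obtain \<theta> where \<theta>: "is_stopping_time F \<theta>" "AE \<omega> in P. A (stopped_time \<theta> T \<omega>) \<omega> \<le> min (A T \<omega>) k"
    "measure P {\<omega>\<in>space P. ennreal \<delta> < running_sup X T \<omega>}
      \<le> measure P {\<omega>\<in>space P. \<delta> \<le> X (stopped_time \<theta> T \<omega>) \<omega>} + measure P {\<omega>\<in>space P. k \<le> A T \<omega>} + d"
    using passage_before_level[OF T k d] by blast
  let ?S = "{\<omega>\<in>space P. \<delta> \<le> X (stopped_time \<theta> T \<omega>) \<omega>}"
  let ?\<Gamma> = "recip_integral (E.lift e)"
  have S: "?S \<in> sets P" using stopped_X_measurable[OF \<theta>(1), of T] by measurable
  have e0: "0 < \<eta> e" using eta_pos[OF e] .
  have "ennreal g * ennreal (measure P ?S) = (\<integral>\<^sup>+\<omega>. ennreal g * indicator ?S \<omega> \<partial>P)"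
    using S by (simp add: nn_integral_cmult_indicator emeasure_eq_measure)
  also have "\<dots> \<le> (\<integral>\<^sup>+\<omega>. ?\<Gamma> (ennreal (X (stopped_time \<theta> T \<omega>) \<omega>)) \<partial>P)"
  proof (intro nn_integral_mono)
    fix \<omega>
    show "ennreal g * indicator ?S \<omega> \<le> ?\<Gamma> (ennreal (X (stopped_time \<theta> T \<omega>) \<omega>))"
    proof (cases "\<omega> \<in> ?S")
      case True
      then have "?\<Gamma> (ennreal \<delta>) \<le> ?\<Gamma> (ennreal (X (stopped_time \<theta> T \<omega>) \<omega>))"
        by (intro E.recip_mono ennreal_leI) simp
      with g(2) True show ?thesis by (simp add: order_trans)
    qed simp
  qed
  also have "\<dots> \<le> (\<integral>\<^sup>+\<omega>. ennreal (A (stopped_time \<theta> T \<omega>) \<omega>) \<partial>P)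
      + ?\<Gamma> (\<integral>\<^sup>+\<omega>. ennreal (H (stopped_time \<theta> T \<omega>) \<omega>) \<partial>P)"
    by (rule key_inequality_lift[OF e \<theta>(1) T])
  also have "\<dots> \<le> ennreal k + ennreal (h / \<eta> e)"
  proof (rule add_mono)
    have "(\<integral>\<^sup>+\<omega>. ennreal (A (stopped_time \<theta> T \<omega>) \<omega>) \<partial>P) \<le> (\<integral>\<^sup>+\<omega>. ennreal (min (A T \<omega>) k) \<partial>P)"
      by (rule stopped_A_le[OF \<theta>(2)])
    also have "\<dots> \<le> (\<integral>\<^sup>+\<omega>. ennreal k \<partial>P)" by (intro nn_integral_mono ennreal_leI) simp
    finally show "(\<integral>\<^sup>+\<omega>. ennreal (A (stopped_time \<theta> T \<omega>) \<omega>) \<partial>P) \<le> ennreal k"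
      by (simp add: emeasure_space_1)
    have "?\<Gamma> (\<integral>\<^sup>+\<omega>. ennreal (H (stopped_time \<theta> T \<omega>) \<omega>) \<partial>P) \<le> ?\<Gamma> (ennreal h)"
      using stopped_H_le[OF T, of \<theta>] h(2) by (intro E.recip_mono) (rule order_trans)
    also have "\<dots> \<le> ennreal (h / \<eta> e)" by (rule E.recip_le[OF e h(1)])
    finally show "?\<Gamma> (\<integral>\<^sup>+\<omega>. ennreal (H (stopped_time \<theta> T \<omega>) \<omega>) \<partial>P) \<le> ennreal (h / \<eta> e)" .
  qed
  finally have "ennreal (g * measure P ?S) \<le> ennreal (k + h / \<eta> e)"
    using g(1) k h(1) e0 by (simp add: ennreal_mult' flip: ennreal_plus)
  then have "g * measure P ?S \<le> k + h / \<eta> e"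
    using k h(1) e0 by (subst (asm) ennreal_le_iff) (auto intro!: add_nonneg_nonneg divide_nonneg_pos)
  then have "measure P ?S \<le> (k + h / \<eta> e) / g" using g(1) by (simp add: pos_le_divide_eq mult.commute)
  then show "measure P {\<omega>\<in>space P. ennreal \<delta> < running_sup X T \<omega>}
    \<le> (k + h / \<eta> e) / g + measure P {\<omega>\<in>space P. k \<le> A T \<omega>} + d" using \<theta>(3) by simp
qed

end

text \<open>\<open>\<Gamma>(\<delta>)\<close> for the function raised to \<open>\<eta> e\<close>
  contains the integral of \<open>1 / \<eta>\<close> over \<open>(e, \<delta>)\<close>, which grows
  to the divergent Osgood integral as \<open>e\<close> falls to \<open>0\<close>.\<close>

lemma (in eta_function) osgood_recip_unbounded:
  assumes os: "osgood_at_0 \<eta>" and \<delta>: "0 < \<delta>"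
  shows "\<exists>e>0. ennreal g \<le> recip_integral (lift e) (ennreal \<delta>)"
proof -
  have "lower_integral \<eta> \<delta> 0 = \<top>" using os \<delta> by (simp add: osgood_at_0_def lower_integral_def)
  with lower_integral_limit[OF \<delta>] have "(\<lambda>n. lower_integral \<eta> \<delta> (\<delta> * inverse (real (Suc n)))) \<longlonglongrightarrow> \<top>" by simp
  then have "\<forall>\<^sub>F n in sequentially. ennreal g < lower_integral \<eta> \<delta> (\<delta> * inverse (real (Suc n)))"
    by (intro order_tendstoD(1)) auto
  then obtain N where N: "\<And>n. N \<le> n \<Longrightarrow> ennreal g < lower_integral \<eta> \<delta> (\<delta> * inverse (real (Suc n)))"
    unfolding eventually_sequentially by blast
  \<comment> \<open>The extra \<open>Suc\<close> gives \<open>e < \<delta>\<close> even for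
    \<open>N = 0\<close>.\<close>
  define e where "e = \<delta> * inverse (real (Suc (Suc N)))"
  have "inverse (real (Suc (Suc N))) < 1" by (simp add: inverse_less_1_iff)
  then have e: "0 < e" "e < \<delta>" using \<delta> mult_strict_left_mono[of "inverse (real (Suc (Suc N)))" 1 \<delta>] by (auto simp: e_def)
  have "lower_integral \<eta> \<delta> e \<le> recip_integral (lift e) (ennreal \<delta>)"
    using recip_lower(2)[OF e(1) less_imp_le[OF e(2)], of e] e by (simp add: add_increasing)
  moreover have "ennreal g < lower_integral \<eta> \<delta> e" unfolding e_def by (rule N) simp
  ultimately show ?thesis using e(1) by (intro exI[of _ e]) auto
qed

context usual_filtered_prob_space
begin

text \<open>The order of the choices is the point. The level \<open>k\<close> comes first and works
  for all \<open>n\<close> because \<open>A\<close> is shared. Osgood's condition then makes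
  \<open>\<Gamma>(\<delta>)\<close> large compared with \<open>k\<close>, at the price of a small
  \<open>e\<close>; only afterwards is \<open>E[H]\<close> required to be small compared with
  \<open>\<eta> e\<close>.\<close>

lemma sup_tendsto_zero:
  assumes cond: "\<And>n::nat. condition_A_sup P F \<eta> (Xn n) A (Hn n) (Mn n)"
    and unb: "filterlim \<eta> at_top at_top" and os: "osgood_at_0 \<eta>" and T: "0 \<le> T"
    and H: "(\<lambda>n. \<integral>\<^sup>+\<omega>. ennreal (Hn n T \<omega>) \<partial>P) \<longlonglongrightarrow> 0" and \<delta>: "0 < \<delta>"
  shows "(\<lambda>n. measure P {\<omega>\<in>space P. ennreal \<delta> < running_sup (Xn n) T \<omega>}) \<longlonglongrightarrow> 0"
proof (rule order_tendstoI)
  have A_sup: "A_sup_unbounded P F \<eta> (Xn n) A (Hn n) (Mn n)" for n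
    by unfold_locales (use cond unb in auto)
  interpret A0: A_sup_unbounded P F \<eta> "Xn 0" A "Hn 0" "Mn 0" by (rule A_sup)
  fix r :: real assume r: "0 < r"
  have "\<forall>\<^sub>F n in sequentially. measure P {\<omega>\<in>space P. real n \<le> A T \<omega>} < r / 3"
    using r by (intro order_tendstoD(2)[OF A0.A_level_tendsto[OF T]]) simp
  then obtain N where N: "\<And>n. N \<le> n \<Longrightarrow> measure P {\<omega>\<in>space P. real n \<le> A T \<omega>} < r / 3"
    unfolding eventually_sequentially by blast
  define k where "k = real (Suc N)"
  have k: "0 < k" "measure P {\<omega>\<in>space P. k \<le> A T \<omega>} < r / 3" using N[of "Suc N"] by (auto simp: k_def)
  define g where "g = 3 * k / r"
  have g: "0 < g" using k r by (simp add: g_def)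
  obtain e where e: "0 < e" "ennreal g \<le> recip_integral (A0.E.lift e) (ennreal \<delta>)"
    using A0.E.osgood_recip_unbounded[OF os \<delta>] by blast
  \<comment> \<open>With \<open>g\<close> and \<open>h\<close> so chosen,
    \<open>k / g = r / 3\<close> and \<open>h / \<eta> e / g = r / 4\<close>; the probability that
    \<open>A\<close> reaches \<open>k\<close> is below \<open>r / 3\<close>, so the total stays
    below \<open>r\<close>.\<close>
  define h where "h = r / 4 * g * \<eta> e"
  have e0: "0 < \<eta> e" using A0.eta_pos[OF e(1)] .
  have h: "0 < h" using r g e0 by (simp add: h_def)
  have "\<forall>\<^sub>F n in sequentially. (\<integral>\<^sup>+\<omega>. ennreal (Hn n T \<omega>) \<partial>P) < ennreal h"
    using h by (intro order_tendstoD(2)[OF H]) simp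
  then show "\<forall>\<^sub>F n in sequentially. measure P {\<omega>\<in>space P. ennreal \<delta> < running_sup (Xn n) T \<omega>} < r"
  proof eventually_elim
    fix n assume Hn: "(\<integral>\<^sup>+\<omega>. ennreal (Hn n T \<omega>) \<partial>P) < ennreal h"
    have "measure P {\<omega>\<in>space P. ennreal \<delta> < running_sup (Xn n) T \<omega>}
      \<le> (k + h / \<eta> e) / g + measure P {\<omega>\<in>space P. k \<le> A T \<omega>}"
      using A_sup_unbounded.tail_bound[OF A_sup T k(1) e(1) less_imp_le[OF \<delta>] g e(2) less_imp_le[OF h] less_imp_le[OF Hn]] .
    also have "(k + h / \<eta> e) / g = r / 3 + r / 4"
      using k r e0 g by (simp add: h_def g_def field_simps)
    finally show "measure P {\<omega>\<in>space P. ennreal \<delta> < running_sup (Xn n) T \<omega>} < r" using k(2) r by simp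
  qed
next
  fix a :: real assume "a < 0"
  then show "\<forall>\<^sub>F n in sequentially. a < measure P {\<omega>\<in>space P. ennreal \<delta> < running_sup (Xn n) T \<omega>}"
    by (intro always_eventually allI less_le_trans[OF _ measure_nonneg])
qed

end

context A_sup_unbounded
begin

text \<open>The convergence result applied to a constant sequence: a constant probability that tends
  to \<open>0\<close> is \<open>0\<close>, for every threshold \<open>1 / (n + 1)\<close>.\<close>

lemma sup_eq_zero:
  assumes os: "osgood_at_0 \<eta>" and T: "0 \<le> T" and H0: "AE \<omega> in P. H T \<omega> = 0"
  shows "AE \<omega> in P. running_sup X T \<omega> = 0"
proof -
  have "(\<integral>\<^sup>+\<omega>. ennreal (H T \<omega>) \<partial>P) = (\<integral>\<^sup>+\<omega>. 0 \<partial>P)"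
    using H0 by (intro nn_integral_cong_AE) (auto elim!: eventually_mono)
  then have "(\<lambda>n::nat. measure P {\<omega>\<in>space P. ennreal \<delta> < running_sup X T \<omega>}) \<longlonglongrightarrow> 0" if "0 < \<delta>" for \<delta>
    using that sup_tendsto_zero[of \<eta> "\<lambda>n. X" A "\<lambda>n. H" "\<lambda>n. M" T \<delta>] cond eta_unbounded os T by simp
  then have m: "measure P {\<omega>\<in>space P. ennreal \<delta> < running_sup X T \<omega>} = 0" if "0 < \<delta>" for \<delta>
    using that LIMSEQ_unique[OF tendsto_const] by blast
  have "AE \<omega> in P. running_sup X T \<omega> \<le> ennreal (inverse (real (Suc n)))" for n
  proof -
    have "{\<omega>\<in>space P. ennreal (inverse (real (Suc n))) < running_sup X T \<omega>} \<in> sets P"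
      using running_sup_measurable[OF T] by measurable
    with m[of "inverse (real (Suc n))"] show ?thesis
      by (subst AE_iff_measurable[OF _ refl]) (simp_all add: not_le emeasure_eq_measure del: of_nat_Suc)
  qed
  then have "AE \<omega> in P. \<forall>n. running_sup X T \<omega> \<le> ennreal (inverse (real (Suc n)))"
    by (simp add: AE_all_countable)
  then show ?thesis
  proof eventually_elim
    fix \<omega> assume "\<forall>n. running_sup X T \<omega> \<le> ennreal (inverse (real (Suc n)))"
    then have "running_sup X T \<omega> \<le> ennreal 0"
      by (intro LIMSEQ_le_const[OF tendsto_ennrealI[OF LIMSEQ_inverse_real_of_nat]]) blast
    then show "running_sup X T \<omega> = 0" by simp
  qed
qed

end

section \<open>Lenglart's inequality\<close>

lemma nn_integral_powr_from_0:
  fixes p c :: real assumes p: "0 < p" and c: "0 \<le> c"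
  shows "(\<integral>\<^sup>+x. ennreal (p * x powr (p - 1)) * indicator {0..c} x \<partial>lborel) = ennreal (c powr p)"
proof -
  have "((\<lambda>x. x powr (p - 1)) has_integral (c powr (p - 1 + 1) / (p - 1 + 1))) {0..c}"
    using p c by (intro has_integral_powr_from_0) auto
  from has_integral_mult_right[OF this, of p] p
  have "((\<lambda>x. p * x powr (p - 1)) has_integral (c powr p)) {0..c}" by simp
  then show ?thesis using p by (intro nn_integral_has_integral_lebesgue') auto
qed

lemma nn_integral_powr_to_inf:
  fixes p c :: real assumes p: "p < 1" and c: "0 < c"
  shows "(\<integral>\<^sup>+x. ennreal (x powr (p - 2)) * indicator {c..} x \<partial>lborel) = ennreal (c powr (p - 1) / (1 - p))"
proof -
  have "((\<lambda>x. x powr (p - 2)) has_integral (- (c powr (p - 2 + 1)) / (p - 2 + 1))) {c..}"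
    using p c by (intro has_integral_powr_to_inf) auto
  moreover have "- (c powr (p - 2 + 1)) / (p - 2 + 1) = c powr (p - 1) / (1 - p)"
  proof -
    have e: "p - 2 + 1 = p - 1" by simp
    show ?thesis unfolding e using p by (simp add: divide_simps) (simp add: algebra_simps)
  qed
  ultimately have "((\<lambda>x. x powr (p - 2)) has_integral (c powr (p - 1) / (1 - p))) {c..}" by simp
  then show ?thesis by (intro nn_integral_has_integral_lebesgue') auto
qed

lemma ennreal_powr_ennreal: "0 \<le> x \<Longrightarrow> ennreal_powr (ennreal x) p = ennreal (x powr p)"
  by (simp add: ennreal_powr_def)

lemma ennreal_powr_mono:
  assumes "x \<le> y" "0 \<le> p" shows "ennreal_powr x p \<le> ennreal_powr y p"
proof (cases "y = \<top>")
  case False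
  then have "x \<noteq> \<top>" "enn2real x \<le> enn2real y" using assms(1) by (auto simp: top_unique less_top intro!: enn2real_mono)
  then show ?thesis using False assms(2) by (auto simp: ennreal_powr_def intro!: ennreal_leI powr_mono2)
qed (simp add: ennreal_powr_def)

lemma ennreal_powr_mult:
  assumes "0 < a" shows "ennreal_powr (ennreal a * z) p = ennreal (a powr p) * ennreal_powr z p"
proof (cases z)
  case (real x)
  then have "ennreal_powr (ennreal a * z) p = ennreal_powr (ennreal (a * x)) p"
    using assms by (simp add: ennreal_mult)
  also have "\<dots> = ennreal ((a * x) powr p)" using assms real by (intro ennreal_powr_ennreal) simp
  also have "\<dots> = ennreal (a powr p) * ennreal_powr z p"
    using assms real by (simp add: powr_mult ennreal_mult ennreal_powr_ennreal)
  finally show ?thesis .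
next
  case top
  then show ?thesis using assms by (simp add: ennreal_powr_def ennreal_mult_top)
qed

lemma ennreal_powr_layer:
  assumes p: "0 < p"
  shows "ennreal_powr y p \<le> (\<integral>\<^sup>+x. ennreal (p * x powr (p - 1)) * indicator {x. 0 < x \<and> ennreal x < y} x \<partial>lborel)"
    (is "_ \<le> ?I")
proof -
  have le: "ennreal (c powr p) \<le> ?I" if c: "0 \<le> c" "ennreal c \<le> y" for c
    unfolding nn_integral_powr_from_0[OF p c(1), symmetric]
  proof (rule nn_integral_mono_AE, rule AE_mp[OF AE_lborel_singleton[of c]],
      rule AE_mp[OF AE_lborel_singleton[of 0]], intro AE_I2 impI)
    fix x :: real assume "x \<noteq> 0" "x \<noteq> c"
    moreover have "ennreal x < y" if "0 < x" "x < c"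
      using c(2) that by (auto simp: ennreal_less_iff intro: less_le_trans[of _ "ennreal c"])
    ultimately show "ennreal (p * x powr (p - 1)) * indicator {0..c} x
       \<le> ennreal (p * x powr (p - 1)) * indicator {x. 0 < x \<and> ennreal x < y} x"
      by (auto simp: indicator_def)
  qed
  show ?thesis
  proof (cases y)
    case (real c)
    then show ?thesis using le[of c] by (simp add: ennreal_powr_ennreal)
  next
    case top
    have "of_nat n \<le> ?I" for n
    proof -
      \<comment> \<open>For \<open>y = \<top>\<close> every \<open>c\<close> is admissible, and the
        choice \<open>c = n powr (1 / p)\<close> shows that the right side is at least
        \<open>n\<close>.\<close>
      have "(real n powr (1 / p)) powr p = real n" using p by (simp add: powr_powr)
      then show ?thesis using le[of "real n powr (1 / p)"] top by (simp add: ennreal_of_nat_eq_real_of_nat)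
    qed
    then have "\<not> ?I < \<top>" using ennreal_Ex_less_of_nat[of ?I] not_less by blast
    then have "?I = \<top>" by (simp add: not_less top_unique)
    then show ?thesis by simp
  qed
qed

text \<open>The constant \<open>p\<^sup>-\<^sup>p / (1 - p)\<close> is optimal: in the tail bound the truncation level \<open>\<lambda> x\<close> gives
  \<open>\<lambda>\<^sup>1\<^sup>-\<^sup>p / (1 - p) + \<lambda>\<^sup>-\<^sup>p\<close>, which is minimal at \<open>\<lambda> = p\<close>.\<close>

lemma lenglart_pointwise:
  assumes p: "0 < p" "p < 1" and b: "0 \<le> b"
  shows "(\<integral>\<^sup>+x. ennreal (p * x powr (p - 2)) * (indicator {0<..} x *
      (ennreal (min b (p * x)) + ennreal x * (if p * x \<le> b then 1 else 0))) \<partial>lborel)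
    \<le> ennreal (p powr (-p) / (1 - p) * b powr p)"
proof (cases "b = 0")
  case True
  have "ennreal (p * x powr (p - 2)) * (indicator {0<..} x *
      (ennreal (min b (p * x)) + ennreal x * (if p * x \<le> b then 1 else 0))) = 0" for x :: real
  proof (cases "0 < x")
    case True
    then have "0 < p * x" using p by simp
    then show ?thesis using \<open>b = 0\<close> by (simp add: min_def)
  qed simp
  then have "(\<integral>\<^sup>+x. ennreal (p * x powr (p - 2)) * (indicator {0<..} x *
      (ennreal (min b (p * x)) + ennreal x * (if p * x \<le> b then 1 else 0))) \<partial>lborel) = 0"
    by (simp only: nn_integral_const mult_zero_left)
  then show ?thesis by (simp only: zero_le)
next
  case False
  \<comment> \<open>The point where \<open>p x\<close> meets \<open>b\<close>: up to it both terms
    count and sum to \<open>(p + 1) x\<close>; beyond it the indicator vanishes and the minimum is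
    \<open>b\<close>.\<close>
  define c where "c = b / p"
  have c: "0 < c" "b = p * c" using False b p by (auto simp: c_def)
  have "(\<integral>\<^sup>+x. ennreal (p * x powr (p - 2)) * (indicator {0<..} x *
      (ennreal (min b (p * x)) + ennreal x * (if p * x \<le> b then 1 else 0))) \<partial>lborel)
    \<le> (\<integral>\<^sup>+x. ennreal (p + 1) * (ennreal (p * x powr (p - 1)) * indicator {0..c} x)
        + ennreal (p * b) * (ennreal (x powr (p - 2)) * indicator {c..} x) \<partial>lborel)"
  proof (intro nn_integral_mono)
    fix x :: real
    show "ennreal (p * x powr (p - 2)) * (indicator {0<..} x *
      (ennreal (min b (p * x)) + ennreal x * (if p * x \<le> b then 1 else 0)))
      \<le> ennreal (p + 1) * (ennreal (p * x powr (p - 1)) * indicator {0..c} x)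
        + ennreal (p * b) * (ennreal (x powr (p - 2)) * indicator {c..} x)"
    proof (cases "0 < x")
      case x: True
      show ?thesis
      proof (cases "x \<le> c")
        case True
        have xp: "x powr (p - 1) = x powr (p - 2) * x"
        proof -
          have "x powr (p - 1) = x powr ((p - 2) + 1)" by simp
          also have "\<dots> = x powr (p - 2) * x powr 1" by (rule powr_add)
          finally show ?thesis using x by simp
        qed
        have "p * x \<le> b" using True c p by simp
        then have "ennreal (p * x powr (p - 2)) * (indicator {0<..} x *
            (ennreal (min b (p * x)) + ennreal x * (if p * x \<le> b then 1 else 0)))
          = ennreal (p * x powr (p - 2)) * ennreal (p * x + x)"
          using x p by (simp add: min_absorb2 ennreal_plus)
        also have "\<dots> = ennreal ((p + 1) * (p * x powr (p - 1)))"
          using x p by (subst ennreal_mult[symmetric]) (auto simp: xp algebra_simps)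
        also have "\<dots> = ennreal (p + 1) * (ennreal (p * x powr (p - 1)) * indicator {0..c} x)"
          using x True p by (simp add: ennreal_mult)
        finally show ?thesis by (simp add: add_increasing2)
      next
        case False
        then have "b < p * x" using c p by simp
        then have "ennreal (p * x powr (p - 2)) * (indicator {0<..} x *
            (ennreal (min b (p * x)) + ennreal x * (if p * x \<le> b then 1 else 0)))
          = ennreal (p * x powr (p - 2)) * ennreal b"
          using x by (simp add: min_absorb1)
        also have "\<dots> = ennreal (p * b) * (ennreal (x powr (p - 2)) * indicator {c..} x)"
          using False p b by (simp add: ennreal_mult[symmetric] ac_simps)
        finally show ?thesis by simp
      qed
    qed simp
  qed
  also have "\<dots> = ennreal (p + 1) * ennreal (c powr p) + ennreal (p * b) * ennreal (c powr (p - 1) / (1 - p))"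
    using nn_integral_powr_from_0[OF p(1) less_imp_le[OF c(1)]] nn_integral_powr_to_inf[OF p(2) c(1)]
    by (simp add: nn_integral_add nn_integral_cmult)
  also have "\<dots> = ennreal ((p + 1) * c powr p + p * b * (c powr (p - 1) / (1 - p)))"
  proof -
    have "0 \<le> (p + 1) * c powr p" "0 \<le> p * b * (c powr (p - 1) / (1 - p))" using p b by auto
    then have "ennreal ((p + 1) * c powr p + p * b * (c powr (p - 1) / (1 - p)))
      = ennreal ((p + 1) * c powr p) + ennreal (p * b * (c powr (p - 1) / (1 - p)))" by (rule ennreal_plus)
    also have "\<dots> = ennreal (p + 1) * ennreal (c powr p) + ennreal (p * b) * ennreal (c powr (p - 1) / (1 - p))"
      using p b by (intro arg_cong2[where f = "(+)"] ennreal_mult) auto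
    finally show ?thesis ..
  qed
  also have "(p + 1) * c powr p + p * b * (c powr (p - 1) / (1 - p)) = p powr (-p) / (1 - p) * b powr p"
  proof -
    have "c powr p = c powr ((p - 1) + 1)" by simp
    also have "\<dots> = c powr (p - 1) * c powr 1" by (rule powr_add)
    finally have cp: "c powr p = c powr (p - 1) * c" using c by simp
    have "(p + 1) * c powr p + p * b * (c powr (p - 1) / (1 - p)) = c powr p * ((p + 1) + p * p / (1 - p))"
      unfolding c(2) cp by (simp add: algebra_simps)
    also have "(p + 1) + p * p / (1 - p) = 1 / (1 - p)" using p by (simp add: field_simps)
    also have "c powr p * (1 / (1 - p)) = p powr (-p) / (1 - p) * b powr p"
      using p b by (simp add: c_def powr_divide powr_minus_divide)
    finally show ?thesis .
  qed
  finally show ?thesis .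
qed

text \<open>The moment is bounded by the integral of \<open>p * x powr (p - 1) * P(Y > x)\<close>.
  Writing \<open>x powr (p - 1)\<close> as \<open>x powr (p - 2) * x\<close> makes the tail
  hypothesis applicable under the integral, and after Tonelli the pointwise bound with
  \<open>b = B \<omega>\<close> finishes.\<close>

lemma (in prob_space) lenglart:
  fixes Y :: "'a \<Rightarrow> ennreal" and B :: "'a \<Rightarrow> real"
  assumes p: "0 < p" "p < 1" and Y[measurable]: "Y \<in> borel_measurable M" and B[measurable]: "B \<in> borel_measurable M"
    and B0: "\<And>\<omega>. \<omega> \<in> space M \<Longrightarrow> 0 \<le> B \<omega>"
    and tail: "\<And>x. 0 < x \<Longrightarrow> ennreal x * emeasure M {\<omega>\<in>space M. ennreal x < Y \<omega>}
      \<le> (\<integral>\<^sup>+\<omega>. ennreal (min (B \<omega>) (p * x)) \<partial>M) + ennreal x * emeasure M {\<omega>\<in>space M. p * x \<le> B \<omega>}"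
  shows "(\<integral>\<^sup>+\<omega>. ennreal_powr (Y \<omega>) p \<partial>M) \<le> ennreal (p powr (-p) / (1 - p)) * (\<integral>\<^sup>+\<omega>. ennreal (B \<omega> powr p) \<partial>M)"
proof -
  interpret L: pair_sigma_finite M lborel ..
  have "(\<integral>\<^sup>+\<omega>. ennreal_powr (Y \<omega>) p \<partial>M)
     \<le> (\<integral>\<^sup>+\<omega>. \<integral>\<^sup>+x. ennreal (p * x powr (p - 1)) * (if 0 < x \<and> ennreal x < Y \<omega> then 1 else 0) \<partial>lborel \<partial>M)"
    using ennreal_powr_layer[OF p(1)] by (intro nn_integral_mono) (simp add: indicator_def of_bool_def)
  also have "\<dots> = (\<integral>\<^sup>+x. \<integral>\<^sup>+\<omega>. ennreal (p * x powr (p - 1)) * (if 0 < x \<and> ennreal x < Y \<omega> then 1 else 0) \<partial>M \<partial>lborel)"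
    by (rule L.Fubini'[symmetric]) measurable
  also have "\<dots> \<le> (\<integral>\<^sup>+x. \<integral>\<^sup>+\<omega>. ennreal (p * x powr (p - 2)) * (indicator {0<..} x *
      (ennreal (min (B \<omega>) (p * x)) + ennreal x * (if p * x \<le> B \<omega> then 1 else 0))) \<partial>M \<partial>lborel)"
  proof (rule nn_integral_mono)
    fix x :: real
    show "(\<integral>\<^sup>+\<omega>. ennreal (p * x powr (p - 1)) * (if 0 < x \<and> ennreal x < Y \<omega> then 1 else 0) \<partial>M)
      \<le> (\<integral>\<^sup>+\<omega>. ennreal (p * x powr (p - 2)) * (indicator {0<..} x *
      (ennreal (min (B \<omega>) (p * x)) + ennreal x * (if p * x \<le> B \<omega> then 1 else 0))) \<partial>M)"
    proof (cases "0 < x")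
      case x: True
      have "x powr (p - 1) = x powr ((p - 2) + 1)" by simp
      also have "\<dots> = x powr (p - 2) * x powr 1" by (rule powr_add)
      finally have xp: "ennreal (p * x powr (p - 1)) = ennreal (p * x powr (p - 2)) * ennreal x"
        using x p by (simp add: ennreal_mult[symmetric])
      have "(\<integral>\<^sup>+\<omega>. ennreal (p * x powr (p - 1)) * (if 0 < x \<and> ennreal x < Y \<omega> then 1 else 0) \<partial>M)
        = (\<integral>\<^sup>+\<omega>. ennreal (p * x powr (p - 1)) * indicator {\<omega>\<in>space M. ennreal x < Y \<omega>} \<omega> \<partial>M)"
        using x by (intro nn_integral_cong) (auto simp: indicator_def)
      also have "\<dots> = ennreal (p * x powr (p - 2)) * (ennreal x * emeasure M {\<omega>\<in>space M. ennreal x < Y \<omega>})"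
        unfolding xp mult.assoc[symmetric] by (intro nn_integral_cmult_indicator) measurable
      also have "\<dots> \<le> ennreal (p * x powr (p - 2)) * ((\<integral>\<^sup>+\<omega>. ennreal (min (B \<omega>) (p * x)) \<partial>M) + ennreal x * emeasure M {\<omega>\<in>space M. p * x \<le> B \<omega>})"
        by (intro mult_left_mono tail x) simp
      also have "ennreal x * emeasure M {\<omega>\<in>space M. p * x \<le> B \<omega>} = (\<integral>\<^sup>+\<omega>. ennreal x * (if p * x \<le> B \<omega> then 1 else 0) \<partial>M)"
      proof -
        have "(\<integral>\<^sup>+\<omega>. ennreal x * (if p * x \<le> B \<omega> then 1 else 0) \<partial>M) = (\<integral>\<^sup>+\<omega>. ennreal x * indicator {\<omega>\<in>space M. p * x \<le> B \<omega>} \<omega> \<partial>M)"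
          by (intro nn_integral_cong) (auto simp: indicator_def)
        also have "\<dots> = ennreal x * emeasure M {\<omega>\<in>space M. p * x \<le> B \<omega>}"
          by (intro nn_integral_cmult_indicator) measurable
        finally show ?thesis ..
      qed
      also have "(\<integral>\<^sup>+\<omega>. ennreal (min (B \<omega>) (p * x)) \<partial>M) + (\<integral>\<^sup>+\<omega>. ennreal x * (if p * x \<le> B \<omega> then 1 else 0) \<partial>M)
        = (\<integral>\<^sup>+\<omega>. ennreal (min (B \<omega>) (p * x)) + ennreal x * (if p * x \<le> B \<omega> then 1 else 0) \<partial>M)"
        by (intro nn_integral_add[symmetric]) measurable
      also have "ennreal (p * x powr (p - 2)) * \<dots> = (\<integral>\<^sup>+\<omega>. ennreal (p * x powr (p - 2)) * (ennreal (min (B \<omega>) (p * x)) + ennreal x * (if p * x \<le> B \<omega> then 1 else 0)) \<partial>M)"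
        by (intro nn_integral_cmult[symmetric]) measurable
      finally show ?thesis using x by simp
    qed simp
  qed
  also have "\<dots> = (\<integral>\<^sup>+\<omega>. \<integral>\<^sup>+x. ennreal (p * x powr (p - 2)) * (indicator {0<..} x *
      (ennreal (min (B \<omega>) (p * x)) + ennreal x * (if p * x \<le> B \<omega> then 1 else 0))) \<partial>lborel \<partial>M)"
    by (rule L.Fubini') measurable
  also have "\<dots> \<le> (\<integral>\<^sup>+\<omega>. ennreal (p powr (-p) / (1 - p)) * ennreal (B \<omega> powr p) \<partial>M)"
  proof (intro nn_integral_mono)
    fix \<omega> assume "\<omega> \<in> space M"
    from lenglart_pointwise[OF p B0[OF this]] p
    show "(\<integral>\<^sup>+x. ennreal (p * x powr (p - 2)) * (indicator {0<..} x *
      (ennreal (min (B \<omega>) (p * x)) + ennreal x * (if p * x \<le> B \<omega> then 1 else 0))) \<partial>lborel)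
      \<le> ennreal (p powr (-p) / (1 - p)) * ennreal (B \<omega> powr p)"
      by (simp add: ennreal_mult[symmetric])
  qed
  also have "\<dots> = ennreal (p powr (-p) / (1 - p)) * (\<integral>\<^sup>+\<omega>. ennreal (B \<omega> powr p) \<partial>M)"
    by (intro nn_integral_cmult) measurable
  finally show ?thesis .
qed

section \<open>Inverting \<open>G\<close>, and the moment bounds for the supremum\<close>

context eta_function
begin

text \<open>Beyond \<open>c\<close> the integrand is at most \<open>1 / \<eta> c\<close>. This
  supplies the continuity of \<open>G\<close> needed to attain intermediate values.\<close>

lemma upper_integral_lipschitz:
  assumes c: "0 < c" "c \<le> s" "s \<le> t"
  shows "upper_integral \<eta> c (ennreal t) \<le> upper_integral \<eta> c (ennreal s) + ennreal ((t - s) / \<eta> c)"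
proof -
  let ?g = "\<lambda>v. ennreal (1 / \<eta> (max 0 v))"
  have c0: "0 \<le> c" and ec: "0 < \<eta> c" using c pos by auto
  have "upper_integral \<eta> c (ennreal t)
    \<le> (\<integral>\<^sup>+v. ?g v * indicator {v. c < v \<and> ennreal v < ennreal s} v + ennreal (1 / \<eta> c) * indicator {s..t} v \<partial>lborel)"
    unfolding upper_eq[OF c0]
  proof (intro nn_integral_mono)
    fix v
    have "1 / \<eta> v \<le> 1 / \<eta> c" if "c < v"
      using that c ec eta_monoD[of c v] pos[of v] by (intro divide_left_mono) auto
    then show "?g v * indicator {v. c < v \<and> ennreal v < ennreal t} v
      \<le> ?g v * indicator {v. c < v \<and> ennreal v < ennreal s} v + ennreal (1 / \<eta> c) * indicator {s..t} v"
      using c by (auto simp: indicator_def ennreal_less_iff max_def not_less intro: ennreal_leI)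
  qed
  also have "\<dots> = upper_integral \<eta> c (ennreal s) + ennreal (1 / \<eta> c) * ennreal (t - s)"
    unfolding upper_eq[OF c0] using c by (simp add: nn_integral_add nn_integral_cmult_indicator)
  also have "ennreal (1 / \<eta> c) * ennreal (t - s) = ennreal ((t - s) / \<eta> c)"
    using c ec by (simp add: ennreal_mult[symmetric])
  finally show ?thesis .
qed

lemma upper_integral_le_c:
  assumes "0 < c" "z \<le> ennreal c" shows "upper_integral \<eta> c z = 0"
proof -
  have e: "{v. c < v \<and> ennreal v < z} = {}"
    using assms by (auto simp: ennreal_less_iff dest: less_le_trans)
  show ?thesis unfolding upper_integral_def e by simp
qed

text \<open>The inverse of \<open>G\<close>, by the intermediate value theorem: it turns the event
  that \<open>G\<close> of the supremum exceeds \<open>x\<close> into a passage of \<open>X\<close>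
  above \<open>\<delta>\<close>.\<close>

lemma upper_integral_attained:
  assumes c: "0 < c" and x: "0 < x" "ennreal x < upper_integral \<eta> c \<top>"
  shows "\<exists>\<delta>\<ge>c. upper_integral \<eta> c (ennreal \<delta>) = ennreal x"
proof -
  define U where "U t = enn2real (upper_integral \<eta> c (ennreal t))" for t
  have ec: "0 < \<eta> c" by (rule pos[OF c])
  have U: "upper_integral \<eta> c (ennreal t) = ennreal (U t)" if "c \<le> t" for t
    using upper_finite[OF c, of t] c that by (simp add: U_def)
  have U0: "0 \<le> U t" for t by (simp add: U_def)
  have Umono: "U s \<le> U t" if "c \<le> s" "s \<le> t" for s t
    using upper_integral_mono[of "ennreal s" "ennreal t" \<eta> c] that U[of s] U[of t] U0[of t] by (simp add: ennreal_leI)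
  have Ulip: "U t \<le> U s + (t - s) / \<eta> c" if "c \<le> s" "s \<le> t" for s t
  proof -
    have "0 \<le> (t - s) / \<eta> c" using that ec by simp
    then show ?thesis using upper_integral_lipschitz[OF c that] that U[of s] U[of t] U0[of s]
      by (simp add: ennreal_plus[symmetric] del: ennreal_plus)
  qed
  obtain n where n: "ennreal x < upper_integral \<eta> c (ennreal (real n))"
    using x(2) unfolding upper_integral_top[OF c] less_SUP_iff by blast
  have cn: "c \<le> real n"
  proof (rule ccontr)
    assume "\<not> c \<le> real n"
    then have "upper_integral \<eta> c (ennreal (real n)) = 0" by (intro upper_integral_le_c c ennreal_leI) simp
    with n show False by simp
  qed
  have lip: "dist (U s) (U t) \<le> 1 / \<eta> c * dist s t" if "c \<le> s" "c \<le> t" for s t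
    using Ulip[of s t] Ulip[of t s] Umono[of s t] Umono[of t s] that
    by (cases "s \<le> t") (auto simp: dist_real_def)
  have "(1 / \<eta> c)-lipschitz_on {c..real n} U"
    using lip ec by (intro lipschitz_onI) auto
  then have "continuous_on {c..real n} U" by (rule lipschitz_on_continuous_on)
  moreover have "U c \<le> x" using upper_integral_le_c[OF c order_refl] x by (simp add: U_def)
  moreover have "x \<le> U (real n)" using n U[OF cn] x by (simp add: ennreal_less_iff)
  ultimately obtain \<delta> where "c \<le> \<delta>" "U \<delta> = x" using IVT'[of U c x "real n"] cn by blast
  then show ?thesis using U by auto
qed

text \<open>Moving the base point from \<open>1\<close> to \<open>c\<close> changes the integral by
  a finite amount only. For \<open>c > 1\<close> the finite piece is measured by the primitive of
  \<open>1 / lift 1\<close>.\<close>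

lemma upper_integral_top_infinite:
  assumes c: "0 < c" and inf: "(\<integral>\<^sup>+u\<in>{1<..}. ennreal (1 / \<eta> u) \<partial>lborel) = \<top>"
  shows "upper_integral \<eta> c \<top> = \<top>"
proof -
  have one: "upper_integral \<eta> 1 \<top> = \<top>"
    using inf by (simp add: upper_integral_def greaterThan_def)
  show ?thesis
  proof (cases "c \<le> 1")
    case True
    then have "upper_integral \<eta> 1 \<top> \<le> upper_integral \<eta> c \<top>"
      unfolding upper_integral_def by (intro nn_integral_mono) (auto simp: indicator_def)
    then show ?thesis using one by (simp add: top_unique)
  next
    case False
    then have c1: "1 \<le> c" by simp
    have "recip_integral (lift 1) \<top> = \<top>"
      using recip_split[of 1 1 \<top>] one by simp
    moreover have "recip_integral (lift 1) \<top> = recip_integral (lift 1) (ennreal c) + upper_integral \<eta> c \<top>"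
      using c1 by (intro recip_split) auto
    moreover have "recip_integral (lift 1) (ennreal c) < \<top>" using c by (intro recip_finite) auto
    ultimately show ?thesis by auto
  qed
qed

end

context A_sup_unbounded
begin

text \<open>At time zero the integral and \<open>M\<close> vanish, so
  \<open>c \<le> X 0 \<le> H 0 \<le> H T\<close> almost surely. Hence \<open>G(E[H])\<close> is
  non-negative and free of the negative part.\<close>

lemma H_lower_bound:
  assumes T: "0 \<le> T" and X_ge: "AE \<omega> in P. \<forall>t\<in>{0..T}. c \<le> X t \<omega>"
  shows "ennreal c \<le> (\<integral>\<^sup>+\<omega>. ennreal (H T \<omega>) \<partial>P)"
proof -
  have "AE \<omega> in P. ereal (X 0 \<omega>) \<le> enn2ereal (stieltjes_integral (\<lambda>s. eta_ext \<eta> (running_sup_left X s \<omega>)) (\<lambda>s. A s \<omega>) 0)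
     + ereal (M 0 \<omega>) + ereal (H 0 \<omega>)"
    using cond unfolding condition_A_sup_def by blast
  then have "AE \<omega> in P. ennreal c \<le> ennreal (H T \<omega>)"
    using X_ge AE_space
  proof eventually_elim
    fix \<omega> assume le: "ereal (X 0 \<omega>) \<le> enn2ereal (stieltjes_integral (\<lambda>s. eta_ext \<eta> (running_sup_left X s \<omega>)) (\<lambda>s. A s \<omega>) 0)
       + ereal (M 0 \<omega>) + ereal (H 0 \<omega>)"
      and X: "\<forall>t\<in>{0..T}. c \<le> X t \<omega>" and \<omega>: "\<omega> \<in> space P"
    have "X 0 \<omega> \<le> H 0 \<omega>" using le M_0[OF \<omega>] by (simp add: stieltjes_integral_def zero_ennreal.rep_eq)
    moreover have "H 0 \<omega> \<le> H T \<omega>" using H_mono[OF \<omega> order_refl T] .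
    moreover have "c \<le> X 0 \<omega>" using X T by simp
    ultimately show "ennreal c \<le> ennreal (H T \<omega>)" by (intro ennreal_leI) linarith
  qed
  then have "(\<integral>\<^sup>+\<omega>. ennreal c \<partial>P) \<le> (\<integral>\<^sup>+\<omega>. ennreal (H T \<omega>) \<partial>P)" by (rule nn_integral_mono_AE)
  then show ?thesis by (simp add: emeasure_space_1)
qed

text \<open>The hypothesis of Lenglart's inequality for \<open>G\<close> of the supremum, with
  dominating variable \<open>A T + g\<close> and any truncation \<open>y\<close>. If
  \<open>y \<le> g\<close>, the last event is certain and the claim trivial; if \<open>x\<close> is
  at least the limit of \<open>G\<close>, the event on the left is empty.\<close>

lemma dominated_tail:
  assumes T: "0 \<le> T" and c: "0 < c" and X_ge: "AE \<omega> in P. \<forall>t\<in>{0..T}. c \<le> X t \<omega>"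
    and g: "0 \<le> g" "upper_integral \<eta> c (\<integral>\<^sup>+\<omega>. ennreal (H T \<omega>) \<partial>P) = ennreal g"
    and x: "0 < x"
  shows "ennreal x * emeasure P {\<omega>\<in>space P. ennreal x < upper_integral \<eta> c (running_sup X T \<omega>)}
    \<le> (\<integral>\<^sup>+\<omega>. ennreal (min (A T \<omega> + g) y) \<partial>P) + ennreal x * emeasure P {\<omega>\<in>space P. y \<le> A T \<omega> + g}"
    (is "ennreal x * emeasure P ?Y \<le> ?I + ennreal x * emeasure P ?E")
proof (cases "y \<le> g")
  case True
  have "?E = space P" using A_nonneg[OF _ T] True by (fastforce intro: order_trans)
  moreover have "emeasure P ?Y \<le> 1" by (rule emeasure_le_1)
  ultimately show ?thesis
    using mult_left_mono[of "emeasure P ?Y" 1 "ennreal x"] by (simp add: emeasure_space_1 add_increasing)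
next
  case False
  \<comment> \<open>If \<open>A\<close> is kept at most \<open>y - g\<close>, then
    \<open>A + g\<close> is kept at most \<open>y\<close>, which is the truncation claimed.\<close>
  define k where "k = y - g"
  have k: "0 < k" using False by (simp add: k_def)
  have AT[measurable]: "A T \<in> borel_measurable P" by (rule A_meas[OF T])
  show ?thesis
  proof (cases "ennreal x < upper_integral \<eta> c \<top>")
    case False
    then have "?Y = {}" using upper_integral_mono[of _ \<top> \<eta> c] by (auto dest: less_le_trans)
    then have z: "emeasure P ?Y = 0" by (simp only: emeasure_empty)
    show ?thesis unfolding z by simp
  next
    case True
    then obtain \<delta> where \<delta>: "c \<le> \<delta>" "upper_integral \<eta> c (ennreal \<delta>) = ennreal x"
      using E.upper_integral_attained[OF c x] by blast
    let ?S = "{\<omega>\<in>space P. ennreal \<delta> < running_sup X T \<omega>}"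
    have S: "?S \<in> sets P" using running_sup_measurable[OF T] by measurable
    have YS: "?Y \<subseteq> ?S"
    proof
      fix \<omega> assume \<omega>: "\<omega> \<in> ?Y"
      have "\<not> running_sup X T \<omega> \<le> ennreal \<delta>"
        using \<omega> \<delta>(2) upper_integral_mono[of "running_sup X T \<omega>" "ennreal \<delta>" \<eta> c] by auto
      then show "\<omega> \<in> ?S" using \<omega> by (simp add: not_le)
    qed
    have "ennreal x * emeasure P ?S \<le> ?I + ennreal x * emeasure P ?E"
    proof (rule ennreal_le_epsilon)
      fix d :: real assume d: "0 < d"
      \<comment> \<open>The announcement error is multiplied by \<open>x\<close> at the end, hence
        \<open>d / x\<close>.\<close>
      have "0 < d / x" using d x by simp
      obtain \<theta> where \<theta>: "is_stopping_time F \<theta>" "AE \<omega> in P. A (stopped_time \<theta> T \<omega>) \<omega> \<le> min (A T \<omega>) k"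
        "measure P ?S \<le> measure P {\<omega>\<in>space P. \<delta> \<le> X (stopped_time \<theta> T \<omega>) \<omega>} + measure P {\<omega>\<in>space P. k \<le> A T \<omega>} + d / x"
        using passage_before_level[OF T k \<open>0 < d / x\<close>] by blast
      let ?R = "{\<omega>\<in>space P. \<delta> \<le> X (stopped_time \<theta> T \<omega>) \<omega>}"
      let ?\<Gamma> = "recip_integral (E.lift c)"
      let ?h = "\<integral>\<^sup>+\<omega>. ennreal (H T \<omega>) \<partial>P"
      have R: "?R \<in> sets P" using stopped_X_measurable[OF \<theta>(1), of T] by measurable
      have fin: "?\<Gamma> (ennreal c) < \<top>" using c by (intro E.recip_finite) auto
      \<comment> \<open>Since \<open>X \<ge> c\<close> and \<open>E[H] \<ge> c\<close>, both
        \<open>\<Gamma>(X)\<close> and \<open>\<Gamma>(E[H])\<close> split into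
        \<open>\<Gamma>(c)\<close> and a value of \<open>G\<close>; the common finite term is
        carried along and then cancelled.\<close>
      have "?\<Gamma> (ennreal c) + ennreal x * emeasure P ?R = (\<integral>\<^sup>+\<omega>. ?\<Gamma> (ennreal c) + ennreal x * indicator ?R \<omega> \<partial>P)"
        using R by (subst nn_integral_add) (auto simp: nn_integral_cmult_indicator emeasure_space_1)
      also have "\<dots> \<le> (\<integral>\<^sup>+\<omega>. ?\<Gamma> (ennreal (X (stopped_time \<theta> T \<omega>) \<omega>)) \<partial>P)"
      proof (rule nn_integral_mono_AE, rule eventually_mono[OF X_ge])
        fix \<omega> assume "\<forall>t\<in>{0..T}. c \<le> X t \<omega>"
        then have cX: "c \<le> X (stopped_time \<theta> T \<omega>) \<omega>" using stopped_time_le[OF T, of \<theta> \<omega>] by simp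
        have "ennreal x * indicator ?R \<omega> \<le> upper_integral \<eta> c (ennreal (X (stopped_time \<theta> T \<omega>) \<omega>))"
        proof (cases "\<omega> \<in> ?R")
          case True
          then show ?thesis using upper_integral_mono[of "ennreal \<delta>" _ \<eta> c] \<delta>(2) by (simp add: ennreal_leI)
        qed simp
        then show "?\<Gamma> (ennreal c) + ennreal x * indicator ?R \<omega> \<le> ?\<Gamma> (ennreal (X (stopped_time \<theta> T \<omega>) \<omega>))"
          using E.recip_split[OF c order_refl ennreal_leI[OF cX]] by (simp add: add_left_mono)
      qed
      also have "\<dots> \<le> (\<integral>\<^sup>+\<omega>. ennreal (A (stopped_time \<theta> T \<omega>) \<omega>) \<partial>P)
          + ?\<Gamma> (\<integral>\<^sup>+\<omega>. ennreal (H (stopped_time \<theta> T \<omega>) \<omega>) \<partial>P)"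
        by (rule key_inequality_lift[OF c \<theta>(1) T])
      also have "\<dots> \<le> (\<integral>\<^sup>+\<omega>. ennreal (min (A T \<omega>) k) \<partial>P) + ?\<Gamma> ?h"
        by (intro add_mono stopped_A_le \<theta>(2) E.recip_mono stopped_H_le T)
      also have "?\<Gamma> ?h = ?\<Gamma> (ennreal c) + ennreal g"
        using E.recip_split[OF c order_refl H_lower_bound[OF T X_ge]] g(2) by simp
      finally have "?\<Gamma> (ennreal c) + ennreal x * emeasure P ?R
         \<le> ?\<Gamma> (ennreal c) + ((\<integral>\<^sup>+\<omega>. ennreal (min (A T \<omega>) k) \<partial>P) + ennreal g)" by (simp add: ac_simps)
      then have "ennreal x * emeasure P ?R \<le> (\<integral>\<^sup>+\<omega>. ennreal (min (A T \<omega>) k) \<partial>P) + ennreal g"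
        using fin by (auto simp: ennreal_add_left_cancel_le)
      also have "\<dots> = (\<integral>\<^sup>+\<omega>. ennreal (min (A T \<omega>) k) + ennreal g \<partial>P)"
        by (subst nn_integral_add) (auto simp: emeasure_space_1)
      also have "\<dots> = ?I"
      proof (intro nn_integral_cong)
        fix \<omega> assume "\<omega> \<in> space P"
        from A_nonneg[OF this T] have "ennreal (min (A T \<omega>) k) + ennreal g = ennreal (min (A T \<omega>) k + g)"
          using k g(1) by (intro ennreal_plus[symmetric]) auto
        then show "ennreal (min (A T \<omega>) k) + ennreal g = ennreal (min (A T \<omega> + g) y)"
          by (simp add: k_def min_add_distrib_left[symmetric] min_def)
      qed
      finally have R_le: "ennreal x * emeasure P ?R \<le> ?I" .
      have Ek: "?E = {\<omega>\<in>space P. k \<le> A T \<omega>}" by (auto simp: k_def)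
      have "emeasure P ?S \<le> emeasure P ?R + emeasure P ?E + ennreal (d / x)"
        unfolding Ek emeasure_eq_measure using \<theta>(3) \<open>0 < d / x\<close>
        by (simp add: ennreal_plus[symmetric] del: ennreal_plus)
      then have "ennreal x * emeasure P ?S \<le> ennreal x * (emeasure P ?R + emeasure P ?E + ennreal (d / x))"
        by (rule mult_left_mono) simp
      also have "\<dots> = ennreal x * emeasure P ?R + ennreal x * emeasure P ?E + ennreal d"
        using x d by (simp add: distrib_left ennreal_mult[symmetric])
      also have "\<dots> \<le> ?I + ennreal x * emeasure P ?E + ennreal d"
        by (intro add_right_mono R_le)
      finally show "ennreal x * emeasure P ?S \<le> ?I + ennreal x * emeasure P ?E + ennreal d" .
    qed
    moreover have "ennreal x * emeasure P ?Y \<le> ennreal x * emeasure P ?S"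
      using emeasure_mono[OF YS S] by (intro mult_left_mono) auto
    ultimately show ?thesis by (rule order_trans[rotated])
  qed
qed

lemma moment_bound:
  assumes T: "0 \<le> T" and c: "0 < c" and X_ge: "AE \<omega> in P. \<forall>t\<in>{0..T}. c \<le> X t \<omega>"
    and g: "0 \<le> g" "upper_integral \<eta> c (\<integral>\<^sup>+\<omega>. ennreal (H T \<omega>) \<partial>P) = ennreal g"
    and p: "0 < p" "p < 1"
  shows "(\<integral>\<^sup>+\<omega>. ennreal_powr (upper_integral \<eta> c (running_sup X T \<omega>)) p \<partial>P)
    \<le> ennreal (p powr (-p) / (1 - p)) * (\<integral>\<^sup>+\<omega>. ennreal ((A T \<omega> + g) powr p) \<partial>P)"
proof (rule lenglart[OF p])
  show "(\<lambda>\<omega>. upper_integral \<eta> c (running_sup X T \<omega>)) \<in> borel_measurable P"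
    by (rule measurable_compose[OF running_sup_measurable[OF T] E.upper_integral_measurable]) (use c in simp)
  show "(\<lambda>\<omega>. A T \<omega> + g) \<in> borel_measurable P" using A_meas[OF T] by measurable
  show "0 \<le> A T \<omega> + g" if "\<omega> \<in> space P" for \<omega> using A_nonneg[OF that T] g by simp
qed (rule dominated_tail[OF T c X_ge g])

lemma G_ext_running_sup:
  assumes T: "0 \<le> T" and c: "0 < c" and X_ge: "AE \<omega> in P. \<forall>t\<in>{0..T}. c \<le> X t \<omega>"
  shows "AE \<omega> in P. G_ext \<eta> c (running_sup X T \<omega>) = enn2ereal (upper_integral \<eta> c (running_sup X T \<omega>))"
  using X_ge
proof (rule eventually_mono)
  fix \<omega> assume "\<forall>t\<in>{0..T}. c \<le> X t \<omega>"
  then have "ennreal c \<le> ennreal (X T \<omega>)" using T by (intro ennreal_leI) simp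
  also have "\<dots> \<le> running_sup X T \<omega>" unfolding running_sup_def using T by (intro SUP_upper) simp
  finally show "G_ext \<eta> c (running_sup X T \<omega>) = enn2ereal (upper_integral \<eta> c (running_sup X T \<omega>))"
    by (simp add: E.G_ext_eq[OF c])
qed

text \<open>The constant is the power \<open>1 / p\<close> of \<open>p powr (-p) / (1 - p)\<close>.
  As \<open>X\<close> and \<open>E[H]\<close> are at least \<open>c\<close>, the values of
  \<open>G\<close> are non-negative, so the absolute values in the norms are harmless; if
  \<open>G(E[H])\<close> is infinite, so is the right side.\<close>

lemma G_sup_Lp_bound:
  assumes T: "0 \<le> T" and c: "0 < c" and X_ge: "AE \<omega> in P. \<forall>t\<in>{0..T}. c \<le> X t \<omega>"
    and p: "0 < p" "p < 1"
  shows "Lp_norm P p (\<lambda>\<omega>. G_ext \<eta> c (running_sup X T \<omega>))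
    \<le> ennreal ((1 - p) powr (- 1 / p)) * ennreal (1 / p) *
       Lp_norm P p (\<lambda>\<omega>. ereal (A T \<omega>) + G_ext \<eta> c (\<integral>\<^sup>+\<omega>. ennreal (H T \<omega>) \<partial>P))"
proof -
  let ?h = "\<integral>\<^sup>+\<omega>. ennreal (H T \<omega>) \<partial>P"
  have Gh: "G_ext \<eta> c ?h = enn2ereal (upper_integral \<eta> c ?h)"
    using H_lower_bound[OF T X_ge] by (simp add: E.G_ext_eq[OF c])
  show ?thesis
  proof (cases "upper_integral \<eta> c ?h")
    case (real g)
    have rhs: "Lp_norm P p (\<lambda>\<omega>. ereal (A T \<omega>) + G_ext \<eta> c ?h)
      = ennreal_powr (\<integral>\<^sup>+\<omega>. ennreal ((A T \<omega> + g) powr p) \<partial>P) (1 / p)"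
      unfolding Lp_norm_def
    proof (intro arg_cong2[where f = ennreal_powr] nn_integral_cong refl)
      fix \<omega> assume \<omega>: "\<omega> \<in> space P"
      have A0: "0 \<le> A T \<omega> + g" using A_nonneg[OF \<omega> T] real by simp
      have "ereal (A T \<omega>) + G_ext \<eta> c ?h = ereal (A T \<omega> + g)" using real by (simp add: Gh enn2ereal_ennreal)
      then show "ennreal_powr (e2ennreal \<bar>ereal (A T \<omega>) + G_ext \<eta> c ?h\<bar>) p = ennreal ((A T \<omega> + g) powr p)"
        using A0 by (simp add: ennreal_powr_ennreal e2ennreal_ereal)
    qed
    have lhs: "Lp_norm P p (\<lambda>\<omega>. G_ext \<eta> c (running_sup X T \<omega>))
      = ennreal_powr (\<integral>\<^sup>+\<omega>. ennreal_powr (upper_integral \<eta> c (running_sup X T \<omega>)) p \<partial>P) (1 / p)"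
      unfolding Lp_norm_def
      by (intro arg_cong2[where f = ennreal_powr] nn_integral_cong_AE refl
          eventually_mono[OF G_ext_running_sup[OF T c X_ge]]) simp
    have "Lp_norm P p (\<lambda>\<omega>. G_ext \<eta> c (running_sup X T \<omega>))
      \<le> ennreal_powr (ennreal (p powr (-p) / (1 - p)) * (\<integral>\<^sup>+\<omega>. ennreal ((A T \<omega> + g) powr p) \<partial>P)) (1 / p)"
      unfolding lhs using p real by (intro ennreal_powr_mono moment_bound[OF T c X_ge]) auto
    also have "\<dots> = ennreal ((p powr (-p) / (1 - p)) powr (1 / p)) * Lp_norm P p (\<lambda>\<omega>. ereal (A T \<omega>) + G_ext \<eta> c ?h)"
      unfolding rhs using p by (intro ennreal_powr_mult) simp
    also have "(p powr (-p) / (1 - p)) powr (1 / p) = (1 - p) powr (- 1 / p) * (1 / p)"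
      using p by (simp add: powr_divide powr_powr powr_minus_divide powr_mult)
    also have "ennreal ((1 - p) powr (- 1 / p) * (1 / p)) = ennreal ((1 - p) powr (- 1 / p)) * ennreal (1 / p)"
      using p by (intro ennreal_mult) auto
    finally show ?thesis .
  next
    case top
    have "(\<lambda>\<omega>. ereal (A T \<omega>) + G_ext \<eta> c ?h) = (\<lambda>_. \<infinity>)" by (simp add: Gh top)
    then have "Lp_norm P p (\<lambda>\<omega>. ereal (A T \<omega>) + G_ext \<eta> c ?h) = \<top>"
      by (simp add: Lp_norm_def ennreal_powr_def emeasure_space_1)
    then show ?thesis using p by (simp add: ennreal_mult_top ennreal_mult[symmetric])
  qed
qed

text \<open>The moment bound is finite by
  \<open>(a + g)\<^sup>p \<le> 2\<^sup>p (a\<^sup>p + g\<^sup>p)\<close>, so \<open>G\<close> of the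
  supremum is finite almost surely, whereas divergence of the integral of \<open>1 / \<eta>\<close>
  makes \<open>G\<close> infinite at \<open>\<top>\<close>.\<close>

lemma sup_finite:
  assumes T: "0 \<le> T" and c: "0 < c" and X_ge: "AE \<omega> in P. \<forall>t\<in>{0..T}. c \<le> X t \<omega>"
    and p: "0 < p" "p < 1"
    and inf: "(\<integral>\<^sup>+u\<in>{1<..}. ennreal (1 / \<eta> u) \<partial>lborel) = \<top>"
    and Ap: "(\<integral>\<^sup>+\<omega>. ennreal (A T \<omega> powr p) \<partial>P) < \<top>"
    and H: "(\<integral>\<^sup>+\<omega>. ennreal (H T \<omega>) \<partial>P) < \<top>"
  shows "AE \<omega> in P. running_sup X T \<omega> < \<top>"
proof -
  let ?h = "\<integral>\<^sup>+\<omega>. ennreal (H T \<omega>) \<partial>P"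
  have "upper_integral \<eta> c ?h < \<top>"
    using H E.upper_finite[OF c, of "enn2real ?h"] by simp
  then obtain g where g: "0 \<le> g" "upper_integral \<eta> c ?h = ennreal g"
    by (cases "upper_integral \<eta> c ?h") auto
  have AT[measurable]: "A T \<in> borel_measurable P" by (rule A_meas[OF T])
  have "(\<integral>\<^sup>+\<omega>. ennreal ((A T \<omega> + g) powr p) \<partial>P)
    \<le> (\<integral>\<^sup>+\<omega>. ennreal (2 powr p) * (ennreal (A T \<omega> powr p) + ennreal (g powr p)) \<partial>P)"
  proof (intro nn_integral_mono)
    fix \<omega> assume \<omega>: "\<omega> \<in> space P"
    let ?a = "A T \<omega>"
    have a: "0 \<le> ?a" by (rule A_nonneg[OF \<omega> T])
    have "(?a + g) powr p \<le> (2 * max ?a g) powr p" using a g p by (intro powr_mono2) auto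
    also have "\<dots> = 2 powr p * max ?a g powr p" using a by (intro powr_mult)
    also have "\<dots> \<le> 2 powr p * (?a powr p + g powr p)" by (intro mult_left_mono) (auto simp: max_def)
    finally show "ennreal ((?a + g) powr p) \<le> ennreal (2 powr p) * (ennreal (?a powr p) + ennreal (g powr p))"
      by (simp add: ennreal_leI ennreal_mult[symmetric] ennreal_plus[symmetric] del: ennreal_plus)
  qed
  also have "\<dots> = ennreal (2 powr p) * ((\<integral>\<^sup>+\<omega>. ennreal (A T \<omega> powr p) \<partial>P) + ennreal (g powr p))"
    by (simp add: nn_integral_cmult nn_integral_add emeasure_space_1)
  also have "\<dots> < \<top>" using Ap by (simp add: ennreal_mult_less_top)
  finally have "ennreal (p powr (-p) / (1 - p)) * (\<integral>\<^sup>+\<omega>. ennreal ((A T \<omega> + g) powr p) \<partial>P) < \<top>"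
    by (simp add: ennreal_mult_less_top)
  then have fin: "(\<integral>\<^sup>+\<omega>. ennreal_powr (upper_integral \<eta> c (running_sup X T \<omega>)) p \<partial>P) < \<top>"
    using moment_bound[OF T c X_ge g p] by (rule le_less_trans[rotated])
  have "ennreal_powr z p = (if z = \<top> then \<top> else ennreal (enn2real z powr p))" for z
    by (simp add: ennreal_powr_def)
  then have "(\<lambda>z. ennreal_powr z p) = (\<lambda>z. if z = \<top> then \<top> else ennreal (enn2real z powr p))" by (rule ext)
  then have [measurable]: "(\<lambda>z. ennreal_powr z p) \<in> borel_measurable borel" by simp
  have [measurable]: "(\<lambda>\<omega>. upper_integral \<eta> c (running_sup X T \<omega>)) \<in> borel_measurable P"
    by (rule measurable_compose[OF running_sup_measurable[OF T] E.upper_integral_measurable]) (use c in simp)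
  have "AE \<omega> in P. ennreal_powr (upper_integral \<eta> c (running_sup X T \<omega>)) p \<noteq> \<infinity>"
    using fin by (intro nn_integral_PInf_AE) auto
  then show ?thesis
  proof (rule eventually_mono)
    fix \<omega> assume *: "ennreal_powr (upper_integral \<eta> c (running_sup X T \<omega>)) p \<noteq> \<infinity>"
    have "running_sup X T \<omega> \<noteq> \<top>"
      using * E.upper_integral_top_infinite[OF c inf] by (auto simp: ennreal_powr_def)
    then show "running_sup X T \<omega> < \<top>" by (simp add: less_top)
  qed
qed

end

theorem theorem3p11:
  fixes P :: "'a measure" and F :: "real \<Rightarrow> 'a measure"
    and \<eta> :: "real \<Rightarrow> real" and c :: real
    and X A H M :: "real \<Rightarrow> 'a \<Rightarrow> real"
  assumes "usual_filtered_prob_space P F"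
    and "condition_A_sup P F \<eta> X A H M"
    and "filterlim \<eta> at_top at_top"
    and "c > 0"
  shows
    "(\<forall>\<tau> T. is_stopping_time F \<tau> \<longrightarrow> T \<ge> 0 \<longrightarrow>
          ereal_expectation P (\<lambda>\<omega>. G \<eta> c (X (stopped_time \<tau> T \<omega>) \<omega>))
            \<le> enn2ereal (\<integral>\<^sup>+\<omega>. ennreal (A (stopped_time \<tau> T \<omega>) \<omega>) \<partial>P)
               + G_ext \<eta> c (\<integral>\<^sup>+\<omega>. ennreal (H (stopped_time \<tau> T \<omega>) \<omega>) \<partial>P)) \<and>
     (\<forall>T\<ge>0. osgood_at_0 \<eta> \<longrightarrow> (AE \<omega> in P. H T \<omega> = 0) \<longrightarrow>
          (AE \<omega> in P. running_sup X T \<omega> = 0)) \<and>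
     (\<forall>T\<ge>0. \<forall>(Xn :: nat \<Rightarrow> real \<Rightarrow> 'a \<Rightarrow> real) Hn Mn.
          (\<forall>n. condition_A_sup P F \<eta> (Xn n) A (Hn n) (Mn n)) \<longrightarrow>
          osgood_at_0 \<eta> \<longrightarrow>
          (\<lambda>n. \<integral>\<^sup>+\<omega>. ennreal (Hn n T \<omega>) \<partial>P) \<longlonglongrightarrow> 0 \<longrightarrow>
          (\<forall>\<delta>>0. (\<lambda>n. measure P {\<omega>\<in>space P. running_sup (Xn n) T \<omega> > ennreal \<delta>}) \<longlonglongrightarrow> 0)) \<and>
     (\<forall>T>0. (AE \<omega> in P. \<forall>t\<in>{0..T}. X t \<omega> \<ge> c) \<longrightarrow>
          (\<forall>p\<in>{0<..<1}.
             Lp_norm P p (\<lambda>\<omega>. G_ext \<eta> c (running_sup X T \<omega>))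
               \<le> ennreal ((1 - p) powr (- 1 / p)) * ennreal (1 / p) *
                  Lp_norm P p (\<lambda>\<omega>. ereal (A T \<omega>) + G_ext \<eta> c (\<integral>\<^sup>+\<omega>. ennreal (H T \<omega>) \<partial>P)) \<and>
             ((\<integral>\<^sup>+u\<in>{1<..}. ennreal (1 / \<eta> u) \<partial>lborel) = \<top> \<longrightarrow>
              (\<integral>\<^sup>+\<omega>. ennreal (A T \<omega> powr p) \<partial>P) < \<top> \<longrightarrow>
              (\<integral>\<^sup>+\<omega>. ennreal (H T \<omega>) \<partial>P) < \<top> \<longrightarrow>
              (AE \<omega> in P. running_sup X T \<omega> < \<top>))))"
proof -
  interpret usual_filtered_prob_space P F by fact
  interpret S: A_sup_unbounded P F \<eta> X A H M by standard (fact assms)+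
  show ?thesis
  proof (intro conjI allI impI ballI)
    fix \<tau> T assume "is_stopping_time F \<tau>" "0 \<le> (T::real)"
    then show "ereal_expectation P (\<lambda>\<omega>. G \<eta> c (X (stopped_time \<tau> T \<omega>) \<omega>))
            \<le> enn2ereal (\<integral>\<^sup>+\<omega>. ennreal (A (stopped_time \<tau> T \<omega>) \<omega>) \<partial>P)
               + G_ext \<eta> c (\<integral>\<^sup>+\<omega>. ennreal (H (stopped_time \<tau> T \<omega>) \<omega>) \<partial>P)"
      by (rule S.expectation_G_le[OF assms(4)])
  next
    fix T :: real assume "0 \<le> T" "osgood_at_0 \<eta>" "AE \<omega> in P. H T \<omega> = 0"
    then show "AE \<omega> in P. running_sup X T \<omega> = 0" by (intro S.sup_eq_zero)
  next
    fix T \<delta> :: real and Xn :: "nat \<Rightarrow> real \<Rightarrow> 'a \<Rightarrow> real" and Hn Mn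
    assume "0 \<le> T" "\<forall>n. condition_A_sup P F \<eta> (Xn n) A (Hn n) (Mn n)" "osgood_at_0 \<eta>"
      "(\<lambda>n. \<integral>\<^sup>+\<omega>. ennreal (Hn n T \<omega>) \<partial>P) \<longlonglongrightarrow> 0" "0 < \<delta>"
    then show "(\<lambda>n. measure P {\<omega>\<in>space P. running_sup (Xn n) T \<omega> > ennreal \<delta>}) \<longlonglongrightarrow> 0"
      using assms(3) by (intro sup_tendsto_zero[where \<eta> = \<eta> and Hn = Hn and Mn = Mn]) auto
  next
    fix T p :: real
    assume T: "0 < T" and X_ge: "AE \<omega> in P. \<forall>t\<in>{0..T}. c \<le> X t \<omega>" and p: "p \<in> {0<..<1}"
    then show "Lp_norm P p (\<lambda>\<omega>. G_ext \<eta> c (running_sup X T \<omega>))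
               \<le> ennreal ((1 - p) powr (- 1 / p)) * ennreal (1 / p) *
                  Lp_norm P p (\<lambda>\<omega>. ereal (A T \<omega>) + G_ext \<eta> c (\<integral>\<^sup>+\<omega>. ennreal (H T \<omega>) \<partial>P))"
      using assms(4) by (intro S.G_sup_Lp_bound) auto
    assume "(\<integral>\<^sup>+u\<in>{1<..}. ennreal (1 / \<eta> u) \<partial>lborel) = \<top>"
      "(\<integral>\<^sup>+\<omega>. ennreal (A T \<omega> powr p) \<partial>P) < \<top>" "(\<integral>\<^sup>+\<omega>. ennreal (H T \<omega>) \<partial>P) < \<top>"
    with T X_ge p show "AE \<omega> in P. running_sup X T \<omega> < \<top>"
      using assms(4) by (intro S.sup_finite) auto
  qed
qed

end
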